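(* Let $X=(\mathbb R,|\cdot|,\gamma)$ be the one-dimensional centred Gaussian space with unit variance, let $X^n=(\mathbb R^n,|\cdot|_{\ell_2},\gamma^{\otimes n})$ be its $n$-fold Cartesian product, let $X^\infty=(\mathbb R^\infty,\tau^\infty,\ell_2,\gamma^{\otimes\infty})$ be its infinite product (with $\tau^\infty$ the product topology and $\ell_2(x,y)=(\sum_{i=1}^\infty(x_i-y_i)^2)^{1/2}\in[0,\infty]$), and let $\mathbb W$ be the abstract Wiener space (with infinite-dimensional Cameron–Martin space). Then $$\overline{\mathcal P_{\mathbb W}}^{\square}=\overline{\mathcal P_{X^\infty}}^{\square}=\overline{\bigcup_{n\in\mathbb N}\mathcal P_{X^n}}^{\square}.$$
   Context: An mm-space is a complete separable metric space with a Borel probability measure; $\mathcal X$ is the set of mm-isomorphism classes (isomorphism: measure-preserving map that is distance-preserving on the support). An emm-space is $(X,\tau,d,m)$ with $(X,\tau)$ Polish, $d:X\times X\to[0,+\infty]$ a complete, $\tau\times\tau$-lower semicontinuous extended distance whose induced topology is finer than or equal to $\tau$, and $m$ a $\tau$-Borel probability measure. Mm-spaces are emm-spaces with the metric topology. For emm-spaces, $Y\prec X$ means: there are a measurable $\varphi:X\to Y$ with $\varphi_\#m_X=m_Y$ and $E$ with $m_X(E)=1$ such that $d_Y(\varphi(x),\varphi(y))\le d_X(x,y)$ on $E\times E$. $\mathcal P_X=\{Y\in\mathcal X:Y\prec X\}$. Box distance on $\mathcal X$: a parameter is a Borel map $\iota_X:[0,1)\to X$ with $(\iota_X)_\#\mathrm{Leb}=m_X$;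 $\square(X,Y)$ is the infimum over parameters of the infimum of $\varepsilon\ge0$ such that some Borel $I_0\subset[0,1)$ has $\mathrm{Leb}(I_0)\ge1-\varepsilon$ and $|d_X(\iota_X(s),\iota_X(t))-d_Y(\iota_Y(s),\iota_Y(t))|\le\varepsilon$ on $I_0\times I_0$; $\overline{\,\cdot\,}^\square$ is closure in $(\mathcal X,\square)$. An abstract Wiener space is a triple $(W,H,\mu)$: $H$ a separable real Hilbert space continuously and densely embedded in a separable real Banach space $W$, and $\mu$ the centred Gaussian measure on $W$ with Cameron–Martin space $H$ (each $\ell\in W^*$ is centred Gaussian under $\mu$ with variance $\|h_\ell\|_H^2$, where $\ell(h)=\langle h,h_\ell\rangle_H$ for $h\in H$). It is regarded as the emm-space $\mathbb W=(W,\tau_W,d_H,\mu)$, with $\tau_W$ the norm topology of $W$ and $d_H(w_1,w_2)=\|w_1-w_2\|_H$ if $w_1-w_2\in H$, $+\infty$ otherwise. *)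

theory Defs
  imports "HOL-Probability.Probability"
begin

section \<open>Mm-spaces and extended mm-spaces\<close>

definition borel_of :: "'a topology \<Rightarrow> 'a measure"
  where "borel_of T = sigma (topspace T) {U. openin T U}"

text \<open>
  The carrier of an mm-space is the explicit set \<^term>\<open>mspace (fst X)\<close>, the carrier of an
  emm-space is \<^term>\<open>topspace (etop X)\<close>; values of the distances off the carrier are irrelevant.
\<close>

type_synonym 'a mm = "'a metric \<times> 'a measure"

definition mm_space :: "'a mm \<Rightarrow> bool" where
  "mm_space X \<longleftrightarrow>
     mcomplete_of (fst X) \<and> separable_space (mtopology_of (fst X)) \<and>
     prob_space (snd X) \<and>
     space (snd X) = mspace (fst X) \<and> sets (snd X) = sets (borel_of (mtopology_of (fst X)))"

record 'a emm =
  etop :: "'a topology"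
  edist :: "'a \<Rightarrow> 'a \<Rightarrow> ennreal"
  emeas :: "'a measure"

definition emm_space :: "'a emm \<Rightarrow> bool" where
  "emm_space X \<longleftrightarrow> (let \<tau> = etop X; S = topspace \<tau>; d = edist X; m = emeas X in
     completely_metrizable_space \<tau> \<and> separable_space \<tau> \<and>
     (\<forall>x\<in>S. \<forall>y\<in>S. d x y = 0 \<longleftrightarrow> x = y) \<and>
     (\<forall>x\<in>S. \<forall>y\<in>S. d x y = d y x) \<and>
     (\<forall>x\<in>S. \<forall>y\<in>S. \<forall>z\<in>S. d x z \<le> d x y + d y z) \<and>
     (\<forall>\<sigma>::nat \<Rightarrow> 'a. range \<sigma> \<subseteq> S \<and> (\<forall>\<epsilon>>0. \<exists>N. \<forall>i\<ge>N. \<forall>j\<ge>N. d (\<sigma> i) (\<sigma> j) < \<epsilon>)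
        \<longrightarrow> (\<exists>x\<in>S. (\<lambda>i. d (\<sigma> i) x) \<longlonglongrightarrow> 0)) \<and>
     (\<forall>a. openin (prod_topology \<tau> \<tau>) {(x, y) \<in> S \<times> S. a < d x y}) \<and>
     (\<forall>U. openin \<tau> U \<longrightarrow> (\<forall>x\<in>U. \<exists>\<epsilon>>0. \<forall>y\<in>S. d x y < \<epsilon> \<longrightarrow> y \<in> U)) \<and>
     prob_space m \<and> space m = S \<and> sets m = sets (borel_of \<tau>))"

definition emm_of :: "'a mm \<Rightarrow> 'a emm" where
  "emm_of X = \<lparr>etop = mtopology_of (fst X), edist = (\<lambda>x y. ennreal (mdist (fst X) x y)),
               emeas = snd X\<rparr>"

lemma emm_space_emm_of:
  assumes "mm_space X"
  shows "emm_space (emm_of X)"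
proof -
  define d where "d = fst X"
  interpret Metric_space "mspace d" "mdist d" by simp
  have T: "mtopology_of d = mtopology" by (simp add: mtopology_of_def)
  have mc: mcomplete using assms by (simp add: mm_space_def mcomplete_of_def d_def)
  have lsc: "openin (prod_topology mtopology mtopology)
     {(x, y) \<in> mspace d \<times> mspace d. a < ennreal (mdist d x y)}" for a
  proof (cases a)
    case (real r)
    have "continuous_map (prod_topology mtopology mtopology) euclideanreal (\<lambda>(x,y). mdist d x y)"
      using continuous_map_mdist_alt[OF continuous_map_id, of d]
      by (simp add: T case_prod_unfold)
    from openin_continuous_map_preimage[OF this, of "{r<..}"] 
    have "openin (prod_topology mtopology mtopology)
      {x \<in> mspace d \<times> mspace d. r < (case x of (x,y) \<Rightarrow> mdist d x y)}" by simp
    moreover have "{x \<in> mspace d \<times> mspace d. r < (case x of (x,y) \<Rightarrow> mdist d x y)} =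
      {(x, y) \<in> mspace d \<times> mspace d. a < ennreal (mdist d x y)}"
      using real by (auto simp: ennreal_less_iff)
    ultimately show ?thesis by simp
  qed simp
  have cpl: "\<exists>x\<in>mspace d. (\<lambda>i. ennreal (mdist d (\<sigma> i) x)) \<longlonglongrightarrow> 0"
    if rng: "range \<sigma> \<subseteq> mspace d" 
       and cau: "\<forall>\<epsilon>>0. \<exists>N. \<forall>i\<ge>N. \<forall>j\<ge>N. ennreal (mdist d (\<sigma> i) (\<sigma> j)) < \<epsilon>" for \<sigma> :: "nat \<Rightarrow> 'a"
  proof -
    have "MCauchy \<sigma>"
      unfolding MCauchy_def
    proof (intro conjI allI impI)
      fix e :: real assume e: "e > 0"
      then obtain N where N: "\<forall>i\<ge>N. \<forall>j\<ge>N. ennreal (mdist d (\<sigma> i) (\<sigma> j)) < ennreal e"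
        using cau by (metis ennreal_less_zero_iff)
      show "\<exists>N. \<forall>n n'. N \<le> n \<longrightarrow> N \<le> n' \<longrightarrow> mdist d (\<sigma> n) (\<sigma> n') < e"
        using N e by (auto simp: ennreal_less_iff)
    qed (use rng in auto)
    then obtain x where x: "limitin mtopology \<sigma> x sequentially"
      using mc mcomplete_def by blast
    then have "x \<in> mspace d" "(\<lambda>i. mdist d (\<sigma> i) x) \<longlonglongrightarrow> 0"
      using limit_metric_sequentially limitin_metric_dist_null by blast+
    then show ?thesis
      using tendsto_ennrealI by fastforce
  qed
  have fine: "\<exists>\<epsilon>>0. \<forall>y\<in>mspace d. ennreal (mdist d x y) < \<epsilon> \<longrightarrow> y \<in> U"
    if U: "openin mtopology U" "x \<in> U" for U x
  proof -
    obtain r where r: "r > 0" "mball x r \<subseteq> U"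
      using U by (auto simp: openin_mtopology)
    have "x \<in> mspace d" using U openin_subset by fastforce
    then show ?thesis using r
      by (intro exI[of _ "ennreal r"]) (auto simp: ennreal_less_iff subset_iff)
  qed
  show ?thesis
    using assms
    unfolding emm_space_def Let_def emm_of_def mm_space_def d_def[symmetric] T
    using lsc cpl fine mc
    by (auto simp: commute completely_metrizable_space_mtopology ennreal_plus[symmetric] 
          triangle T simp del: ennreal_plus intro!: ennreal_leI)
qed

definition msupport :: "'a mm \<Rightarrow> 'a set" where
  "msupport X = {x \<in> mspace (fst X).
     \<forall>U. openin (mtopology_of (fst X)) U \<and> x \<in> U \<longrightarrow> 0 < emeasure (snd X) U}"

definition mm_iso :: "'a mm \<Rightarrow> 'b mm \<Rightarrow> bool" where
  "mm_iso X Y \<longleftrightarrow> (\<exists>f \<in> measurable (snd X) (snd Y).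
     distr (snd X) (snd Y) f = snd Y \<and>
     (\<forall>x\<in>msupport X. \<forall>y\<in>msupport X. mdist (fst Y) (f x) (f y) = mdist (fst X) x y))"

text \<open>
  A separable metric space has at most continuum many points, so every isomorphism class of
  mm-spaces has a representative whose set of points is a set of reals (lemma
  \<open>mm_space_representable\<close>).  The real numbers serve only as a pool of points here; the
  metric of the representative is unrelated to their usual distance.
\<close>

definition mm_classes :: "real mm set set" where
  "mm_classes = {X. mm_space X} // {(X, Y). mm_space X \<and> mm_space Y \<and> mm_iso X Y}"

lemma mm_space_representable:
  fixes X :: "'a mm"
  assumes X: "mm_space X"
  shows "\<exists>Y :: real mm. mm_space Y \<and> mm_iso X Y"
proof -
  define M where "M = mspace (fst X)"
  define d where "d = mdist (fst X)"
  define m where "m = snd X"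
  interpret X: Metric_space M d by (simp add: M_def d_def)
  have T: "mtopology_of (fst X) = X.mtopology" by (simp add: mtopology_of_def M_def d_def)
  have mc: "X.mcomplete" and sep: "separable_space X.mtopology"
    and pm: "prob_space m" and spm: "space m = M" and setm: "sets m = sets (borel_of X.mtopology)"
    using X by (simp_all add: mm_space_def m_def T flip: M_def, simp add: mcomplete_of_def M_def d_def)
  obtain D where D: "countable D" "D \<subseteq> M" "X.mtopology closure_of D = M"
    using sep by (auto simp: separable_space_def)
  define code where "code x = {(n, q :: rat). d x (from_nat_into D n) < of_rat q}" for x
  have "inj_on code M"
  proof (rule inj_onI, rule ccontr)
    fix x y assume xy: "x \<in> M" "y \<in> M" "code x = code y" "x \<noteq> y"
    then have "d x y / 2 > 0" by simp
    moreover have "x \<in> X.mtopology closure_of D" using D xy by simp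
    ultimately obtain z where z: "z \<in> D" "d x z < d x y / 2"
      unfolding X.metric_closure_of by fastforce
    obtain q :: rat where q: "d x z < of_rat q" "of_rat q < d x y / 2"
      using z(2) of_rat_dense by blast
    obtain n where n: "z = from_nat_into D n" 
      using z D(1) from_nat_into_surj by metis
    have "(n, q) \<in> code x" using q n by (simp add: code_def)
    then have "(n, q) \<in> code y" using xy(3) by simp
    then have "d y z < of_rat q" using n by (simp add: code_def)
    then show False using q X.triangle[of x z y] xy z D(2) X.commute[of y z] by auto
  qed
  moreover obtain g :: "(nat \<times> rat) set \<Rightarrow> real" where g: "inj g"
  proof -
    obtain h :: "nat set \<Rightarrow> real" where h: "bij h"
      using nat_sets_eqpoll_reals by (auto simp: eqpoll_def)
    have "inj (\<lambda>A. h (to_nat ` (A :: (nat \<times> rat) set)))"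
      using h by (metis (no_types, lifting) bij_is_inj inj_def inj_image_eq_iff inj_to_nat)
    then show ?thesis using that by blast
  qed
  ultimately have injf: "inj_on (g \<circ> code) M"
    by (meson comp_inj_on inj_on_subset subset_UNIV)
  define f where "f = g \<circ> code"
  define k where "k = inv_into M f"
  have kf: "k (f x) = x" if "x \<in> M" for x
    using that injf unfolding k_def f_def by (rule inv_into_f_f[rotated])
  define N where "N = f ` M"
  define e where "e = (\<lambda>u v. d (k u) (k v))"
  have kN: "k u \<in> M" "f (k u) = u" if "u \<in> N" for u
    using that kf by (auto simp: N_def)
  interpret Y: Metric_space N e
  proof
    fix u v w
    show "0 \<le> e u v" "e u v = e v u" by (auto simp: e_def X.commute)
    assume u: "u \<in> N" and v: "v \<in> N"
    show "e u v = 0 \<longleftrightarrow> u = v" using u v kN by (metis e_def X.zero)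
    assume w: "w \<in> N"
    show "e u w \<le> e u v + e v w" using u v w kN by (auto simp: e_def X.triangle)
  qed
  interpret XY: Metric_space12 M d N e ..
  have hom: "homeomorphic_map X.mtopology Y.mtopology f"
    by (rule XY.isometry_imp_homeomorphic_map) (auto simp: N_def e_def kf)
  have mcY: "Y.mcomplete"
    unfolding Y.mcomplete_def
  proof (intro allI impI)
    fix \<sigma> assume s: "Y.MCauchy \<sigma>"
    then have sN: "\<sigma> n \<in> N" for n by (auto simp: Y.MCauchy_def)
    have "X.MCauchy (k \<circ> \<sigma>)"
      using s kN sN unfolding X.MCauchy_def Y.MCauchy_def by (auto simp: e_def)
    then obtain x where x: "limitin X.mtopology (k \<circ> \<sigma>) x sequentially"
      using mc X.mcomplete_def by blast
    then have "limitin Y.mtopology (f \<circ> (k \<circ> \<sigma>)) (f x) sequentially"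
      by (rule continuous_map_limit[OF homeomorphic_imp_continuous_map[OF hom]])
    moreover have "f \<circ> (k \<circ> \<sigma>) = \<sigma>" using kN sN by auto
    ultimately show "\<exists>x. limitin Y.mtopology \<sigma> x sequentially" by auto
  qed
  have sepY: "separable_space Y.mtopology"
    using sep homeomorphic_separable_space[OF homeomorphic_map_imp_homeomorphic_space[OF hom]] by simp
  have oX: "U \<subseteq> M" if "openin X.mtopology U" for U
    using openin_subset[OF that] by simp
  have oY: "U \<subseteq> N" if "openin Y.mtopology U" for U
    using openin_subset[OF that] by simp
  define B where "B = borel_of Y.mtopology"
  have spB: "space B = N"
    unfolding B_def borel_of_def by (subst space_measure_of) (use oY in auto)
  have fm: "f \<in> measurable m B"
    unfolding B_def borel_of_def
  proof (rule measurable_measure_of)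
    show "f \<in> space m \<rightarrow> topspace Y.mtopology" unfolding Y.topspace_mtopology spm by (auto simp: N_def)
    fix U assume "U \<in> {U. openin Y.mtopology U}"
    then have "openin X.mtopology {x \<in> topspace X.mtopology. f x \<in> U}"
      using openin_continuous_map_preimage[OF homeomorphic_imp_continuous_map[OF hom]] by simp
    moreover have "{x \<in> topspace X.mtopology. f x \<in> U} = f -` U \<inter> space m"
      by (auto simp: spm)
    ultimately show "f -` U \<inter> space m \<in> sets m"
      unfolding setm borel_of_def 
      by (subst sets_measure_of) (use oX in auto)
  qed (use oY in auto)
  define Y :: "real mm" where "Y = (metric (N, e), distr m B f)"
  have mmY: "mm_space Y"
    unfolding mm_space_def Y_def
    using mcY sepY prob_space.prob_space_distr[OF pm fm] spB
    by (simp add: B_def Y.mspace_metric Y.mtopology_of)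
  have "mm_iso X Y"
    unfolding mm_iso_def
  proof (intro bexI[of _ f] conjI ballI)
    show "f \<in> measurable (snd X) (snd Y)" using fm by (simp add: Y_def m_def)
    show "distr (snd X) (snd Y) f = snd Y" 
      by (simp add: Y_def m_def) (rule distr_cong, auto)
    fix x y assume "x \<in> msupport X" "y \<in> msupport X"
    then have "x \<in> M" "y \<in> M" by (simp_all add: msupport_def M_def)
    then have "e (f x) (f y) = d x y" by (simp add: e_def kf)
    then show "mdist (fst Y) (f x) (f y) = mdist (fst X) x y"
      by (simp add: Y_def Y.mdist_metric d_def)
  qed
  with mmY show ?thesis by blast
qed

definition dominated :: "'b emm \<Rightarrow> 'a emm \<Rightarrow> bool"  (infix \<open>\<prec>\<^sub>L\<close> 50) where
  "Y \<prec>\<^sub>L X \<longleftrightarrow> (\<exists>\<phi> \<in> measurable (emeas X) (emeas Y).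
     distr (emeas X) (emeas Y) \<phi> = emeas Y \<and>
     (\<exists>E \<in> sets (emeas X). emeasure (emeas X) E = 1 \<and>
        (\<forall>x\<in>E. \<forall>y\<in>E. edist Y (\<phi> x) (\<phi> y) \<le> edist X x y)))"

definition pyramid :: "'a emm \<Rightarrow> real mm set set" where
  "pyramid X = {c \<in> mm_classes. \<exists>Y\<in>c. emm_of Y \<prec>\<^sub>L X}"

section \<open>Box distance\<close>

abbreviation Leb01 :: "real measure" where
  "Leb01 \<equiv> restrict_space lborel {0..<1}"

definition mm_parameters :: "'a mm \<Rightarrow> (real \<Rightarrow> 'a) set" where
  "mm_parameters X = {\<iota> \<in> measurable Leb01 (snd X). distr Leb01 (snd X) \<iota> = snd X}"

definition box_dist :: "'a mm \<Rightarrow> 'b mm \<Rightarrow> real" where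
  "box_dist X Y = (INF (\<iota>, \<kappa>) \<in> mm_parameters X \<times> mm_parameters Y.
     Inf {\<epsilon>. 0 \<le> \<epsilon> \<and> (\<exists>I \<in> sets Leb01. measure Leb01 I \<ge> 1 - \<epsilon> \<and>
        (\<forall>s\<in>I. \<forall>t\<in>I. \<bar>mdist (fst X) (\<iota> s) (\<iota> t) - mdist (fst Y) (\<kappa> s) (\<kappa> t)\<bar> \<le> \<epsilon>))})"

text \<open>The box distance does not depend on the representatives, so any choice will do.\<close>

definition box_class_dist :: "real mm set \<Rightarrow> real mm set \<Rightarrow> real" where
  "box_class_dist a b = box_dist (SOME X. X \<in> a) (SOME Y. Y \<in> b)"

definition box_closure :: "real mm set set \<Rightarrow> real mm set set" where
  "box_closure A = {c \<in> mm_classes. \<forall>\<epsilon>>0. \<exists>a\<in>A. box_class_dist c a < \<epsilon>}"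

section \<open>Gaussian product spaces\<close>

abbreviation std_gaussian :: "real measure" where
  "std_gaussian \<equiv> density lborel (\<lambda>x. ennreal (std_normal_density x))"

text \<open>\<open>\<real>\<^sup>n\<close> is the set of functions on \<^term>\<open>{..<n}\<close>, extended by \<^term>\<open>undefined\<close>.\<close>

definition gaussian_power :: "nat \<Rightarrow> (nat \<Rightarrow> real) mm" where
  "gaussian_power n =
     (metric (Pi\<^sub>E {..<n} (\<lambda>_. UNIV), \<lambda>x y. L2_set (\<lambda>i. x i - y i) {..<n}),
      Pi\<^sub>M {..<n} (\<lambda>_. std_gaussian))"

lemma Metric_space_L2_set:
  "Metric_space (Pi\<^sub>E {..<n} (\<lambda>_. UNIV)) (\<lambda>x y :: nat \<Rightarrow> real. L2_set (\<lambda>i. x i - y i) {..<n})"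
proof
  fix x y z :: "nat \<Rightarrow> real"
  show "0 \<le> L2_set (\<lambda>i. x i - y i) {..<n}" by (rule L2_set_nonneg)
  show "L2_set (\<lambda>i. x i - y i) {..<n} = L2_set (\<lambda>i. y i - x i) {..<n}"
    unfolding L2_set_def by (simp add: power2_commute)
  assume x: "x \<in> Pi\<^sub>E {..<n} (\<lambda>_. UNIV)" and y: "y \<in> Pi\<^sub>E {..<n} (\<lambda>_. UNIV)"
  show "L2_set (\<lambda>i. x i - y i) {..<n} = 0 \<longleftrightarrow> x = y"
    using x y by (auto simp: L2_set_eq_0_iff intro: PiE_ext)
  show "L2_set (\<lambda>i. x i - z i) {..<n}
      \<le> L2_set (\<lambda>i. x i - y i) {..<n} + L2_set (\<lambda>i. y i - z i) {..<n}"
    using L2_set_triangle_ineq[of "\<lambda>i. x i - y i" "\<lambda>i. y i - z i" "{..<n}"] by simp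
qed

lemma mspace_gaussian_power: "mspace (fst (gaussian_power n)) = Pi\<^sub>E {..<n} (\<lambda>_. UNIV)"
  and mdist_gaussian_power:
    "mdist (fst (gaussian_power n)) x y = L2_set (\<lambda>i. x i - y i) {..<n}"
  by (simp_all add: gaussian_power_def Metric_space.mspace_metric[OF Metric_space_L2_set]
        Metric_space.mdist_metric[OF Metric_space_L2_set])

definition ell2_edist :: "(nat \<Rightarrow> real) \<Rightarrow> (nat \<Rightarrow> real) \<Rightarrow> ennreal" where
  "ell2_edist x y = (if summable (\<lambda>i. (x i - y i)\<^sup>2)
                     then ennreal (sqrt (\<Sum>i. (x i - y i)\<^sup>2)) else \<infinity>)"

definition gaussian_infinite_power :: "(nat \<Rightarrow> real) emm" where
  "gaussian_infinite_power =
     \<lparr>etop = product_topology (\<lambda>_. euclideanreal) UNIV, edist = ell2_edist,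
      emeas = Pi\<^sub>M UNIV (\<lambda>_. std_gaussian)\<rparr>"

section \<open>Abstract Wiener spaces\<close>

text \<open>The centred Gaussian law with standard deviation \<open>\<sigma>\<close>; the point mass at \<open>0\<close> for \<open>\<sigma> = 0\<close>.\<close>

definition centred_gaussian :: "real \<Rightarrow> real measure" where
  "centred_gaussian \<sigma> = distr std_gaussian borel (\<lambda>x. \<sigma> * x)"

text \<open>
  The map \<open>i\<close> is the embedding of \<open>H\<close> into \<open>W\<close>.  By the Riesz representation theorem every
  continuous linear functional \<open>l\<close> on \<open>W\<close> has exactly one \<open>h\<close> as in the last condition.
\<close>

definition abstract_wiener_space ::
  "('h::{real_inner, complete_space, second_countable_topology}
     \<Rightarrow> 'w::{banach, second_countable_topology}) \<Rightarrow> 'w measure \<Rightarrow> bool" where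
  "abstract_wiener_space i \<mu> \<longleftrightarrow>
     bounded_linear i \<and> inj i \<and> closure (range i) = UNIV \<and>
     prob_space \<mu> \<and> sets \<mu> = sets borel \<and>
     (\<forall>(l :: 'w \<Rightarrow> real) h. bounded_linear l \<and> (\<forall>k. l (i k) = k \<bullet> h)
        \<longrightarrow> distr \<mu> borel l = centred_gaussian (norm h))"

definition cameron_martin_edist :: "('h::real_inner \<Rightarrow> 'w::real_normed_vector) \<Rightarrow> 'w \<Rightarrow> 'w \<Rightarrow> ennreal"
  where "cameron_martin_edist i v w =
    (if v - w \<in> range i then ennreal (norm (inv i (v - w))) else \<infinity>)"

definition wiener_emm :: "('h::real_inner \<Rightarrow> 'w::real_normed_vector) \<Rightarrow> 'w measure \<Rightarrow> 'w emm" where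
  "wiener_emm i \<mu> = \<lparr>etop = euclidean, edist = cameron_martin_edist i, emeas = \<mu>\<rparr>"

end

theory Submission
  imports Defs
begin

text \<open>
  The proof has two halves. The first shows that the Wiener space and \<open>X\<^sup>\<infinity>\<close> dominate each other, so
  that they have the same pyramid even before taking closures
  (\<open>wiener_equiv_gaussian_infinite_power\<close>). By the Hahn-Banach theorem countably many functionals separate the points of the separable space \<open>W\<close>;
  orthonormalising their Riesz representatives in \<open>H\<close> gives functionals \<open>m\<^sub>0, m\<^sub>1, \<dots>\<close> that still
  separate points and whose representatives \<open>e\<^sub>0, e\<^sub>1, \<dots>\<close> are orthonormal; the sequence is infinite
  because \<open>H\<close> is infinite-dimensional. The continuous injection \<open>T w = (m\<^sub>n w)\<^sub>n\<close> carries \<open>\<mu>\<close> to the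
  product Gaussian measure, since all finite linear combinations of the \<open>m\<^sub>n\<close> have the right law and
  characteristic functions determine joint laws (\<open>gaussian_char_imp_product\<close>), and it carries the Cameron-Martin distance to the \<open>\<ell>\<^sub>2\<close> distance. Its inverse is Borel on the image of a
  \<open>\<sigma>\<close>-compact set of full measure, which exists because \<open>\<mu>\<close> is inner regular.

  The second half compares \<open>X\<^sup>\<infinity>\<close> with the spaces \<open>X\<^sup>n\<close>. Coordinate projections give one inclusion.
  For the other, let \<open>\<phi>\<close> witness \<open>Y \<prec> X\<^sup>\<infinity>\<close> and freeze the coordinates from \<open>n\<close> on at a typical
  point \<open>z\<close>. The section \<open>x \<mapsto> \<phi> (x, z)\<close> on \<open>X\<^sup>n\<close> is still almost everywhere 1-Lipschitz, so \<open>Y\<close> with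
  its metric and the law of this section as its measure is dominated by \<open>X\<^sup>n\<close>. For large \<open>n\<close> and most
  \<open>z\<close> that law is close to \<open>m\<^sub>Y\<close> on every cell of a fixed finite partition, because the preimages of
  the cells are approximated in measure by sets that depend on finitely many coordinates only
  (\<open>good_section\<close>). Two measures on the same metric space that almost agree on a partition into small
  cells are close in the box distance (\<open>box_within_same_metric\<close>), so \<open>Y\<close> is a limit of members of
  the pyramids of the \<open>X\<^sup>n\<close> (\<open>section_approximation\<close>).

  To pass from the pyramids to their closures, and to be free to choose representatives of the
  classes, the box distance must satisfy the triangle inequality (\<open>box_dist_triangle\<close>). That needs a
  parameter for every mm-space (\<open>mm_parameters_nonempty\<close>) and a way to glue two parameters of the
  same space, which comes from a coupling of Lebesgue measure with itself (\<open>leb_coupling\<close>).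
\<close>

section \<open>Continuous linear functionals on a separable normed space\<close>

text \<open>
  The condition for \<open>c \<ge> 0\<close> is stated as an inequality; applied to \<open>c\<close> and \<open>1/c\<close> it gives positive
  homogeneity, and \<open>c = 0\<close> gives \<open>q 0 \<le> 0\<close>, hence \<open>q 0 = 0\<close> by subadditivity.
\<close>

definition sublinear :: "('a::real_vector \<Rightarrow> real) \<Rightarrow> bool" where
  "sublinear q \<longleftrightarrow> (\<forall>x y. q (x + y) \<le> q x + q y) \<and> (\<forall>c\<ge>0. \<forall>x. q (c *\<^sub>R x) \<le> c * q x)"

lemma sublinear_zero: "sublinear q \<Longrightarrow> q 0 = 0"
proof -
  assume q: "sublinear q"
  have "q (0 *\<^sub>R 0) \<le> 0 * q 0" using q unfolding sublinear_def by blast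
  moreover have "q (0 + 0) \<le> q 0 + q 0" using q unfolding sublinear_def by blast
  ultimately show ?thesis by simp
qed

lemma sublinear_lower: "sublinear q \<Longrightarrow> - q (- x) \<le> q x"
proof -
  assume q: "sublinear q"
  have "q (x + - x) \<le> q x + q (- x)" using q unfolding sublinear_def by blast
  then show ?thesis using sublinear_zero[OF q] by simp
qed

text \<open>
  Every sublinear functional lies above one that is bounded by \<open>q (x + y) - q y\<close>, namely the infimum
  of \<open>q (x + t y) - t q y\<close> over \<open>t \<ge> 0\<close>. It serves twice: a minimal sublinear functional must coincide
  with it, which forces linearity, and for \<open>q = norm\<close> it makes the linear functional attain the norm
  at \<open>y\<close>.
\<close>

lemma sublinear_tilt:
  assumes q: "sublinear q"
  obtains q' where "sublinear q'" "\<And>x. q' x \<le> q x" "\<And>x. q' x \<le> q (x + y) - q y"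
proof
  define F where "F x t = q (x + t *\<^sub>R y) - t * q y" for x t
  define q' where "q' x = (INF t\<in>{0..}. F x t)" for x
  have add: "q (x + z) \<le> q x + q z" for x z using q by (simp add: sublinear_def)
  have hom: "q (c *\<^sub>R x) \<le> c * q x" if "c \<ge> 0" for c x using q that by (simp add: sublinear_def)
  have hom': "q (c *\<^sub>R x) = c * q x" if "c > 0" for c x
  proof (rule antisym)
    have "q (inverse c *\<^sub>R (c *\<^sub>R x)) \<le> inverse c * q (c *\<^sub>R x)" using that by (intro hom) auto
    then show "c * q x \<le> q (c *\<^sub>R x)" using that by (simp add: field_simps)
  qed (use hom that in auto)
  have lb: "- q (- x) \<le> F x t" if "t \<ge> 0" for x t
  proof -
    have "q (t *\<^sub>R y) \<le> q (x + t *\<^sub>R y) + q (- x)" using add[of "x + t *\<^sub>R y" "- x"] by simp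
    moreover have "q (t *\<^sub>R y) = t * q y" using that hom' sublinear_zero[OF q] by (cases "t = 0") auto
    ultimately show ?thesis by (simp add: F_def)
  qed
  then have bdd: "bdd_below (F x ` {0..})" for x by (auto simp: bdd_below_def)
  have le: "q' x \<le> F x t" if "t \<ge> 0" for x t
    unfolding q'_def using that by (intro cINF_lower bdd) auto
  have ge: "a \<le> q' x" if "\<And>t. t \<ge> 0 \<Longrightarrow> a \<le> F x t" for a x
    unfolding q'_def using that by (intro cINF_greatest) auto
  show "q' x \<le> q x" for x using le[of 0 x] by (simp add: F_def)
  show "q' x \<le> q (x + y) - q y" for x using le[of 1 x] by (simp add: F_def)
  show "sublinear q'"
    unfolding sublinear_def
  proof (intro conjI allI impI)
    fix x z
    have *: "q' (x + z) \<le> F x s + F z t" if "s \<ge> 0" "t \<ge> 0" for s t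
    proof -
      have "F (x + z) (s + t) \<le> F x s + F z t"
        using add[of "x + s *\<^sub>R y" "z + t *\<^sub>R y"] by (simp add: F_def algebra_simps)
      with le[of "s + t" "x + z"] that show ?thesis by simp
    qed
    have "q' (x + z) - F x s \<le> q' z" if "s \<ge> 0" for s
      using *[OF that] by (intro ge) (smt (verit))
    then have "q' (x + z) - q' z \<le> q' x" by (intro ge) (smt (verit))
    then show "q' (x + z) \<le> q' x + q' z" by simp
  next
    fix c :: real and x assume c: "c \<ge> 0"
    show "q' (c *\<^sub>R x) \<le> c * q' x"
    proof (cases "c = 0")
      case True
      then show ?thesis using le[of 0 0] sublinear_zero[OF q] by (simp add: F_def)
    next
      case False
      with c have c: "c > 0" by simp
      have "q' (c *\<^sub>R x) / c \<le> q' x"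
      proof (rule ge)
        fix t :: real assume t: "t \<ge> 0"
        have "q' (c *\<^sub>R x) \<le> F (c *\<^sub>R x) (c * t)" using c t by (intro le) auto
        also have "\<dots> = c * F x t"
          using hom'[OF c, of "x + t *\<^sub>R y"] by (simp add: F_def algebra_simps)
        finally show "q' (c *\<^sub>R x) / c \<le> F x t" using c by (simp add: field_simps)
      qed
      then show ?thesis using c by (simp add: field_simps)
    qed
  qed
qed

lemma minimal_sublinear_linear:
  assumes q: "sublinear q" and min: "\<And>q'. sublinear q' \<Longrightarrow> (\<And>x. q' x \<le> q x) \<Longrightarrow> q' = q"
  shows "linear q"
proof -
  have add: "q (x + y) = q x + q y" for x y
  proof -
    obtain q' where q': "sublinear q'" "\<And>x. q' x \<le> q x" "\<And>x. q' x \<le> q (x + y) - q y"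
      using sublinear_tilt[OF q] by blast
    have "q' = q" by (rule min) (use q' in auto)
    then have "q x \<le> q (x + y) - q y" using q'(3) by simp
    moreover have "q (x + y) \<le> q x + q y" using q by (simp add: sublinear_def)
    ultimately show ?thesis by simp
  qed
  have neg: "q (- x) = - q x" for x using add[of x "- x"] sublinear_zero[OF q] by simp
  have hom: "q (c *\<^sub>R x) = c * q x" if c: "c \<ge> 0" for c x
  proof -
    have "q (c *\<^sub>R x) \<le> c * q x" "q (c *\<^sub>R (- x)) \<le> c * q (- x)"
      using q c unfolding sublinear_def by blast+
    then show ?thesis by (simp add: neg)
  qed
  show ?thesis
  proof (rule linearI)
    fix c x show "q (c *\<^sub>R x) = c *\<^sub>R q x"
      using hom[of c x] hom[of "- c" x] neg[of "c *\<^sub>R x"] by (cases "c \<ge> 0") auto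
  qed (rule add)
qed

text \<open>
  The Hahn-Banach theorem in the form used here: by Zorn's lemma there is a minimal sublinear
  functional below \<open>p\<close>, and it is linear.
\<close>

lemma linear_below_sublinear:
  assumes p: "sublinear p"
  obtains q where "linear q" "\<And>x. q x \<le> p x"
proof -
  define A where "A = {q. sublinear q \<and> q \<le> p}"
  define P where "P = (\<lambda>a b :: 'a \<Rightarrow> real. b \<le> a)"
  have "\<exists>m\<in>A. \<forall>a\<in>A. P m a \<longrightarrow> a = m"
  proof (rule predicate_Zorn)
    show "partial_order_on A (relation_of P A)"
      by (rule partial_order_on_relation_ofI) (auto simp: P_def intro: order_trans)
    fix C assume "C \<in> Chains (relation_of P A)"
    then have CA: "C \<subseteq> A" and ch: "\<And>a b. a \<in> C \<Longrightarrow> b \<in> C \<Longrightarrow> a \<le> b \<or> b \<le> a"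
      by (auto simp: Chains_def relation_of_def P_def)
    show "\<exists>u\<in>A. \<forall>a\<in>C. P a u"
    proof (cases "C = {}")
      case True then show ?thesis using p by (auto simp: A_def)
    next
      case False
      define u where "u x = (INF q\<in>C. q x)" for x
      have lb: "- p (- x) \<le> q x" if "q \<in> C" for q x
      proof -
        have "sublinear q" "q (- x) \<le> p (- x)" using that CA by (auto simp: A_def le_fun_def)
        then show ?thesis using sublinear_lower[of q x] by simp
      qed
      have bdd: "bdd_below ((\<lambda>q. q x) ` C)" for x
        using lb by (auto simp: bdd_below_def)
      have le: "u x \<le> q x" if "q \<in> C" for q x
        unfolding u_def using that by (intro cINF_lower bdd) auto
      have ge: "a \<le> u x" if "\<And>q. q \<in> C \<Longrightarrow> a \<le> q x" for a x
        unfolding u_def using that False by (intro cINF_greatest) auto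
      have "sublinear u"
        unfolding sublinear_def
      proof (intro conjI allI impI)
        fix x z
        have *: "u (x + z) \<le> q1 x + q2 z" if q12: "q1 \<in> C" "q2 \<in> C" for q1 q2
        proof -
          \<comment> \<open>Subadditivity of the infimum needs only that two members of the chain are comparable.\<close>
          obtain q where q: "q \<in> C" "q \<le> q1" "q \<le> q2" using ch[OF q12] q12 by (metis order_refl)
          have "u (x + z) \<le> q (x + z)" using q by (intro le)
          also have "\<dots> \<le> q x + q z" using q CA by (auto simp: A_def sublinear_def)
          also have "\<dots> \<le> q1 x + q2 z" using q by (intro add_mono) (auto simp: le_fun_def)
          finally show ?thesis .
        qed
        have "u (x + z) - q1 x \<le> u z" if "q1 \<in> C" for q1
          using *[OF that] by (intro ge) (smt (verit))
        then have "u (x + z) - u z \<le> u x" by (intro ge) (smt (verit))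
        then show "u (x + z) \<le> u x + u z" by simp
      next
        fix c :: real and x assume c: "c \<ge> 0"
        show "u (c *\<^sub>R x) \<le> c * u x"
        proof (cases "c = 0")
          case True
          obtain q where "q \<in> C" using False by blast
          then have "u 0 \<le> q 0" "q 0 = 0" using le CA by (auto simp: A_def intro: sublinear_zero)
          then show ?thesis using True by simp
        next
          case False
          with c have c: "c > 0" by simp
          have "u (c *\<^sub>R x) / c \<le> u x"
          proof (rule ge)
            fix q assume q: "q \<in> C"
            then have "u (c *\<^sub>R x) \<le> q (c *\<^sub>R x)" by (rule le)
            also have "\<dots> \<le> c * q x" using q CA c by (auto simp: A_def sublinear_def)
            finally show "u (c *\<^sub>R x) / c \<le> q x" using c by (simp add: field_simps)
          qed
          then show ?thesis using c by (simp add: field_simps)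
        qed
      qed
      moreover have "u \<le> p"
      proof -
        obtain q where "q \<in> C" using False by blast
        then have "u \<le> q" "q \<le> p" using le CA by (auto simp: A_def le_fun_def)
        then show ?thesis by simp
      qed
      ultimately show ?thesis using le by (auto simp: A_def P_def le_fun_def)
    qed
  qed
  then obtain m where m: "m \<in> A" "\<And>a. a \<in> A \<Longrightarrow> a \<le> m \<Longrightarrow> a = m" by (auto simp: P_def)
  have "linear m"
  proof (rule minimal_sublinear_linear)
    show "sublinear m" using m by (simp add: A_def)
    fix q' assume "sublinear q'" "\<And>x. q' x \<le> m x"
    then show "q' = m" using m by (intro m(2)) (auto simp: A_def le_fun_def intro: order_trans)
  qed
  then show ?thesis using that m by (auto simp: A_def le_fun_def)
qed

lemma norming_functional:
  fixes w :: "'w::real_normed_vector"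
  obtains l :: "'w \<Rightarrow> real" where "bounded_linear l" "\<And>x. \<bar>l x\<bar> \<le> norm x" "l w = norm w"
proof -
  have "sublinear (norm :: 'w \<Rightarrow> real)" by (simp add: sublinear_def norm_triangle_ineq)
  then obtain p where p: "sublinear p" "\<And>x. p x \<le> norm x" "\<And>x. p x \<le> norm (x + w) - norm w"
    using sublinear_tilt by blast
  then obtain l where l: "linear l" "\<And>x. l x \<le> p x" using linear_below_sublinear by blast
  have up: "l x \<le> norm x" for x using l(2)[of x] p(2)[of x] by simp
  have ab: "\<bar>l x\<bar> \<le> norm x" for x
    using up[of x] up[of "- x"] by (simp add: linear_neg[OF l(1)])
  have "bounded_linear l"
    using ab l(1) by (intro bounded_linear.intro bounded_linear_axioms.intro exI[of _ 1]) auto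
  moreover have "l w = norm w"
    using l(2)[of "- w"] p(3)[of "- w"] up[of w] by (simp add: linear_neg[OF l(1)])
  ultimately show ?thesis using that ab by blast
qed

text \<open>Functionals that attain the norm at the points of a countable dense set separate all points.\<close>

lemma countable_separating_functionals:
  obtains l :: "nat \<Rightarrow> 'w::{real_normed_vector, second_countable_topology} \<Rightarrow> real"
  where "\<And>k. bounded_linear (l k)" "\<And>w. (\<And>k. l k w = 0) \<Longrightarrow> w = 0"
proof -
  obtain D :: "'w set" where D: "countable D" "\<And>X. open X \<Longrightarrow> X \<noteq> {} \<Longrightarrow> \<exists>d\<in>D. d \<in> X"
    using countable_dense_setE by blast
  have Dne: "D \<noteq> {}" using D(2)[of UNIV] by auto
  have "\<exists>l :: 'w \<Rightarrow> real. bounded_linear l \<and> (\<forall>x. \<bar>l x\<bar> \<le> norm x) \<and> l d = norm d" for d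
    by (metis norming_functional)
  then obtain L :: "'w \<Rightarrow> 'w \<Rightarrow> real" where L: "\<And>d. bounded_linear (L d)" "\<And>d x. \<bar>L d x\<bar> \<le> norm x" "\<And>d. L d d = norm d"
    by metis
  show ?thesis
  proof (rule that[of "\<lambda>k. L (from_nat_into D k)"])
    fix w assume w: "\<And>k. L (from_nat_into D k) w = 0"
    have z: "L d w = 0" if "d \<in> D" for d
      using w from_nat_into_surj[OF D(1) that] by metis
    show "w = 0"
    proof (rule ccontr)
      assume "w \<noteq> 0"
      then obtain d where d: "d \<in> D" "d \<in> ball w (norm w / 2)" using D(2)[of "ball w (norm w / 2)"] by auto
      have "norm d = L d (d - w)"
        using z[OF d(1)] L(3)[of d] by (simp add: linear_diff[OF bounded_linear.linear[OF L(1)]])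
      also have "\<dots> \<le> norm (d - w)" using L(2)[of d "d - w"] by simp
      also have "\<dots> < norm w / 2" using d(2) by (simp add: dist_norm norm_minus_commute)
      finally have "norm d < norm w / 2" .
      moreover have "norm w \<le> norm d + norm (d - w)" using norm_triangle_sub[of w d] by (simp add: norm_minus_commute)
      ultimately show False using \<open>norm (d - w) < norm w / 2\<close> by simp
    qed
  qed (rule L(1))
qed

section \<open>Orthonormal sequences in a Hilbert space\<close>

text \<open>
  The representing vector minimises \<open>J x = \<parallel>x\<parallel>\<^sup>2 / 2 - f x\<close>; the parallelogram law makes every minimising
  sequence Cauchy.
\<close>

lemma riesz_representation:
  fixes f :: "'h::{real_inner, complete_space} \<Rightarrow> real"
  assumes f: "bounded_linear f"
  obtains h where "\<And>k. f k = k \<bullet> h"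
proof -
  interpret bounded_linear f by fact
  define J where "J x = (x \<bullet> x) / 2 - f x" for x
  obtain K where K: "\<And>x. norm (f x) \<le> norm x * K" using bounded by blast
  have lb: "- (K\<^sup>2 / 2) \<le> J x" for x
  proof -
    have "f x \<le> norm x * K" using K[of x] by simp
    moreover have "0 \<le> (norm x - K)\<^sup>2" by simp
    ultimately show ?thesis by (simp add: J_def dot_square_norm power2_diff)
  qed
  then have bdd: "bdd_below (range J)" by (auto simp: bdd_below_def)
  define m where "m = (INF x. J x)"
  have m: "m \<le> J x" for x unfolding m_def by (intro cINF_lower bdd) auto
  have "\<exists>x. J x < m + inverse (Suc n)" for n
    using cInf_lessD[of "range J" "m + inverse (Suc n)"] by (auto simp: m_def)
  then obtain x where x: "\<And>n. J (x n) < m + inverse (Suc n)" by metis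
  have par: "(norm (a - b))\<^sup>2 \<le> 4 * (J a + J b - 2 * m)" for a b
  proof -
    have "(norm (a - b))\<^sup>2 = 4 * (J a + J b - 2 * J ((1/2) *\<^sub>R (a + b)))"
      by (simp add: J_def power2_norm_eq_inner add scaleR algebra_simps inner_commute)
    with m[of "(1/2) *\<^sub>R (a + b)"] show ?thesis by simp
  qed
  have "Cauchy x"
  proof (rule metric_CauchyI)
    fix e :: real assume e: "e > 0"
    then obtain N where N: "inverse (Suc N) < e\<^sup>2 / 8"
      using reals_Archimedean[of "e\<^sup>2/8"] by auto
    have "dist (x a) (x b) < e" if "a \<ge> N" "b \<ge> N" for a b
    proof -
      have i: "inverse (Suc a) \<le> inverse (Suc N)" "inverse (Suc b) \<le> inverse (Suc N)"
        using that by (auto simp: field_simps)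
      have "(norm (x a - x b))\<^sup>2 \<le> 4 * (J (x a) + J (x b) - 2 * m)" by (rule par)
      also have "\<dots> < e\<^sup>2"
      proof -
        have "J (x a) < m + e\<^sup>2 / 8" "J (x b) < m + e\<^sup>2 / 8"
          using x[of a] x[of b] i N by (meson add_strict_left_mono less_trans le_less_trans less_le_trans add_left_mono)+
        then show ?thesis by (simp add: field_simps)
      qed
      finally show ?thesis using e by (simp add: dist_norm power2_less_imp_less)
    qed
    then show "\<exists>M. \<forall>a\<ge>M. \<forall>b\<ge>M. dist (x a) (x b) < e" by blast
  qed
  then obtain h where h: "x \<longlonglongrightarrow> h" using Cauchy_convergent convergent_def by blast
  have "(\<lambda>n. J (x n)) \<longlonglongrightarrow> J h"
    unfolding J_def by (intro tendsto_intros tendsto h) auto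
  moreover have "(\<lambda>n. m + inverse (Suc n)) \<longlonglongrightarrow> m + 0"
    by (intro tendsto_intros LIMSEQ_inverse_real_of_nat)
  ultimately have "J h \<le> m + 0"
    by (rule LIMSEQ_le) (use x in \<open>auto intro!: less_imp_le\<close>)
  then have mn: "J h \<le> J y" for y using m[of y] by simp
  have "f k = k \<bullet> h" for k
  proof (cases "k = 0")
    case False
    define a where "a = h \<bullet> k - f k"
    define K where "K = k \<bullet> k"
    have K: "K > 0" using False by (simp add: K_def)
    define t where "t = - a / K"
    have "J h \<le> J (h + t *\<^sub>R k)" by (rule mn)
    then have "0 \<le> t * a + t\<^sup>2 * K / 2"
      by (simp add: J_def a_def K_def add scaleR algebra_simps inner_commute power2_eq_square)
    also have "\<dots> = - (a\<^sup>2 / (2 * K))" using K by (simp add: t_def power2_eq_square field_simps)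
    finally have "a = 0" using K by (simp add: divide_simps)
    then show ?thesis by (simp add: a_def inner_commute)
  qed (simp add: zero)
  then show ?thesis using that by blast
qed

text \<open>Orthonormality of an infinite sequence; it includes that the vectors are distinct.\<close>

definition orthonormal :: "(nat \<Rightarrow> 'h::real_inner) \<Rightarrow> bool" where
  "orthonormal e \<longleftrightarrow> (\<forall>m n. e m \<bullet> e n = (if m = n then 1 else 0))"

text \<open>
  Orthogonalisation without normalisation. The vectors \<open>h n\<close> may be linearly dependent: then
  \<open>gram_schmidt h n\<close> is zero, and its later coefficients are \<open>0\<close> because division by zero gives zero.
\<close>

fun gram_schmidt :: "(nat \<Rightarrow> 'h::real_inner) \<Rightarrow> nat \<Rightarrow> 'h" where
  "gram_schmidt h n = h n - (\<Sum>j<n. (h n \<bullet> gram_schmidt h j / (gram_schmidt h j \<bullet> gram_schmidt h j)) *\<^sub>R gram_schmidt h j)"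

declare gram_schmidt.simps [simp del]

lemma gram_schmidt_orthogonal: "m < n \<Longrightarrow> gram_schmidt h m \<bullet> gram_schmidt h n = 0"
proof (induction n arbitrary: m rule: less_induct)
  case (less n)
  let ?g = "gram_schmidt h"
  have "?g j \<bullet> ?g m = 0" if "j < n" "j \<noteq> m" for j
    using less.IH[of j m] less.IH[of m j] that less.prems
    by (cases "j < m") (auto simp: inner_commute)
  then have "(\<Sum>j<n. (h n \<bullet> ?g j / (?g j \<bullet> ?g j)) * (?g j \<bullet> ?g m))
      = (\<Sum>j<n. if j = m then h n \<bullet> ?g m else 0)"
    by (intro sum.cong) auto
  also have "\<dots> = h n \<bullet> ?g m" using less.prems by simp
  finally show ?case
    by (subst (2) gram_schmidt.simps) (simp add: inner_diff_right inner_sum_right inner_commute)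
qed

lemma gram_schmidt_in_span: "gram_schmidt h n \<in> span (range h)"
proof (induction n rule: less_induct)
  case (less n)
  then show ?case
    by (subst gram_schmidt.simps) (intro span_diff span_sum span_scale, auto intro: span_base)
qed

lemma orthonormal_sequence_exists:
  fixes h :: "nat \<Rightarrow> 'h::real_inner"
  assumes inf: "\<nexists>B. finite B \<and> range h \<subseteq> span B"
  obtains e where "orthonormal e" "range e \<subseteq> span (range h)" "range h \<subseteq> span (range e)"
proof -
  let ?g = "gram_schmidt h"
  define S where "S = {n. ?g n \<noteq> 0}"
  have hg: "h n \<in> span (?g ` S)" for n
  proof -
    have gs: "?g j \<in> span (?g ` S)" for j
      by (cases "j \<in> S") (auto simp: S_def intro: span_base span_zero)
    have "h n = ?g n + (\<Sum>j<n. (h n \<bullet> ?g j / (?g j \<bullet> ?g j)) *\<^sub>R ?g j)"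
      using gram_schmidt.simps[of h n] by simp
    also have "\<dots> \<in> span (?g ` S)" by (intro span_add span_sum span_scale gs)
    finally show ?thesis .
  qed
  have infS: "infinite S"
  proof
    assume "finite S"
    then show False using inf hg by (metis finite_imageI image_subsetI)
  qed
  \<comment> \<open>The orthonormal sequence skips the vanishing vectors.\<close>
  define e where "e j = (1 / norm (?g (enumerate S j))) *\<^sub>R ?g (enumerate S j)" for j
  have en: "?g (enumerate S j) \<noteq> 0" for j using enumerate_in_set[OF infS, of j] by (simp add: S_def)
  have orth: "?g m \<bullet> ?g n = 0" if "m \<noteq> n" for m n
    using gram_schmidt_orthogonal[of m n h] gram_schmidt_orthogonal[of n m h] that
    by (cases "m < n") (auto simp: inner_commute)
  have "orthonormal e"
    unfolding orthonormal_def
  proof (intro allI)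
    fix m n
    show "e m \<bullet> e n = (if m = n then 1 else 0)"
    proof (cases "m = n")
      case True
      then show ?thesis using en[of n] by (simp add: e_def dot_square_norm power2_eq_square)
    next
      case False
      then have "enumerate S m \<noteq> enumerate S n"
        using infS strict_mono_enumerate strict_mono_eq by blast
      then show ?thesis using False orth by (simp add: e_def)
    qed
  qed
  moreover have "range e \<subseteq> span (range h)"
    by (auto simp: e_def intro!: span_scale gram_schmidt_in_span)
  moreover have "range h \<subseteq> span (range e)"
  proof -
    have "?g ` S \<subseteq> span (range e)"
    proof
      fix y assume "y \<in> ?g ` S"
      then obtain n where n: "n \<in> S" "y = ?g n" by blast
      then obtain j where j: "n = enumerate S j" using range_enumerate[OF infS] by blast
      have "y = norm y *\<^sub>R e j" using en[of j] n j by (simp add: e_def)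
      then show "y \<in> span (range e)" by (metis rangeI span_base span_scale)
    qed
    then have "span (?g ` S) \<subseteq> span (range e)" by (simp add: span_minimal)
    then show ?thesis using hg by blast
  qed
  ultimately show ?thesis using that by blast
qed

lemma orthonormal_norm_sum:
  assumes e: "orthonormal e" and A: "finite A"
  shows "(norm (\<Sum>k\<in>A. c k *\<^sub>R e k))\<^sup>2 = (\<Sum>k\<in>A. (c k)\<^sup>2)"
proof -
  have ee: "e k \<bullet> e j = (if j = k then 1 else 0)" for k j using e by (simp add: orthonormal_def)
  have "(norm (\<Sum>k\<in>A. c k *\<^sub>R e k))\<^sup>2 = (\<Sum>k\<in>A. \<Sum>j\<in>A. c k * c j * (if j = k then 1 else 0))"
    by (auto simp: power2_norm_eq_inner inner_sum_left inner_sum_right ee mult_ac sum_distrib_left intro!: sum.cong)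
  also have "\<dots> = (\<Sum>k\<in>A. \<Sum>j\<in>A. if j = k then (c k)\<^sup>2 else 0)"
    by (intro sum.cong) (auto simp: power2_eq_square)
  also have "\<dots> = (\<Sum>k\<in>A. (c k)\<^sup>2)" using A by simp
  finally show ?thesis .
qed

lemma bessel_summable:
  assumes e: "orthonormal e"
  shows "summable (\<lambda>n. (x \<bullet> e n)\<^sup>2)"
proof (rule summableI_nonneg_bounded[where x = "x \<bullet> x"])
  fix n
  let ?s = "\<Sum>k<n. (x \<bullet> e k) *\<^sub>R e k"
  have ss: "?s \<bullet> ?s = (\<Sum>k<n. (x \<bullet> e k)\<^sup>2)"
    using orthonormal_norm_sum[OF e, of "{..<n}" "\<lambda>k. x \<bullet> e k"] by (simp add: power2_norm_eq_inner)
  have xs: "x \<bullet> ?s = (\<Sum>k<n. (x \<bullet> e k)\<^sup>2)" by (simp add: inner_sum_right power2_eq_square)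
  have "0 \<le> (x - ?s) \<bullet> (x - ?s)" by simp
  also have "\<dots> = x \<bullet> x - 2 * (x \<bullet> ?s) + ?s \<bullet> ?s" by (simp add: algebra_simps inner_commute)
  finally show "(\<Sum>k<n. (x \<bullet> e k)\<^sup>2) \<le> x \<bullet> x" using ss xs by simp
qed simp

text \<open>The Riesz-Fischer theorem.\<close>

lemma orthonormal_series:
  fixes e :: "nat \<Rightarrow> 'h::{real_inner, complete_space}"
  assumes e: "orthonormal e" and c: "summable (\<lambda>n. (c n)\<^sup>2)"
  obtains h where "\<And>n. h \<bullet> e n = c n" "(norm h)\<^sup>2 = (\<Sum>n. (c n)\<^sup>2)"
proof -
  have ee: "e k \<bullet> e j = (if j = k then 1 else 0)" for k j using e by (simp add: orthonormal_def)
  note sq = orthonormal_norm_sum[OF e]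
  have sm: "summable (\<lambda>k. c k *\<^sub>R e k)"
    unfolding summable_iff_convergent
  proof (rule Cauchy_convergent, rule metric_CauchyI)
    fix r :: real assume r: "r > 0"
    then obtain N where N: "\<And>m n. m \<ge> N \<Longrightarrow> norm (\<Sum>k=m..<n. (c k)\<^sup>2) < r\<^sup>2"
      using c unfolding summable_Cauchy by (meson zero_less_power)
    have *: "norm (\<Sum>k=m..<n. c k *\<^sub>R e k) < r" if "m \<ge> N" for m n
    proof -
      have "(norm (\<Sum>k=m..<n. c k *\<^sub>R e k))\<^sup>2 < r\<^sup>2"
        using N[OF that, of n] by (simp add: sq)
      then show ?thesis using r by (simp add: power2_less_imp_less)
    qed
    have **: "dist (\<Sum>k<m. c k *\<^sub>R e k) (\<Sum>k<n. c k *\<^sub>R e k) < r" if "N \<le> m" "m \<le> n" for m n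
    proof -
      have "(\<Sum>k<n. c k *\<^sub>R e k) - (\<Sum>k<m. c k *\<^sub>R e k) = (\<Sum>k=m..<n. c k *\<^sub>R e k)"
        using sum_diff_nat_ivl[of 0 m n "\<lambda>k. c k *\<^sub>R e k"] that by (simp add: lessThan_atLeast0)
      then show ?thesis using *[OF that(1), of n] by (metis dist_norm norm_minus_commute)
    qed
    show "\<exists>M. \<forall>m\<ge>M. \<forall>n\<ge>M. dist (\<Sum>k<m. c k *\<^sub>R e k) (\<Sum>k<n. c k *\<^sub>R e k) < r"
    proof (intro exI[of _ N] allI impI)
      fix m n assume "N \<le> m" "N \<le> n"
      then show "dist (\<Sum>k<m. c k *\<^sub>R e k) (\<Sum>k<n. c k *\<^sub>R e k) < r"
        using **[of m n] **[of n m] by (cases "m \<le> n") (auto simp: dist_commute)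
    qed
  qed
  define h where "h = (\<Sum>k. c k *\<^sub>R e k)"
  have lim: "(\<lambda>n. \<Sum>k<n. c k *\<^sub>R e k) \<longlonglongrightarrow> h" unfolding h_def by (rule summable_LIMSEQ[OF sm])
  have "h \<bullet> e n = c n" for n
  proof -
    have "(\<lambda>N. (\<Sum>k<N. c k *\<^sub>R e k) \<bullet> e n) \<longlonglongrightarrow> h \<bullet> e n" by (intro tendsto_intros lim)
    moreover have "eventually (\<lambda>N. (\<Sum>k<N. c k *\<^sub>R e k) \<bullet> e n = c n) sequentially"
      using eventually_gt_at_top[of n]
    proof eventually_elim
      case (elim N)
      have "(\<Sum>k<N. c k *\<^sub>R e k) \<bullet> e n = (\<Sum>k<N. if k = n then c n else 0)"
        unfolding inner_sum_left by (rule sum.cong) (auto simp: ee)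
      then show ?case using elim by simp
    qed
    then have "(\<lambda>N. (\<Sum>k<N. c k *\<^sub>R e k) \<bullet> e n) \<longlonglongrightarrow> c n" by (rule tendsto_eventually)
    ultimately show ?thesis by (rule LIMSEQ_unique)
  qed
  moreover have "(norm h)\<^sup>2 = (\<Sum>n. (c n)\<^sup>2)"
  proof -
    have "(\<lambda>N. (norm (\<Sum>k<N. c k *\<^sub>R e k))\<^sup>2) \<longlonglongrightarrow> (norm h)\<^sup>2" by (intro tendsto_intros lim)
    moreover have "(\<lambda>N. (norm (\<Sum>k<N. c k *\<^sub>R e k))\<^sup>2) \<longlonglongrightarrow> (\<Sum>n. (c n)\<^sup>2)"
      using summable_LIMSEQ[OF c] by (simp add: sq)
    ultimately show ?thesis by (rule LIMSEQ_unique)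
  qed
  ultimately show ?thesis using that by blast
qed

lemma orthogonal_projection_finite:
  fixes B :: "'h::real_inner set"
  assumes "finite B"
  shows "\<exists>p\<in>span B. \<forall>b\<in>B. (x - p) \<bullet> b = 0"
  using assms
proof (induction B arbitrary: x rule: finite_induct)
  case empty
  show ?case by (auto intro: span_zero)
next
  case (insert b B)
  obtain q where q: "q \<in> span B" "\<forall>a\<in>B. (b - q) \<bullet> a = 0" using insert.IH[of b] by blast
  obtain p where p: "p \<in> span B" "\<forall>a\<in>B. (x - p) \<bullet> a = 0" using insert.IH[of x] by blast
  define c where "c = b - q"
  define p' where "p' = p + ((x - p) \<bullet> c / (c \<bullet> c)) *\<^sub>R c"
  have sub: "span B \<subseteq> span (insert b B)" by (intro span_mono) auto
  have "p' \<in> span (insert b B)"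
    using p(1) q(1) sub unfolding p'_def c_def
    by (intro span_add span_scale span_diff) (auto intro: span_base)
  moreover have B: "(x - p') \<bullet> a = 0" if "a \<in> B" for a
    using p(2) q(2) that by (simp add: p'_def c_def[symmetric] inner_diff_left inner_add_left)
  moreover have "(x - p') \<bullet> b = 0"
  proof -
    have "(x - p') \<bullet> q = 0"
      using orthogonal_to_span[of q B "x - p'"] B q(1) by (simp add: orthogonal_def)
    moreover have "(x - p') \<bullet> c = 0"
      by (cases "c = 0") (auto simp: p'_def inner_diff_left inner_add_left)
    ultimately show ?thesis by (simp add: c_def inner_diff_right)
  qed
  ultimately show ?case by blast
qed

section \<open>Gaussian characteristic functions determine the product law\<close>

text \<open>
  A version of Levy's uniqueness theorem for the image of a weighted measure: it applies the theorem
  to the law of \<open>X\<close> under the probability measure with density \<open>u / c\<close>.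
\<close>

lemma weighted_law_eqI_char:
  fixes X u :: "'a \<Rightarrow> real"
  assumes M: "prob_space M" and X [measurable]: "X \<in> borel_measurable M"
    and u [measurable]: "u \<in> borel_measurable M" and nn: "\<And>x. 0 \<le> u x" and int: "integrable M u"
    and c: "(\<integral>x. u x \<partial>M) = c" "c > 0"
    and N: "real_distribution N"
    and eq: "\<And>t. (CLINT x|M. complex_of_real (u x) * iexp (t * X x)) = complex_of_real c * char N t"
    and B: "B \<in> sets borel"
  shows "(\<integral>x. u x * indicator B (X x) \<partial>M) = c * measure N B"
proof -
  interpret M: prob_space M by fact
  define D where "D = density M (\<lambda>x. ennreal (u x / c))"
  have "(\<integral>\<^sup>+x. ennreal (u x / c) \<partial>M) = 1"
    using c nn int by (subst nn_integral_eq_integral) auto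
  then have "prob_space D"
    by (intro prob_spaceI) (simp add: D_def emeasure_density)
  then interpret D: prob_space D .
  have XD [measurable]: "X \<in> borel_measurable D" by (simp add: D_def)
  have rd: "real_distribution (distr D borel X)"
    by (rule D.real_distribution_distr) (rule XD)
  have "char (distr D borel X) = char N"
  proof
    fix t
    have "char (distr D borel X) t = (CLINT x|D. iexp (t * X x))"
      unfolding char_def by (subst integral_distr) auto
    also have "\<dots> = (CLINT x|M. (u x / c) *\<^sub>R iexp (t * X x))"
      unfolding D_def using nn c by (subst integral_density) auto
    also have "\<dots> = (CLINT x|M. (complex_of_real (u x) * iexp (t * X x)) / complex_of_real c)"
      by (intro Bochner_Integration.integral_cong) (auto simp: scaleR_conv_of_real)
    also have "\<dots> = (CLINT x|M. complex_of_real (u x) * iexp (t * X x)) / complex_of_real c"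
      by simp
    also have "\<dots> = char N t" using eq c by simp
    finally show "char (distr D borel X) t = char N t" .
  qed
  then have *: "distr D borel X = N" by (rule Levy_uniqueness[OF rd N])
  have "measure N B = (\<integral>x. indicator B x \<partial>distr D borel X)"
    unfolding * using N B by (simp add: real_distribution_def real_distribution_axioms_def sets_eq_imp_space_eq)
  also have "\<dots> = (\<integral>x. indicator B (X x) \<partial>D)" using B by (subst integral_distr) auto
  also have "\<dots> = (\<integral>x. (u x / c) *\<^sub>R indicator B (X x) \<partial>M)"
    unfolding D_def using nn c B by (subst integral_density) auto
  also have "\<dots> = (\<integral>x. u x * indicator B (X x) / c \<partial>M)"
    by (intro Bochner_Integration.integral_cong) auto
  also have "\<dots> = (\<integral>x. u x * indicator B (X x) \<partial>M) / c" by simp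
  finally show ?thesis using c by (simp add: field_simps)
qed

lemma (in prob_space) integrable_bounded:
  fixes f :: "'a \<Rightarrow> 'b::{banach, second_countable_topology}"
  assumes "f \<in> borel_measurable M" "\<And>x. norm (f x) \<le> K"
  shows "integrable M f"
  using assms by (intro integrable_const_bound[where B = K]) auto

lemma iexp_expand_cos: "complex_of_real (cos z) = (iexp z + iexp (- z)) / 2"
  by (simp add: complex_eq_iff Re_exp Im_exp)

lemma iexp_expand_sin: "complex_of_real (sin z) = (iexp z - iexp (- z)) / (2 * \<i>)"
  by (simp add: complex_eq_iff Re_exp Im_exp Re_divide Im_divide)

text \<open>
  If \<open>E[exp(i (s Z + t X))]\<close> is, for \<open>s \<in> {-1, 0, 1}\<close> and all \<open>t\<close>, as it is for independent centred
  Gaussians with variances \<open>v\<close> and \<open>1\<close>, then \<open>E[exp(i Z); X \<in> B]\<close> factorises for every Borel set \<open>B\<close>.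
  The one-dimensional uniqueness theorem suffices: it is applied to \<open>X\<close> under the nonnegative weights \<open>1\<close>, \<open>1 + cos Z\<close>
  and \<open>1 + sin Z\<close>.
\<close>

lemma iexp_integral_on_gaussian_event:
  fixes X Z :: "'a \<Rightarrow> real"
  assumes M: "prob_space M" and X [measurable]: "X \<in> borel_measurable M"
    and Z [measurable]: "Z \<in> borel_measurable M"
    and cf: "\<And>s t. s \<in> {-1, 0, 1} \<Longrightarrow>
      (CLINT x|M. iexp (s * Z x + t * X x)) = complex_of_real (exp (- (s\<^sup>2 * v + t\<^sup>2) / 2))"
    and B [measurable]: "B \<in> sets borel"
  shows "measure M {x \<in> space M. X x \<in> B} = measure std_gaussian B"
    and "(CLINT x|M. indicator B (X x) * iexp (Z x))
      = complex_of_real (exp (- v / 2) * measure std_gaussian B)"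
proof -
  interpret M: prob_space M by fact
  have N: "real_distribution std_gaussian" by (rule real_dist_normal_dist)
  let ?g = "measure std_gaussian B"
  have cint: "integrable M (\<lambda>x. iexp (s * Z x + t * X x))" for s t :: real
    by (rule M.integrable_bounded[where K = 1]) auto
  define e where "e = exp (- v / 2)"
  have ch: "char std_gaussian t = complex_of_real (exp (- (t\<^sup>2) / 2))" for t
    by (simp add: char_std_normal_distribution)
  have exs: "complex_of_real (exp (- (v + t\<^sup>2) / 2)) = complex_of_real e * char std_gaussian t" for t
    unfolding ch of_real_mult[symmetric] e_def exp_add[symmetric] by (simp add: field_simps)
  have c0: "(CLINT x|M. iexp (t * X x)) = char std_gaussian t" for t
    using cf[of 0 t] by (simp add: ch)
  have c1: "(CLINT x|M. iexp (s * Z x + t * X x)) = complex_of_real e * char std_gaussian t"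
    if "s = 1 \<or> s = -1" for s t :: real
    using that cf[of s t] exs[of t] by auto
  have cosc: "(CLINT x|M. complex_of_real (1 + cos (Z x)) * iexp (t * X x))
      = complex_of_real (1 + e) * char std_gaussian t" for t
  proof -
    have "complex_of_real (1 + cos (Z x)) * iexp (t * X x) =
      iexp (0 * Z x + t * X x) + (iexp (1 * Z x + t * X x) + iexp (-1 * Z x + t * X x)) / 2" for x
      by (simp only: of_real_add iexp_expand_cos) (simp add: algebra_simps exp_add[symmetric] add_divide_distrib)
    then have "(CLINT x|M. complex_of_real (1 + cos (Z x)) * iexp (t * X x)) =
      (CLINT x|M. iexp (0 * Z x + t * X x)) + ((CLINT x|M. iexp (1 * Z x + t * X x))
        + (CLINT x|M. iexp (-1 * Z x + t * X x))) / 2"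
      by (simp only: integral_divide_zero Bochner_Integration.integral_add cint integrable_divide Bochner_Integration.integrable_add)
    also have "\<dots> = char std_gaussian t + (2 * (complex_of_real e * char std_gaussian t)) / 2"
      by (simp only: c1 simp_thms mult_zero_left add_0 c0 mult_2)
    finally show ?thesis by (simp add: algebra_simps)
  qed
  have sinc: "(CLINT x|M. complex_of_real (1 + sin (Z x)) * iexp (t * X x))
      = complex_of_real 1 * char std_gaussian t" for t
  proof -
    have "complex_of_real (1 + sin (Z x)) * iexp (t * X x) =
      iexp (0 * Z x + t * X x) + (iexp (1 * Z x + t * X x) - iexp (-1 * Z x + t * X x)) / (2 * \<i>)" for x
      by (simp only: of_real_add iexp_expand_sin) (simp add: algebra_simps exp_add[symmetric] diff_divide_distrib)
    then have "(CLINT x|M. complex_of_real (1 + sin (Z x)) * iexp (t * X x)) =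
      (CLINT x|M. iexp (0 * Z x + t * X x)) + ((CLINT x|M. iexp (1 * Z x + t * X x))
        - (CLINT x|M. iexp (-1 * Z x + t * X x))) / (2 * \<i>)"
      by (simp only: integral_divide_zero Bochner_Integration.integral_add Bochner_Integration.integral_diff
          cint integrable_divide Bochner_Integration.integrable_add Bochner_Integration.integrable_diff)
    also have "\<dots> = char std_gaussian t"
      by (simp only: c1 simp_thms mult_zero_left add_0 c0 diff_self div_0 add_0_right)
    finally show ?thesis by simp
  qed
  have onec: "(CLINT x|M. complex_of_real 1 * iexp (t * X x))
      = complex_of_real 1 * char std_gaussian t" for t using c0[of t] by simp
  have ch0: "char std_gaussian 0 = 1" by (simp add: ch)
  have ic: "integrable M (\<lambda>x. 1 + cos (Z x))" "integrable M (\<lambda>x. 1 + sin (Z x))"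
    by (rule M.integrable_bounded[where K = 2]; measurable?; smt (verit) cos_le_one cos_ge_minus_one sin_le_one sin_ge_minus_one real_norm_def)+
  have "complex_of_real (\<integral>x. 1 + cos (Z x) \<partial>M) = complex_of_real (1 + e)"
    using cosc[of 0] by (simp only: integral_complex_of_real[symmetric] ch0) simp
  then have cc: "(\<integral>x. 1 + cos (Z x) \<partial>M) = 1 + e" using of_real_eq_iff by blast
  have "complex_of_real (\<integral>x. 1 + sin (Z x) \<partial>M) = complex_of_real 1"
    using sinc[of 0] by (simp only: integral_complex_of_real[symmetric] ch0) simp
  then have cs: "(\<integral>x. 1 + sin (Z x) \<partial>M) = 1" using of_real_eq_iff by blast
  have nn: "0 \<le> 1 + cos z" "0 \<le> 1 + sin z" for z :: real
    using cos_ge_minus_one[of z] sin_ge_minus_one[of z] by linarith+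
  have ep: "1 + e > 0" by (simp add: e_def add_pos_pos)
  have B1: "(\<integral>x. (1 + cos (Z x)) * indicator B (X x) \<partial>M) = (1 + e) * ?g"
    by (rule weighted_law_eqI_char[OF M X _ nn(1) ic(1) cc ep N cosc B]) simp
  have B2: "(\<integral>x. (1 + sin (Z x)) * indicator B (X x) \<partial>M) = 1 * ?g"
    by (rule weighted_law_eqI_char[OF M X _ nn(2) ic(2) cs _ N sinc B]) simp_all
  have B3: "(\<integral>x. 1 * indicator B (X x) \<partial>M) = 1 * ?g"
    by (rule weighted_law_eqI_char[OF M X _ _ _ _ _ N onec B]) (simp_all add: M.prob_space)
  have ii: "integrable M (\<lambda>x. indicat_real B (X x))"
     "integrable M (\<lambda>x. cos (Z x) * indicat_real B (X x))"
     "integrable M (\<lambda>x. sin (Z x) * indicat_real B (X x))"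
    by (rule M.integrable_bounded[where K = 1]; force simp: indicator_def)+
  have C: "(\<integral>x. cos (Z x) * indicator B (X x) \<partial>M) = e * ?g"
    using B1 B3 ii by (simp add: distrib_right Bochner_Integration.integral_add)
  have S: "(\<integral>x. sin (Z x) * indicator B (X x) \<partial>M) = 0"
    using B2 B3 ii by (simp add: distrib_right Bochner_Integration.integral_add)
  have "(\<lambda>x. indicat_real B (X x)) = (\<lambda>x. indicator (X -` B) x)" by (auto simp: indicator_def)
  then have "(\<integral>x. 1 * indicator B (X x) \<partial>M) = measure M (X -` B \<inter> space M)"
    by simp
  moreover have "X -` B \<inter> space M = {x \<in> space M. X x \<in> B}" by auto
  ultimately show "measure M {x \<in> space M. X x \<in> B} = ?g" using B3 by simp
  have "indicator B (X x) * iexp (Z x) = complex_of_real (cos (Z x) * indicator B (X x))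
      + \<i> * complex_of_real (sin (Z x) * indicator B (X x))" for x
    by (simp add: indicator_def cis_conv_exp[symmetric] complex_eq_iff)
  then have "(CLINT x|M. indicator B (X x) * iexp (Z x)) =
     (CLINT x|M. complex_of_real (cos (Z x) * indicator B (X x)))
      + \<i> * (CLINT x|M. complex_of_real (sin (Z x) * indicator B (X x)))"
    using ii(2,3) by (simp only: Bochner_Integration.integral_add integral_mult_right_zero
         integrable_mult_right integrable_of_real)
  also have "\<dots> = complex_of_real (e * ?g)"
    by (simp only: integral_complex_of_real C S) simp
  finally show "(CLINT x|M. indicator B (X x) * iexp (Z x)) = complex_of_real (exp (- v / 2) * ?g)"
    by (simp add: e_def)
qed

text \<open>
  Induction on the number of coordinates for all probability measures at once: conditioning on an
  event of the last coordinate does not change the joint characteristic function of the others.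
\<close>

lemma gaussian_char_imp_product:
  fixes X :: "nat \<Rightarrow> 'a \<Rightarrow> real"
  assumes "prob_space M" and "\<And>k. k < n \<Longrightarrow> X k \<in> borel_measurable M"
    and "\<And>a. (CLINT x|M. iexp (\<Sum>k<n. a k * X k x)) = complex_of_real (exp (- (\<Sum>k<n. (a k)\<^sup>2) / 2))"
    and "\<And>k. k < n \<Longrightarrow> B k \<in> sets borel"
  shows "measure M {x \<in> space M. \<forall>k<n. X k x \<in> B k} = (\<Prod>k<n. measure std_gaussian (B k))"
  using assms
proof (induction n arbitrary: M)
  case 0
  then interpret prob_space M by simp
  show ?case by (simp add: prob_space)
next
  case (Suc n)
  interpret M: prob_space M by fact
  have Xm [measurable]: "X k \<in> borel_measurable M" if "k \<le> n" for k using Suc.prems(2) that by simp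
  have Xn [measurable]: "X n \<in> borel_measurable M" by (rule Xm) simp
  have Bm [measurable]: "B k \<in> sets borel" if "k \<le> n" for k using Suc.prems(4) that by simp
  have Bn [measurable]: "B n \<in> sets borel" by (rule Bm) simp
  define Z where "Z a x = (\<Sum>k<n. a k * X k x)" for a x
  have Zm [measurable]: "Z a \<in> borel_measurable M" for a unfolding Z_def[abs_def] by measurable
  have cf: "(CLINT x|M. iexp (s * Z a x + t * X n x))
     = complex_of_real (exp (- (s\<^sup>2 * (\<Sum>k<n. (a k)\<^sup>2) + t\<^sup>2) / 2))" for s t a
  proof -
    have "(\<Sum>k<Suc n. (if k = n then t else s * a k) * X k x) = s * Z a x + t * X n x" for x
      by (simp add: Z_def sum_distrib_left mult.assoc)
    moreover have "(\<Sum>k<Suc n. (if k = n then t else s * a k)\<^sup>2) = s\<^sup>2 * (\<Sum>k<n. (a k)\<^sup>2) + t\<^sup>2"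
      by (simp add: sum_distrib_left power_mult_distrib)
    ultimately show ?thesis
      using Suc.prems(3)[of "\<lambda>k. if k = n then t else s * a k"] by simp
  qed
  let ?g = "measure std_gaussian (B n)"
  have g: "measure M {x \<in> space M. X n x \<in> B n} = ?g"
    by (rule iexp_integral_on_gaussian_event(1)[OF Suc.prems(1) Xn Zm cf Bn])
  have ie: "(CLINT x|M. indicator (B n) (X n x) * iexp (Z a x))
      = complex_of_real (exp (- (\<Sum>k<n. (a k)\<^sup>2) / 2) * ?g)" for a
    by (rule iexp_integral_on_gaussian_event(2)[OF Suc.prems(1) Xn Zm cf Bn])
  have split: "{x \<in> space M. \<forall>k<Suc n. X k x \<in> B k} = {x \<in> space M. \<forall>k<n. X k x \<in> B k} \<inter> {x \<in> space M. X n x \<in> B n}"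
    by (auto simp: less_Suc_eq)
  show ?case
  proof (cases "?g = 0")
    case True
    have "measure M {x \<in> space M. \<forall>k<Suc n. X k x \<in> B k} \<le> measure M {x \<in> space M. X n x \<in> B n}"
      unfolding split by (intro M.finite_measure_mono) auto
    then show ?thesis using True g by (simp add: measure_le_0_iff)
  next
    case False
    then have gp: "?g > 0" using measure_nonneg[of std_gaussian "B n"] by linarith
    define D where "D = density M (\<lambda>x. ennreal (indicator (B n) (X n x) / ?g))"
    have int_ind: "(\<integral>x. indicator (B n) (X n x) \<partial>M) = ?g"
    proof -
      have "(\<lambda>x. indicat_real (B n) (X n x)) = (\<lambda>x. indicator (X n -` B n) x)" by (auto simp: indicator_def)
      then have "(\<integral>x. indicator (B n) (X n x) \<partial>M) = measure M (X n -` B n \<inter> space M)"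
        by simp
      also have "X n -` B n \<inter> space M = {x \<in> space M. X n x \<in> B n}" by auto
      finally show ?thesis using g by simp
    qed
    have "(\<integral>\<^sup>+x. ennreal (indicator (B n) (X n x) / ?g) \<partial>M) = 1"
      using gp int_ind
      by (subst nn_integral_eq_integral)
         (auto intro!: M.integrable_const_bound[where B = "1 / ?g"] simp: indicator_def divide_simps)
    then have pD: "prob_space D"
      by (intro prob_spaceI) (simp add: D_def emeasure_density)
    have spD: "space D = space M" by (simp add: D_def)
    have "measure D {x \<in> space D. \<forall>k<n. X k x \<in> B k} = (\<Prod>k<n. measure std_gaussian (B k))"
    proof (rule Suc.IH[OF pD])
      fix k assume k: "k < n"
      show "X k \<in> borel_measurable D" using k by (simp add: D_def)
      show "B k \<in> sets borel" using k by simp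
    next
      fix a :: "nat \<Rightarrow> real"
      have "(CLINT x|D. iexp (Z a x)) = (CLINT x|M. (indicator (B n) (X n x) / ?g) *\<^sub>R iexp (Z a x))"
        unfolding D_def using gp by (subst integral_density) auto
      also have "\<dots> = (CLINT x|M. (indicator (B n) (X n x) * iexp (Z a x)) / complex_of_real ?g)"
        by (intro Bochner_Integration.integral_cong) (auto simp: scaleR_conv_of_real indicator_def)
      also have "\<dots> = (CLINT x|M. indicator (B n) (X n x) * iexp (Z a x)) / complex_of_real ?g"
        by simp
      also have "\<dots> = complex_of_real (exp (- (\<Sum>k<n. (a k)\<^sup>2) / 2))"
        using gp unfolding ie by simp
      finally show "(CLINT x|D. iexp (\<Sum>k<n. a k * X k x)) = complex_of_real (exp (- (\<Sum>k<n. (a k)\<^sup>2) / 2))"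
        by (simp add: Z_def)
    qed
    moreover have "measure D {x \<in> space D. \<forall>k<n. X k x \<in> B k} = measure M {x \<in> space M. \<forall>k<Suc n. X k x \<in> B k} / ?g"
    proof -
      let ?A = "{x \<in> space M. \<forall>k<n. X k x \<in> B k}"
      have A [measurable]: "?A \<in> sets M" by measurable
      have "emeasure D ?A = (\<integral>\<^sup>+x. ennreal (1 / ?g) * indicator {x \<in> space M. \<forall>k<Suc n. X k x \<in> B k} x \<partial>M)"
        unfolding D_def by (subst emeasure_density)
          (auto intro!: nn_integral_cong simp: indicator_def less_Suc_eq)
      also have "\<dots> = ennreal (1 / ?g) * emeasure M {x \<in> space M. \<forall>k<Suc n. X k x \<in> B k}"
        by (intro nn_integral_cmult_indicator) measurable
      finally show ?thesis
        using gp unfolding spD measure_def by (simp add: enn2real_mult)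
    qed
    ultimately show ?thesis using gp by (simp add: field_simps)
  qed
qed

lemma prob_space_std_gaussian: "prob_space std_gaussian"
  by (rule prob_space_normal_density) simp

lemma char_centred_gaussian:
  "(CLINT y|centred_gaussian s. iexp y) = complex_of_real (exp (- s\<^sup>2 / 2))"
proof -
  have "(CLINT y|centred_gaussian s. iexp y) = (CLINT x|std_gaussian. iexp (s * x))"
    unfolding centred_gaussian_def by (subst integral_distr) auto
  also have "\<dots> = char std_gaussian s" by (simp add: char_def)
  finally show ?thesis by (simp add: char_std_normal_distribution)
qed

lemma distr_eq_gaussian_product:
  fixes X :: "nat \<Rightarrow> 'a \<Rightarrow> real"
  assumes M: "prob_space M" and X: "\<And>k. X k \<in> borel_measurable M"
    and cf: "\<And>n a. (CLINT x|M. iexp (\<Sum>k<n. a k * X k x)) = complex_of_real (exp (- (\<Sum>k<n. (a k)\<^sup>2) / 2))"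
  shows "distr M (Pi\<^sub>M UNIV (\<lambda>_. std_gaussian)) (\<lambda>x k. X k x) = Pi\<^sub>M UNIV (\<lambda>_. std_gaussian)"
proof -
  interpret M: prob_space M by fact
  interpret G: product_prob_space "\<lambda>_::nat. std_gaussian" UNIV
    by (intro product_prob_spaceI prob_space_std_gaussian)
  have Xm [measurable]: "(\<lambda>x k. X k x) \<in> measurable M (Pi\<^sub>M UNIV (\<lambda>_. std_gaussian))"
    using X by (intro measurable_PiM_single') (auto simp: measurable_def)
  show ?thesis
  proof (rule G.PiM_eq)
    fix J :: "nat set" and A assume J: "finite J" and A: "\<And>j. j \<in> J \<Longrightarrow> A j \<in> sets std_gaussian"
    define n where "n = Suc (Max (insert 0 J))"
    have Jn: "J \<subseteq> {..<n}" using J by (auto simp: n_def less_Suc_eq_le)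
    define B where "B k = (if k \<in> J then A k else UNIV)" for k
    have Bm: "B k \<in> sets borel" for k using A by (auto simp: B_def)
    have *: "measure M {x \<in> space M. \<forall>k<n. X k x \<in> B k} = (\<Prod>k<n. measure std_gaussian (B k))"
      by (rule gaussian_char_imp_product[OF M X cf Bm])
    have "(\<Prod>k<n. measure std_gaussian (B k)) = (\<Prod>k\<in>J. measure std_gaussian (B k))"
      using Jn prob_space.prob_space[OF prob_space_std_gaussian]
      by (intro prod.mono_neutral_right) (auto simp: B_def)
    also have "\<dots> = (\<Prod>k\<in>J. measure std_gaussian (A k))" by (simp add: B_def)
    finally have pr: "measure M {x \<in> space M. \<forall>k<n. X k x \<in> B k} = (\<Prod>k\<in>J. measure std_gaussian (A k))"
      using * by simp
    have AE: "(\<Pi>\<^sub>E j\<in>J. A j) \<in> sets (Pi\<^sub>M J (\<lambda>_. std_gaussian))"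
      using J A by (intro sets_PiM_I_finite) auto
    have "emeasure (distr M (Pi\<^sub>M UNIV (\<lambda>_. std_gaussian)) (\<lambda>x k. X k x))
       (prod_emb UNIV (\<lambda>_. std_gaussian) J (Pi\<^sub>E J A)) =
       emeasure M ((\<lambda>x k. X k x) -` prod_emb UNIV (\<lambda>_. std_gaussian) J (Pi\<^sub>E J A) \<inter> space M)"
      using AE by (intro emeasure_distr) auto
    also have "(\<lambda>x k. X k x) -` prod_emb UNIV (\<lambda>_. std_gaussian) J (Pi\<^sub>E J A) \<inter> space M
       = {x \<in> space M. \<forall>k<n. X k x \<in> B k}"
      using Jn by (auto simp: prod_emb_def B_def space_PiM PiE_iff subset_eq)
    also have "emeasure M \<dots> = ennreal (\<Prod>k\<in>J. measure std_gaussian (A k))"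
      using pr by (simp add: M.emeasure_eq_measure)
    also have "\<dots> = (\<Prod>k\<in>J. emeasure std_gaussian (A k))"
      by (simp add: prod_ennreal[symmetric] finite_measure.emeasure_eq_measure
           prob_space.finite_measure[OF prob_space_std_gaussian])
    finally show "emeasure (distr M (Pi\<^sub>M UNIV (\<lambda>_. std_gaussian)) (\<lambda>x k. X k x))
       (prod_emb UNIV (\<lambda>_. std_gaussian) J (Pi\<^sub>E J A)) = (\<Prod>k\<in>J. emeasure std_gaussian (A k))" .
  qed simp
qed

section \<open>Domination and pyramids\<close>

lemma dominated_trans:
  assumes YX: "Z \<prec>\<^sub>L Y" and XW: "Y \<prec>\<^sub>L X" and pX: "prob_space (emeas X)"
  shows "Z \<prec>\<^sub>L X"
proof -
  interpret X: prob_space "emeas X" by fact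
  obtain \<phi> E where \<phi> [measurable]: "\<phi> \<in> measurable (emeas Y) (emeas Z)"
    and d\<phi>: "distr (emeas Y) (emeas Z) \<phi> = emeas Z"
    and E [measurable]: "E \<in> sets (emeas Y)" and E1: "emeasure (emeas Y) E = 1"
    and L\<phi>: "\<And>x y. x \<in> E \<Longrightarrow> y \<in> E \<Longrightarrow> edist Z (\<phi> x) (\<phi> y) \<le> edist Y x y"
    using YX unfolding dominated_def by blast
  obtain \<psi> F where \<psi> [measurable]: "\<psi> \<in> measurable (emeas X) (emeas Y)"
    and d\<psi>: "distr (emeas X) (emeas Y) \<psi> = emeas Y"
    and F [measurable]: "F \<in> sets (emeas X)" and F1: "emeasure (emeas X) F = 1"
    and L\<psi>: "\<And>x y. x \<in> F \<Longrightarrow> y \<in> F \<Longrightarrow> edist Y (\<psi> x) (\<psi> y) \<le> edist X x y"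
    using XW unfolding dominated_def by blast
  define G where "G = F \<inter> (\<psi> -` E \<inter> space (emeas X))"
  have pre: "\<psi> -` E \<inter> space (emeas X) \<in> sets (emeas X)" by measurable
  then have G: "G \<in> sets (emeas X)" by (simp add: G_def)
  have "emeasure (emeas X) (\<psi> -` E \<inter> space (emeas X)) = 1"
    using E1 emeasure_distr[OF \<psi> E] d\<psi> by simp
  then have "AE x in emeas X. x \<in> \<psi> -` E \<inter> space (emeas X)" "AE x in emeas X. x \<in> F"
    using F1 by (simp_all only: X.AE_prob_1 X.emeasure_eq_measure ennreal_eq_1)
  then have "AE x in emeas X. x \<in> G" unfolding G_def by eventually_elim auto
  then have "emeasure (emeas X) G = 1" by (rule X.emeasure_eq_1_AE[OF G])
  moreover have "distr (emeas X) (emeas Z) (\<phi> \<circ> \<psi>) = emeas Z"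
    using distr_distr[OF \<phi> \<psi>] d\<phi> d\<psi> by simp
  moreover have "edist Z ((\<phi> \<circ> \<psi>) x) ((\<phi> \<circ> \<psi>) y) \<le> edist X x y" if "x \<in> G" "y \<in> G" for x y
    using that L\<phi>[of "\<psi> x" "\<psi> y"] L\<psi>[of x y] by (auto simp: G_def)
  ultimately show ?thesis
    unfolding dominated_def using G measurable_comp[OF \<psi> \<phi>] by blast
qed

lemma pyramid_mono:
  assumes "Y \<prec>\<^sub>L X" "prob_space (emeas X)"
  shows "pyramid Y \<subseteq> pyramid X"
  unfolding pyramid_def using dominated_trans[OF _ assms] by blast

section \<open>An abstract Wiener space is equivalent to the infinite Gaussian product\<close>

lemma sets_gaussian_PiM: "sets (Pi\<^sub>M UNIV (\<lambda>_::nat. std_gaussian)) = sets borel"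
proof -
  have "sets (Pi\<^sub>M UNIV (\<lambda>_::nat. std_gaussian)) = sets (Pi\<^sub>M UNIV (\<lambda>_. borel :: real measure))"
    by (rule sets_PiM_cong) auto
  then show ?thesis by (simp add: sets_PiM_equal_borel)
qed

text \<open>
  Functionals on \<open>W\<close> that separate points and whose Riesz representatives in the Cameron-Martin space
  are orthonormal.
\<close>

lemma wiener_coordinates:
  fixes i :: "'h::{real_inner, complete_space, second_countable_topology}
                \<Rightarrow> 'w::{banach, second_countable_topology}"
  assumes W: "abstract_wiener_space i \<mu>"
    and inf: "\<nexists>B. finite B \<and> span B = (UNIV :: 'h set)"
  obtains m e where "\<And>n. bounded_linear (m n :: 'w \<Rightarrow> real)" "\<And>n x. m n (i x) = x \<bullet> e n"
    "orthonormal e" "\<And>w. (\<And>n. m n w = 0) \<Longrightarrow> w = 0"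
proof -
  have bi: "bounded_linear i" and ii: "inj i" and dense: "closure (range i) = UNIV"
    using W by (auto simp: abstract_wiener_space_def)
  obtain l :: "nat \<Rightarrow> 'w \<Rightarrow> real" where l: "\<And>k. bounded_linear (l k)"
    and sep: "\<And>w. (\<And>k. l k w = 0) \<Longrightarrow> w = 0"
    using countable_separating_functionals by blast
  have "\<exists>h. \<forall>x. l k (i x) = x \<bullet> h" for k
    using riesz_representation[OF bounded_linear_compose[OF l bi], of k] by metis
  then obtain h where h: "\<And>k x. l k (i x) = x \<bullet> h k" by metis
  have i0: "i 0 = 0" using bi by (simp add: linear_0 bounded_linear.linear)
  \<comment> \<open>The representatives of a separating family are total in the Hilbert space, so they span an
    infinite-dimensional subspace.\<close>
  have total: "x = 0" if "\<And>k. x \<bullet> h k = 0" for x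
  proof -
    have "i x = 0" using that by (intro sep) (simp add: h)
    then show ?thesis using ii i0 by (metis injD)
  qed
  have "\<nexists>B. finite B \<and> range h \<subseteq> span B"
  proof
    assume "\<exists>B. finite B \<and> range h \<subseteq> span B"
    then obtain B where B: "finite B" "range h \<subseteq> span B" by blast
    have "x \<in> span B" for x
    proof -
      obtain p where p: "p \<in> span B" "\<And>b. b \<in> B \<Longrightarrow> (x - p) \<bullet> b = 0"
        using orthogonal_projection_finite[OF B(1)] by blast
      have "(x - p) \<bullet> h k = 0" for k
        using orthogonal_to_span[of "h k" B "x - p"] p(2) B(2) by (auto simp: orthogonal_def)
      then have "x - p = 0" by (rule total)
      then show ?thesis using p(1) by simp
    qed
    then have "span B = UNIV" by auto
    then show False using B(1) inf by blast
  qed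
  then obtain e where e: "orthonormal e" "range e \<subseteq> span (range h)" "range h \<subseteq> span (range e)"
    by (rule orthonormal_sequence_exists)
  have "\<exists>l. bounded_linear (l :: 'w \<Rightarrow> real) \<and> (\<forall>x. l (i x) = x \<bullet> v)" if "v \<in> span (range h)" for v
    using that
  proof (induction rule: span_induct_alt)
    case base
    show ?case by (rule exI[of _ "\<lambda>_. 0"]) (simp add: bounded_linear_zero)
  next
    case (step c u v)
    then obtain k where k: "u = h k" by blast
    obtain l' where l': "bounded_linear (l' :: 'w \<Rightarrow> real)" "\<And>x. l' (i x) = x \<bullet> v"
      using step by blast
    have "bounded_linear (\<lambda>w. c * l k w + l' w)"
      by (intro bounded_linear_add bounded_linear_const_mult l l')
    then show ?case
      by (intro exI[of _ "\<lambda>w. c * l k w + l' w"]) (simp add: k h l' inner_add_right)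
  qed
  then have "\<exists>l. bounded_linear (l :: 'w \<Rightarrow> real) \<and> (\<forall>x. l (i x) = x \<bullet> e n)" for n
    using e(2) by blast
  then obtain m where m: "\<And>n. bounded_linear (m n :: 'w \<Rightarrow> real)" "\<And>n x. m n (i x) = x \<bullet> e n"
    by metis
  have "w = 0" if w: "\<And>n. m n w = 0" for w
  proof (rule sep)
    fix k
    have "\<exists>l. bounded_linear (l :: 'w \<Rightarrow> real) \<and> (\<forall>x. l (i x) = x \<bullet> v) \<and> l w = 0"
      if "v \<in> span (range e)" for v
      using that
    proof (induction rule: span_induct_alt)
      case base
      show ?case by (rule exI[of _ "\<lambda>_. 0"]) (simp add: bounded_linear_zero)
    next
      case (step c u v)
      then obtain n where n: "u = e n" by blast
      obtain l' where l': "bounded_linear (l' :: 'w \<Rightarrow> real)" "\<And>x. l' (i x) = x \<bullet> v" "l' w = 0"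
        using step by blast
      have "bounded_linear (\<lambda>w. c * m n w + l' w)"
        by (intro bounded_linear_add bounded_linear_const_mult m l')
      then show ?case
        by (intro exI[of _ "\<lambda>w. c * m n w + l' w"]) (simp add: n m w l' inner_add_right)
    qed
    then obtain l' where l': "bounded_linear (l' :: 'w \<Rightarrow> real)" "\<And>x. l' (i x) = x \<bullet> h k" "l' w = 0"
      using e(3) by blast
    \<comment> \<open>A functional is determined by its representative, because the range of \<open>i\<close> is dense.\<close>
    have "closed {x. l k x = l' x}"
      by (intro closed_Collect_eq linear_continuous_on l l')
    moreover have "range i \<subseteq> {x. l k x = l' x}" using h l' by auto
    ultimately have "closure (range i) \<subseteq> {x. l k x = l' x}" by (simp add: closure_minimal)
    then have "w \<in> {x. l k x = l' x}" unfolding dense by blast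
    then show "l k w = 0" using l'(3) by simp
  qed
  then show ?thesis using that m e(1) by blast
qed

lemma wiener_equiv_gaussian_infinite_power:
  fixes i :: "'h::{real_inner, complete_space, second_countable_topology}
                \<Rightarrow> 'w::{banach, second_countable_topology}"
  assumes W: "abstract_wiener_space i \<mu>"
    and inf: "\<nexists>B. finite B \<and> span B = (UNIV :: 'h set)"
  shows "gaussian_infinite_power \<prec>\<^sub>L wiener_emm i \<mu>" "wiener_emm i \<mu> \<prec>\<^sub>L gaussian_infinite_power"
proof -
  obtain m e where m: "\<And>n. bounded_linear (m n :: 'w \<Rightarrow> real)" "\<And>n x. m n (i x) = x \<bullet> e n"
    and e: "orthonormal e" and sep: "\<And>w. (\<And>n. m n w = 0) \<Longrightarrow> w = 0"
    using wiener_coordinates[OF W inf] by blast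
  have pm: "prob_space \<mu>" and sm [measurable_cong, simp]: "sets \<mu> = sets borel" and ii: "inj i"
    and law: "\<And>l h. bounded_linear l \<Longrightarrow> (\<And>k. l (i k) = k \<bullet> h) \<Longrightarrow> distr \<mu> borel l = centred_gaussian (norm h)"
    using W by (auto simp: abstract_wiener_space_def)
  interpret prob_space \<mu> by fact
  have sp: "space \<mu> = UNIV" using sets_eq_imp_space_eq[OF sm] by simp
  let ?G = "Pi\<^sub>M UNIV (\<lambda>_::nat. std_gaussian)"
  have spG: "space ?G = UNIV" using sets_eq_imp_space_eq[OF sets_gaussian_PiM] by simp
  define T where "T w n = m n w" for w n
  have cT: "continuous_on UNIV T"
    by (rule continuous_on_coordinatewise_then_product) (simp add: T_def linear_continuous_on m)
  have [measurable]: "T \<in> borel_measurable borel" by (rule borel_measurable_continuous_onI[OF cT])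
  have T [measurable]: "T \<in> measurable \<mu> ?G"
    using measurable_cong_sets[OF sm sets_gaussian_PiM] by simp
  have mm: "m k \<in> borel_measurable \<mu>" for k
    using borel_measurable_continuous_onI[OF linear_continuous_on[OF m(1)[of k]]] measurable_cong_sets[OF sm refl]
    by auto
  have "distr \<mu> ?G (\<lambda>w n. m n w) = ?G"
  proof (rule distr_eq_gaussian_product[OF pm mm])
    fix n and a :: "nat \<Rightarrow> real"
    define l where "l w = (\<Sum>k<n. a k * m k w)" for w
    have bl: "bounded_linear l"
      unfolding l_def[abs_def] by (intro bounded_linear_sum bounded_linear_const_mult m)
    define h where "h = (\<Sum>k<n. a k *\<^sub>R e k)"
    have lh: "l (i k) = k \<bullet> h" for k by (simp add: l_def h_def m inner_sum_right)
    have nh: "(norm h)\<^sup>2 = (\<Sum>k<n. (a k)\<^sup>2)"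
      unfolding h_def by (rule orthonormal_norm_sum[OF e]) simp
    have lm: "l \<in> borel_measurable \<mu>" unfolding l_def[abs_def] using mm by measurable
    have "(CLINT x|\<mu>. iexp (l x)) = (CLINT y|distr \<mu> borel l. iexp y)"
      using lm by (subst integral_distr) auto
    also have "\<dots> = complex_of_real (exp (- (\<Sum>k<n. (a k)\<^sup>2) / 2))"
      unfolding law[OF bl lh] char_centred_gaussian nh ..
    finally show "(CLINT x|\<mu>. iexp (\<Sum>k<n. a k * m k x)) = complex_of_real (exp (- (\<Sum>k<n. (a k)\<^sup>2) / 2))"
      by (simp add: l_def)
  qed
  then have dT: "distr \<mu> ?G T = ?G" by (simp add: T_def[abs_def])
  \<comment> \<open>\<open>T\<close> preserves the extended distances exactly. If the coordinates of \<open>v - w\<close> are square summable,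
    they are those of some \<open>i h\<close>, and \<open>v - w = i h\<close> since the functionals separate points.\<close>
  have ed: "ell2_edist (T v) (T w) = cameron_martin_edist i v w" for v w
  proof -
    define c where "c n = m n (v - w)" for n
    have Tc: "T v n - T w n = c n" for n
      by (simp add: T_def c_def linear_diff[OF bounded_linear.linear[OF m(1)]])
    show ?thesis
    proof (cases "summable (\<lambda>n. (c n)\<^sup>2)")
      case True
      then obtain h where h: "\<And>n. h \<bullet> e n = c n" "(norm h)\<^sup>2 = (\<Sum>n. (c n)\<^sup>2)"
        using orthonormal_series[OF e] by blast
      have "v - w - i h = 0"
        by (rule sep) (simp add: linear_diff[OF bounded_linear.linear[OF m(1)]] m h c_def)
      then have "v - w = i h" by simp
      moreover have "norm h = sqrt (\<Sum>n. (c n)\<^sup>2)" using h(2) by (metis norm_ge_zero real_sqrt_abs abs_of_nonneg)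
      ultimately show ?thesis using True by (simp add: ell2_edist_def cameron_martin_edist_def Tc inv_f_f[OF ii])
    next
      case False
      have "v - w \<notin> range i"
      proof
        assume "v - w \<in> range i"
        then obtain h where "v - w = i h" by blast
        then have "c n = h \<bullet> e n" for n by (simp add: c_def m)
        then show False using False bessel_summable[OF e, of h] by simp
      qed
      then show ?thesis using False by (simp add: ell2_edist_def cameron_martin_edist_def Tc)
    qed
  qed
  show "gaussian_infinite_power \<prec>\<^sub>L wiener_emm i \<mu>"
    unfolding dominated_def gaussian_infinite_power_def wiener_emm_def
    using T dT ed emeasure_space_1 sp by (auto intro!: bexI[of _ T] bexI[of _ UNIV])
  have injT: "inj T"
  proof (rule injI)
    fix v w assume vw: "T v = T w"
    have "v - w = 0"
    proof (rule sep)
      fix n show "m n (v - w) = 0"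
        using fun_cong[OF vw, of n] by (simp add: T_def linear_diff[OF bounded_linear.linear[OF m(1)]])
    qed
    then show "v = w" by simp
  qed
  \<comment> \<open>On a \<open>\<sigma>\<close>-compact set the inverse of the continuous injection \<open>T\<close> is Borel: images of relatively
    closed subsets are again \<open>\<sigma>\<close>-compact.\<close>
  have "\<exists>K. compact K \<and> emeasure \<mu> K > 1 - inverse (Suc n)" for n
  proof -
    have "ennreal (1 - inverse (Suc n)) < 1"
      by (simp add: ennreal_less_one_iff)
    also have "1 = (SUP K\<in>{K. K \<subseteq> space \<mu> \<and> compact K}. emeasure \<mu> K)"
      using inner_regular[OF sm, of "space \<mu>"] emeasure_space_1 sp by simp
    finally show ?thesis unfolding less_SUP_iff by blast
  qed
  then obtain K where K: "\<And>n. compact (K n)" "\<And>n. emeasure \<mu> (K n) > 1 - inverse (Suc n)" by metis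
  define KK where "KK = (\<Union>n. K n)"
  have Ks [measurable]: "K n \<in> sets borel" for n using K(1) by (simp add: borel_compact)
  have KKs [measurable]: "KK \<in> sets borel" unfolding KK_def by measurable
  have "measure \<mu> KK \<ge> 1 - inverse (Suc n)" for n
  proof -
    have "ennreal (1 - inverse (Suc n)) \<le> emeasure \<mu> (K n)" using K(2)[of n] by (simp add: less_imp_le)
    also have "\<dots> \<le> emeasure \<mu> KK" by (intro emeasure_mono) (auto simp: KK_def)
    finally show ?thesis by (simp add: emeasure_eq_measure)
  qed
  then have "1 - 0 \<le> measure \<mu> KK"
    by (intro LIMSEQ_le_const2[OF tendsto_diff[OF tendsto_const LIMSEQ_inverse_real_of_nat]]) auto
  then have mKK: "measure \<mu> KK = 1" using prob_le_1[of KK] by simp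
  have im: "T ` (C \<inter> KK) \<in> sets borel" if "closed C" for C
  proof -
    have "T ` (C \<inter> KK) = (\<Union>n. T ` (C \<inter> K n))" by (auto simp: KK_def)
    moreover have "compact (T ` (C \<inter> K n))" for n
      using that K(1) by (intro compact_continuous_image continuous_on_subset[OF cT]) (auto intro: closed_Int_compact)
    ultimately show ?thesis by (simp add: borel_compact sets.countable_UN image_subset_iff)
  qed
  define S where "S z = (if z \<in> T ` KK then inv T z else 0)" for z
  have ST: "S (T w) = w" if "w \<in> KK" for w using that injT by (simp add: S_def inv_f_f)
  have cl: "S -` C \<in> sets borel" if C: "closed C" for C
  proof -
    have "S -` C = T ` (C \<inter> KK) \<union> (if 0 \<in> C then - (T ` (UNIV \<inter> KK)) else {})"
      using ST injT by (auto simp: S_def inv_f_f split: if_splits)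
    then show ?thesis using im[OF C] im[OF closed_UNIV] by (auto intro: borel_comp)
  qed
  have "S \<in> borel_measurable borel"
  proof (rule borel_measurableI)
    fix C :: "'w set" assume "open C"
    then have "- (S -` (- C)) \<in> sets borel" by (intro borel_comp cl) auto
    then show "S -` C \<inter> space borel \<in> sets borel" by (simp add: vimage_Compl)
  qed
  then have S [measurable]: "S \<in> measurable ?G \<mu>"
    using measurable_cong_sets[OF sets_gaussian_PiM sm] by simp
  have AEK: "AE w in \<mu>. w \<in> KK" using AE_prob_1[OF mKK] .
  have "distr ?G \<mu> S = distr \<mu> \<mu> (S \<circ> T)"
    using distr_distr[OF S T] dT by simp
  also have "\<dots> = distr \<mu> \<mu> (\<lambda>w. w)"
    by (rule distr_cong_AE) (use AEK in \<open>auto elim!: eventually_mono simp: ST\<close>)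
  finally have dS: "distr ?G \<mu> S = \<mu>" by (simp add: distr_id2)
  have TK: "T ` KK \<in> sets ?G" using im[OF closed_UNIV] by (simp add: sets_gaussian_PiM)
  have "emeasure ?G (T ` KK) = emeasure \<mu> (T -` (T ` KK) \<inter> space \<mu>)"
    using emeasure_distr[OF T TK] dT by simp
  also have "T -` (T ` KK) \<inter> space \<mu> = KK" using injT sp by (auto dest: injD)
  finally have eTK: "emeasure ?G (T ` KK) = 1" using mKK by (simp add: emeasure_eq_measure)
  show "wiener_emm i \<mu> \<prec>\<^sub>L gaussian_infinite_power"
    unfolding dominated_def gaussian_infinite_power_def wiener_emm_def
    using S dS TK eTK by (auto intro!: bexI[of _ S] bexI[of _ "T ` KK"] simp: ST ed)
qed

section \<open>Existence of parameters\<close>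

text \<open>Measure-preserving self-maps of the unit interval, the reparametrisations of parameters.\<close>

abbreviation leb_preserving :: "(real \<Rightarrow> real) \<Rightarrow> bool" where
  "leb_preserving \<sigma> \<equiv> \<sigma> \<in> measurable Leb01 Leb01 \<and> distr Leb01 Leb01 \<sigma> = Leb01"

lemma space_Leb01 [simp]: "space Leb01 = {0..<1}"
  by (simp add: space_restrict_space)

lemma sets_Leb01: "A \<in> sets Leb01 \<longleftrightarrow> A \<in> sets borel \<and> A \<subseteq> {0..<1}"
  by (subst sets_restrict_space_iff) auto

lemma prob_space_Leb01: "prob_space Leb01"
  by (intro prob_spaceI) (simp add: emeasure_restrict_space)

interpretation Leb01: prob_space Leb01 by (rule prob_space_Leb01)

text \<open>The quantile function is a parameter of a distribution on the line.\<close>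

lemma real_measure_parametrized:
  assumes "prob_space N" "sets N = sets (borel :: real measure)"
  obtains f where "f \<in> measurable Leb01 N" "distr Leb01 N f = N"
proof -
  interpret N: prob_space N by fact
  interpret N: cdf_distribution N
    using assms(2) by (intro cdf_distribution.intro real_distribution.intro N.prob_space_axioms real_distribution_axioms.intro)
      (auto dest: sets_eq_imp_space_eq)
  define f where "f s = (if s \<in> {0<..<1} then N.I s else 0)" for s
  have "N.I \<in> measurable (restrict_space borel {0<..<1}) borel" by (rule N.measurable_CI)
  then have [measurable]: "f \<in> borel_measurable borel"
    by (subst (asm) measurable_restrict_space_iff[where c = 0]) (auto simp: f_def[abs_def])
  have fL: "f \<in> borel_measurable Leb01" by (intro measurable_restrict_space1) auto
  have "distr Leb01 borel f = N"
  proof (rule measure_eqI)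
    fix A assume "A \<in> sets (distr Leb01 borel f)"
    then have A [measurable]: "A \<in> sets borel" by simp
    have fA [measurable]: "f -` A \<in> sets borel" using measurable_sets[of f borel borel A] by simp
    have IA: "N.I \<in> measurable (restrict_space lborel {0<..<1}) borel"
      using N.measurable_CI by (simp cong: measurable_cong_sets add: sets_restrict_space)
    have "emeasure (distr Leb01 borel f) A = emeasure Leb01 (f -` A \<inter> {0..<1})"
      using fL by (subst emeasure_distr) auto
    also have "\<dots> = emeasure lborel (f -` A \<inter> {0..<1})"
      by (subst emeasure_restrict_space) auto
    also have "\<dots> = emeasure lborel (f -` A \<inter> {0<..<1})"
    proof (rule emeasure_eq_AE)
      show "AE x in lborel. (x \<in> f -` A \<inter> {0..<1}) = (x \<in> f -` A \<inter> {0<..<1})"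
        using AE_lborel_singleton[of 0] by eventually_elim auto
    qed auto
    also have "f -` A \<inter> {0<..<1} = N.I -` A \<inter> space (restrict_space lborel {0<..<1})"
      by (auto simp: f_def space_restrict_space)
    also have "emeasure lborel \<dots> = emeasure (restrict_space lborel {0<..<1}) \<dots>"
      by (subst emeasure_restrict_space) (auto simp: space_restrict_space)
    also have "\<dots> = emeasure (distr (restrict_space lborel {0<..<1}) borel N.I) A"
      using IA by (subst emeasure_distr) auto
    finally show "emeasure (distr Leb01 borel f) A = emeasure N A"
      by (simp add: N.distr_I_eq_M)
  qed (simp add: assms)
  moreover have "distr Leb01 N f = distr Leb01 borel f"
    by (rule distr_cong) (auto simp: assms)
  moreover have "f \<in> measurable Leb01 N" using fL by (simp cong: measurable_cong_sets add: assms(2))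
  ultimately show ?thesis using that by simp
qed

text \<open>
  Base \<open>3\<close> with digits \<open>0\<close> and \<open>1\<close> keeps the expansion unambiguous: the tail is at most \<open>1/2\<close>.
\<close>

lemma floor_ternary_digit:
  fixes a :: "nat \<Rightarrow> real"
  assumes a: "\<And>k. a k \<in> {0, 1}"
  shows "\<lfloor>3 ^ Suc n * (\<Sum>k. a k / 3 ^ Suc k)\<rfloor> mod 3 = (if a n = 1 then 1 else 0)"
proof -
  define r where "r j = (\<Sum>k. a (j + k) / 3 ^ Suc k)" for j
  have geo: "(\<lambda>k. (1/3) * (1/3 :: real) ^ k) sums (1/2)"
    using sums_mult[OF geometric_sums[of "1/3 :: real"], of "1/3"] by simp
  have bd: "0 \<le> a (j + k) / 3 ^ Suc k" "a (j + k) / 3 ^ Suc k \<le> (1/3) * (1/3) ^ k" for j k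
    using a[of "j + k"] by (auto simp: power_divide)
  have sm: "summable (\<lambda>k. a (j + k) / 3 ^ Suc k)" for j
    by (rule summable_comparison_test'[OF sums_summable[OF geo], of 0]) (metis bd abs_of_nonneg real_norm_def)
  have r0: "0 \<le> r j" for j unfolding r_def by (rule suminf_nonneg[OF sm bd(1)])
  have r1: "r j \<le> 1/2" for j
    unfolding r_def using suminf_le[OF bd(2) sm sums_summable[OF geo], of j] sums_unique[OF geo] by simp
  have step: "3 * r j = a j + r (Suc j)" for j
  proof -
    have "r j = a j / 3 + (\<Sum>k. a (j + Suc k) / 3 ^ Suc (Suc k))"
      unfolding r_def using suminf_split_head[OF sm[of j]] by simp
    also have "(\<Sum>k. a (j + Suc k) / 3 ^ Suc (Suc k)) = (\<Sum>k. (1/3) * (a (Suc j + k) / 3 ^ Suc k))"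
      by simp
    also have "\<dots> = (1/3) * r (Suc j)" unfolding r_def by (rule suminf_mult[OF sm])
    finally show ?thesis by simp
  qed
  have "\<exists>z::int. 3 ^ n * r 0 = z + r n" for n
  proof (induction n)
    case 0 show ?case by (rule exI[of _ 0]) simp
  next
    case (Suc n)
    then obtain z :: int where z: "3 ^ n * r 0 = z + r n" by blast
    have "3 ^ Suc n * r 0 = 3 * z + a n + r (Suc n)" using z step[of n] by (simp add: algebra_simps)
    moreover have "a n = real_of_int (if a n = 1 then 1 else 0)" using a[of n] by auto
    ultimately have "3 ^ Suc n * r 0 = real_of_int (3 * z + (if a n = 1 then 1 else 0)) + r (Suc n)" by simp
    then show ?case by blast
  qed
  then obtain z :: int where z: "3 ^ n * r 0 = z + r n" by blast
  have "3 ^ Suc n * r 0 = 3 * z + a n + r (Suc n)" using z step[of n] by (simp add: algebra_simps)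
  moreover have "a n = real_of_int (if a n = 1 then 1 else 0)" using a[of n] by auto
  ultimately have "3 ^ Suc n * r 0 = real_of_int (3 * z + (if a n = 1 then 1 else 0)) + r (Suc n)" by simp
  then have "\<lfloor>3 ^ Suc n * r 0\<rfloor> = 3 * z + (if a n = 1 then 1 else 0)"
    using r0[of "Suc n"] r1[of "Suc n"] by (intro floor_unique) auto
  then have "\<lfloor>3 ^ Suc n * r 0\<rfloor> mod 3 = (if a n = 1 then 1 else 0)" by auto
  then show ?thesis by (simp add: r_def)
qed

text \<open>
  Countably many measurable sets are the preimages of Borel sets of reals under a single real
  function.
\<close>

lemma measurable_real_code:
  fixes U :: "nat \<Rightarrow> 'a set"
  assumes U [measurable]: "\<And>n. U n \<in> sets M"
  obtains c B where "c \<in> borel_measurable M" "\<And>n. B n \<in> sets (borel :: real measure)"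
    "\<And>n y. c y \<in> B n \<longleftrightarrow> y \<in> U n"
proof
  define c where "c y = (\<Sum>k. indicator (U k) y / 3 ^ Suc k :: real)" for y
  define B where "B n = {t :: real. \<lfloor>3 ^ Suc n * t\<rfloor> mod 3 = 1}" for n
  show "c \<in> borel_measurable M" unfolding c_def[abs_def] by measurable
  have fl: "(\<lambda>t :: real. \<lfloor>3 ^ Suc n * t\<rfloor>) \<in> measurable borel (count_space UNIV)" for n
    by measurable
  show "B n \<in> sets borel" for n
    using measurable_sets[OF fl[of n], of "{z. z mod 3 = 1}"] by (simp add: B_def vimage_def)
  show "c y \<in> B n \<longleftrightarrow> y \<in> U n" for n y
    using floor_ternary_digit[of "\<lambda>k. indicator (U k) y" n]
    by (simp add: B_def c_def indicator_def split: if_splits)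
qed

lemma borel_ofI: "openin T U \<Longrightarrow> U \<in> sets (borel_of T)"
  unfolding borel_of_def by (subst sets_measure_of) (auto dest: openin_subset)

lemma measurable_borel_ofI:
  assumes "\<And>x. x \<in> space M \<Longrightarrow> f x \<in> topspace T"
    and "\<And>U. openin T U \<Longrightarrow> f -` U \<inter> space M \<in> sets M"
  shows "f \<in> measurable M (borel_of T)"
  unfolding borel_of_def by (rule measurable_measure_of) (use assms in \<open>auto dest: openin_subset\<close>)

lemma countable_dense_sequence:
  assumes X: "mm_space X"
  shows "\<exists>q :: nat \<Rightarrow> 'a. (\<forall>k. q k \<in> mspace (fst X)) \<and>
    (\<forall>x\<in>mspace (fst X). \<forall>r>0. \<exists>k. mdist (fst X) (q k) x < r)"
proof -
  interpret Metric_space "mspace (fst X)" "mdist (fst X)" by simp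
  interpret P: prob_space "snd X" using X by (simp add: mm_space_def)
  have "separable_space mtopology" using X by (simp add: mm_space_def mtopology_of_def)
  then obtain D where D: "countable D" "D \<subseteq> mspace (fst X)" "mtopology closure_of D = mspace (fst X)"
    by (auto simp: separable_space_def)
  have "mspace (fst X) \<noteq> {}" using X P.not_empty by (simp add: mm_space_def)
  then have Dne: "D \<noteq> {}" using D(3) by auto
  show ?thesis
  proof (intro exI[of _ "from_nat_into D"] conjI allI ballI impI)
    show "from_nat_into D k \<in> mspace (fst X)" for k using from_nat_into[OF Dne] D(2) by blast
    fix x r assume "x \<in> mspace (fst X)" "(r :: real) > 0"
    then obtain z where "z \<in> D" "z \<in> mball x r" using D(3) metric_closure_of[of D] by blast
    then show "\<exists>k. mdist (fst X) (from_nat_into D k) x < r"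
      using from_nat_into_surj[OF D(1)] by (metis in_mball commute)
  qed
qed

lemma mm_space_sets:
  assumes "mm_space X"
  shows "space (snd X) = mspace (fst X)" "sets (snd X) = sets (borel_of (mtopology_of (fst X)))" "prob_space (snd X)"
  using assms by (auto simp: mm_space_def)

text \<open>
  The code of a countable base of balls maps \<open>X\<close> to the line, and the image measure has a parameter.
  It remains to decode: the code of \<open>y\<close> tells for every radius \<open>h n\<close> a dense point \<open>q k\<close> within \<open>h n\<close>
  of \<open>y\<close>, and \<open>y\<close> is the limit of these points. Decoding is Borel on the whole line, so no knowledge
  about the image of the code is needed.
\<close>

lemma mm_parameters_nonempty:
  assumes X: "mm_space X"
  shows "mm_parameters X \<noteq> {}"
proof -
  define M where "M = mspace (fst X)"
  define d where "d = mdist (fst X)"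
  define m where "m = snd X"
  interpret Metric_space M d by (simp add: M_def d_def)
  have top: "mtopology_of (fst X) = mtopology" by (simp add: mtopology_of_def M_def d_def)
  have mc: mcomplete using X by (simp add: mm_space_def mcomplete_of_def M_def d_def)
  have sp: "space m = M" and st: "sets m = sets (borel_of mtopology)" and pm: "prob_space m"
    using mm_space_sets[OF X] by (auto simp: m_def M_def top)
  obtain q :: "nat \<Rightarrow> 'a" where q': "(\<forall>k. q k \<in> M) \<and> (\<forall>x\<in>M. \<forall>r>0. \<exists>k. d (q k) x < r)"
    using countable_dense_sequence[OF X] unfolding M_def[symmetric] d_def[symmetric] by blast
  then have q: "\<And>k. q k \<in> M" "\<And>x r. x \<in> M \<Longrightarrow> r > 0 \<Longrightarrow> \<exists>k. d (q k) x < r" by simp_all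
  define h where "h n = (1/2 :: real) ^ n" for n
  have h: "h n > 0" for n by (simp add: h_def)
  have hlim: "\<exists>n. h n < e" if "e > 0" for e using real_arch_pow_inv[of e "1/2"] that by (auto simp: h_def)
  define U where "U j = mball (q (fst (prod_decode j))) (h (snd (prod_decode j)))" for j
  have "U j \<in> sets m" for j unfolding st U_def by (intro borel_ofI) simp
  then obtain c B where c: "c \<in> borel_measurable m" and B: "\<And>n. B n \<in> sets (borel :: real measure)"
    and cB: "\<And>n y. c y \<in> B n \<longleftrightarrow> y \<in> U n"
    using measurable_real_code by blast
  define BB where "BB k n = B (prod_encode (k, n))" for k n
  have BBm [measurable]: "BB k n \<in> sets borel" for k n by (simp add: BB_def B)
  have cBB: "c y \<in> BB k n \<longleftrightarrow> d (q k) y < h n" if "y \<in> M" for y k n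
    using that q(1) by (simp add: BB_def cB U_def)
  define \<kappa> where "\<kappa> n t = (LEAST k. t \<in> BB k n)" for n t
  have \<kappa>m [measurable]: "\<kappa> n \<in> measurable borel (count_space UNIV)" for n unfolding \<kappa>_def[abs_def] by measurable
  have \<kappa>c: "d (q (\<kappa> n (c y))) y < h n" if "y \<in> M" for n y
  proof -
    have "\<exists>k. c y \<in> BB k n" using q(2)[OF that h[of n]] cBB[OF that] by auto
    then have "c y \<in> BB (\<kappa> n (c y)) n" unfolding \<kappa>_def by (rule LeastI_ex)
    then show ?thesis using cBB[OF that] by simp
  qed
  \<comment> \<open>On \<open>C\<close> the decoding sequence converges with a known rate; \<open>C\<close> contains all codes.\<close>
  define C where "C = {t. \<forall>a b. d (q (\<kappa> a t)) (q (\<kappa> b t)) < h a + h b}"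
  have "{t. d (q (\<kappa> a t)) (q (\<kappa> b t)) < h a + h b} \<in> sets borel" for a b
  proof -
    have "{t. d (q (\<kappa> a t)) (q (\<kappa> b t)) < h a + h b} =
       {t \<in> space borel. \<exists>j k. \<kappa> a t = j \<and> \<kappa> b t = k \<and> d (q j) (q k) < h a + h b}" by auto
    also have "\<dots> \<in> sets borel" by measurable
    finally show ?thesis .
  qed
  then have Cm: "C \<in> sets borel"
  proof -
    assume *: "\<And>a b. {t. d (q (\<kappa> a t)) (q (\<kappa> b t)) < h a + h b} \<in> sets borel"
    have "C = (\<Inter>a. \<Inter>b. {t. d (q (\<kappa> a t)) (q (\<kappa> b t)) < h a + h b})" by (auto simp: C_def)
    then show ?thesis using * by (simp add: sets.countable_INT image_subset_iff)
  qed
  have cC: "c y \<in> C" if "y \<in> M" for y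
    unfolding C_def
  proof (intro CollectI allI)
    fix a b
    have "d (q (\<kappa> a (c y))) (q (\<kappa> b (c y))) \<le> d (q (\<kappa> a (c y))) y + d (q (\<kappa> b (c y))) y"
      using triangle[of "q (\<kappa> a (c y))" y "q (\<kappa> b (c y))"] q(1) that by (simp add: commute)
    then show "d (q (\<kappa> a (c y))) (q (\<kappa> b (c y))) < h a + h b" using \<kappa>c[OF that, of a] \<kappa>c[OF that, of b] by simp
  qed
  have "\<exists>y\<in>M. \<forall>n. d (q (\<kappa> n t)) y \<le> h n" if t: "t \<in> C" for t
  proof -
    have "MCauchy (\<lambda>n. q (\<kappa> n t))"
      unfolding MCauchy_def
    proof (intro conjI allI impI)
      fix e :: real assume "e > 0"
      then obtain N where N: "h N < e / 2" using hlim[of "e/2"] by auto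
      have "h n \<le> h N" if "n \<ge> N" for n using that unfolding h_def by (intro power_decreasing) auto
      then have hs: "h n < e / 2" if "n \<ge> N" for n using N that by (meson le_less_trans)
      have "d (q (\<kappa> n t)) (q (\<kappa> n' t)) < e" if "N \<le> n" "N \<le> n'" for n n'
      proof -
        have "d (q (\<kappa> n t)) (q (\<kappa> n' t)) < h n + h n'" using t by (simp add: C_def)
        also have "\<dots> < e" using hs[OF that(1)] hs[OF that(2)] by linarith
        finally show ?thesis .
      qed
      then show "\<exists>N. \<forall>n n'. N \<le> n \<longrightarrow> N \<le> n' \<longrightarrow> d (q (\<kappa> n t)) (q (\<kappa> n' t)) < e" by blast
    qed (use q(1) in auto)
    then obtain y where y: "limitin mtopology (\<lambda>n. q (\<kappa> n t)) y sequentially"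
      using mc mcomplete_def by blast
    then have yM: "y \<in> M" and ly: "(\<lambda>n. d (q (\<kappa> n t)) y) \<longlonglongrightarrow> 0"
      by (auto simp: limitin_metric_dist_null)
    have "d (q (\<kappa> n t)) y \<le> h n" for n
    proof (rule field_le_epsilon)
      fix e :: real assume e: "e > 0"
      obtain N1 where N1: "h N1 < e / 2" using hlim[of "e/2"] e by auto
      obtain N2 where N2: "\<And>k. k \<ge> N2 \<Longrightarrow> d (q (\<kappa> k t)) y < e / 2"
        using order_tendstoD(2)[OF ly, of "e/2"] e by (auto simp: eventually_sequentially)
      define k where "k = max N1 N2"
      have "h k \<le> h N1" unfolding h_def k_def by (intro power_decreasing) auto
      moreover have "d (q (\<kappa> n t)) (q (\<kappa> k t)) < h n + h k" using t by (simp add: C_def)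
      moreover have "d (q (\<kappa> n t)) y \<le> d (q (\<kappa> n t)) (q (\<kappa> k t)) + d (q (\<kappa> k t)) y"
        using q(1) yM by (intro triangle) auto
      moreover have "d (q (\<kappa> k t)) y < e / 2" by (intro N2) (simp add: k_def)
      ultimately show "d (q (\<kappa> n t)) y \<le> h n + e" using N1 by linarith
    qed
    then show ?thesis using yM by blast
  qed
  then obtain g0 where g0: "\<And>t. t \<in> C \<Longrightarrow> g0 t \<in> M" "\<And>t n. t \<in> C \<Longrightarrow> d (q (\<kappa> n t)) (g0 t) \<le> h n"
    by metis
  define g where "g t = (if t \<in> C then g0 t else q 0)" for t
  have gM: "g t \<in> M" for t using g0(1) q(1) by (simp add: g_def)
  have gc: "g (c y) = y" if y: "y \<in> M" for y
  proof (rule ccontr)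
    assume "g (c y) \<noteq> y"
    then have "d (g (c y)) y > 0" using gM y by simp
    then obtain n where n: "h n < d (g (c y)) y / 2" using hlim[of "d (g (c y)) y / 2"] by auto
    have "d (g (c y)) y \<le> d (q (\<kappa> n (c y))) (g (c y)) + d (q (\<kappa> n (c y))) y"
      using triangle[of "g (c y)" "q (\<kappa> n (c y))" y] q(1) gM y by (simp add: commute)
    moreover have "d (q (\<kappa> n (c y))) (g (c y)) \<le> h n" using g0(2)[OF cC[OF y]] cC[OF y] by (simp add: g_def)
    ultimately show False using \<kappa>c[OF y, of n] n by linarith
  qed
  have gm: "g \<in> measurable borel (borel_of mtopology)"
  proof (rule measurable_borel_ofI)
    fix V assume V: "openin mtopology V"
    \<comment> \<open>Since \<open>g0 t\<close> is within \<open>h n\<close> of the \<open>n\<close>-th approximation, membership in an open set is decided by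
      the approximations alone.\<close>
    define K where "K n = {k. mball (q k) (2 * h n) \<subseteq> V}" for n
    have eq: "g0 t \<in> V \<longleftrightarrow> (\<exists>n. \<kappa> n t \<in> K n)" if t: "t \<in> C" for t
    proof
      assume "g0 t \<in> V"
      then obtain r where r: "r > 0" "mball (g0 t) r \<subseteq> V" using V by (auto simp: openin_mtopology)
      obtain n where n: "h n < r / 3" using hlim[of "r/3"] r by auto
      have "mball (q (\<kappa> n t)) (2 * h n) \<subseteq> mball (g0 t) r"
      proof
        fix z assume "z \<in> mball (q (\<kappa> n t)) (2 * h n)"
        then have z: "z \<in> M" "d (q (\<kappa> n t)) z < 2 * h n" by auto
        have "d (g0 t) z \<le> d (q (\<kappa> n t)) (g0 t) + d (q (\<kappa> n t)) z"
          using triangle[of "g0 t" "q (\<kappa> n t)" z] g0(1)[OF t] q(1) z by (simp add: commute)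
        also have "\<dots> < r" using g0(2)[OF t, of n] z n by linarith
        finally show "z \<in> mball (g0 t) r" using g0(1)[OF t] z by simp
      qed
      then show "\<exists>n. \<kappa> n t \<in> K n" using r unfolding K_def by blast
    next
      assume "\<exists>n. \<kappa> n t \<in> K n"
      then obtain n where n: "mball (q (\<kappa> n t)) (2 * h n) \<subseteq> V" by (auto simp: K_def)
      have "g0 t \<in> mball (q (\<kappa> n t)) (2 * h n)"
        using g0(1)[OF t] g0(2)[OF t, of n] q(1) h[of n] by simp
      then show "g0 t \<in> V" using n by blast
    qed
    have "g -` V \<inter> space borel = (C \<inter> {t \<in> space borel. \<exists>n. \<kappa> n t \<in> K n}) \<union> (if q 0 \<in> V then - C else {})"
      using eq by (auto simp: g_def split: if_splits)
    moreover have "{t \<in> space borel. \<exists>n. \<kappa> n t \<in> K n} \<in> sets borel" by measurable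
    ultimately show "g -` V \<inter> space borel \<in> sets borel" using Cm by (auto intro: borel_comp)
  qed (simp add: gM)
  then have gm': "g \<in> measurable borel m" by (simp cong: measurable_cong_sets add: st)
  define N where "N = distr m borel c"
  have pN: "prob_space N" unfolding N_def by (rule prob_space.prob_space_distr[OF pm c])
  obtain f where f: "f \<in> measurable Leb01 N" "distr Leb01 N f = N"
    using real_measure_parametrized[OF pN] by (auto simp: N_def)
  have gN: "g \<in> measurable N m" using gm' by (simp add: N_def)
  have "distr Leb01 m (g \<circ> f) = distr N m g" using distr_distr[OF gN f(1)] f(2) by simp
  also have "\<dots> = distr m m (g \<circ> c)" unfolding N_def using distr_distr[OF gm' c] by simp
  also have "\<dots> = distr m m (\<lambda>y. y)" by (rule distr_cong) (auto simp: gc sp)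
  finally have "distr Leb01 m (g \<circ> f) = m" by (simp add: distr_id2)
  then have "g \<circ> f \<in> mm_parameters X"
    using measurable_comp[OF f(1) gN] by (simp add: mm_parameters_def m_def)
  then show ?thesis by blast
qed

section \<open>Couplings of Lebesgue measure on the unit interval\<close>

lemma pair_density_marginal:
  assumes p [measurable]: "p \<in> borel_measurable (Leb01 \<Otimes>\<^sub>M Leb01)"
    and 1: "AE s in Leb01. (\<integral>\<^sup>+t. p (s, t) \<partial>Leb01) = 1"
  shows "distr (density (Leb01 \<Otimes>\<^sub>M Leb01) p) Leb01 fst = Leb01"
proof (rule measure_eqI)
  fix A assume "A \<in> sets (distr (density (Leb01 \<Otimes>\<^sub>M Leb01) p) Leb01 fst)"
  then have A [measurable]: "A \<in> sets Leb01" by simp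
  have "emeasure (distr (density (Leb01 \<Otimes>\<^sub>M Leb01) p) Leb01 fst) A
     = emeasure (density (Leb01 \<Otimes>\<^sub>M Leb01) p) (fst -` A \<inter> space (Leb01 \<Otimes>\<^sub>M Leb01))"
    by (subst emeasure_distr) auto
  also have "\<dots> = (\<integral>\<^sup>+z. p z * indicator (fst -` A \<inter> space (Leb01 \<Otimes>\<^sub>M Leb01)) z \<partial>(Leb01 \<Otimes>\<^sub>M Leb01))"
    by (rule emeasure_density) auto
  also have "\<dots> = (\<integral>\<^sup>+z. p z * indicator A (fst z) \<partial>(Leb01 \<Otimes>\<^sub>M Leb01))"
    by (rule nn_integral_cong) (auto simp: indicator_def)
  also have "\<dots> = (\<integral>\<^sup>+s. \<integral>\<^sup>+t. p (s, t) * indicator A s \<partial>Leb01 \<partial>Leb01)"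
    by (subst Leb01.nn_integral_fst[symmetric]) auto
  also have "\<dots> = (\<integral>\<^sup>+s. (\<integral>\<^sup>+t. p (s, t) \<partial>Leb01) * indicator A s \<partial>Leb01)"
    by (intro nn_integral_cong nn_integral_multc) auto
  also have "\<dots> = (\<integral>\<^sup>+s. indicator A s \<partial>Leb01)"
    using 1 by (intro nn_integral_cong_AE) (auto elim!: eventually_mono)
  also have "\<dots> = emeasure Leb01 A" by (simp only: nn_integral_indicator A)
  finally show "emeasure (distr (density (Leb01 \<Otimes>\<^sub>M Leb01) p) Leb01 fst) A = emeasure Leb01 A" .
qed simp

lemma pair_density_marginal_snd:
  assumes p [measurable]: "p \<in> borel_measurable (Leb01 \<Otimes>\<^sub>M Leb01)"
    and 1: "AE t in Leb01. (\<integral>\<^sup>+s. p (s, t) \<partial>Leb01) = 1"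
  shows "distr (density (Leb01 \<Otimes>\<^sub>M Leb01) p) Leb01 snd = Leb01"
proof (rule measure_eqI)
  interpret pair_sigma_finite Leb01 Leb01 ..
  fix A assume "A \<in> sets (distr (density (Leb01 \<Otimes>\<^sub>M Leb01) p) Leb01 snd)"
  then have A [measurable]: "A \<in> sets Leb01" by simp
  have "emeasure (distr (density (Leb01 \<Otimes>\<^sub>M Leb01) p) Leb01 snd) A
     = emeasure (density (Leb01 \<Otimes>\<^sub>M Leb01) p) (snd -` A \<inter> space (Leb01 \<Otimes>\<^sub>M Leb01))"
    by (subst emeasure_distr) auto
  also have "\<dots> = (\<integral>\<^sup>+z. p z * indicator (snd -` A \<inter> space (Leb01 \<Otimes>\<^sub>M Leb01)) z \<partial>(Leb01 \<Otimes>\<^sub>M Leb01))"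
    by (rule emeasure_density) auto
  also have "\<dots> = (\<integral>\<^sup>+z. p z * indicator A (snd z) \<partial>(Leb01 \<Otimes>\<^sub>M Leb01))"
    by (rule nn_integral_cong) (auto simp: indicator_def)
  also have "\<dots> = (\<integral>\<^sup>+t. \<integral>\<^sup>+s. p (s, t) * indicator A t \<partial>Leb01 \<partial>Leb01)"
    by (subst nn_integral_snd[symmetric]) auto
  also have "\<dots> = (\<integral>\<^sup>+t. (\<integral>\<^sup>+s. p (s, t) \<partial>Leb01) * indicator A t \<partial>Leb01)"
    by (intro nn_integral_cong nn_integral_multc) auto
  also have "\<dots> = (\<integral>\<^sup>+t. indicator A t \<partial>Leb01)"
    using 1 by (intro nn_integral_cong_AE) (auto elim!: eventually_mono)
  also have "\<dots> = emeasure Leb01 A" by (simp only: nn_integral_indicator A)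
  finally show "emeasure (distr (density (Leb01 \<Otimes>\<^sub>M Leb01) p) Leb01 snd) A = emeasure Leb01 A" .
qed simp

lemma mm_space_euclidean:
  fixes P :: "'a::{complete_space, second_countable_topology} measure"
  assumes "prob_space P" "sets P = sets borel"
  shows "mm_space (euclidean_metric, P)"
proof -
  obtain D :: "'a set" where D: "countable D" "\<And>X. open X \<Longrightarrow> X \<noteq> {} \<Longrightarrow> \<exists>d\<in>D. d \<in> X"
    using countable_dense_setE by blast
  have "closure D = UNIV"
  proof (rule ccontr)
    assume "closure D \<noteq> UNIV"
    then have "- closure D \<noteq> {}" by auto
    then obtain d where "d \<in> D" "d \<in> - closure D" using D(2)[of "- closure D"] by auto
    then show False using closure_subset by blast
  qed
  then have "separable_space (euclidean :: 'a topology)"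
    unfolding separable_space_def using D(1) by (intro exI[of _ D]) simp
  moreover have "sets (borel_of (euclidean :: 'a topology)) = sets borel"
    by (simp add: borel_of_def borel_def)
  moreover have "mcomplete_of (euclidean_metric :: 'a metric)"
    by (simp add: mcomplete_of_def mcomplete_iff_complete complete_UNIV)
  ultimately show ?thesis
    using assms sets_eq_imp_space_eq[OF assms(2)] by (simp add: mm_space_def)
qed

text \<open>
  The half-open square is not complete, so the measure is moved to the plane, parametrised there,
  and retracted back to the square.
\<close>

lemma plane_measure_parametrized:
  fixes P :: "(real \<times> real) measure"
  assumes P: "prob_space P" "sets P = sets (Leb01 \<Otimes>\<^sub>M Leb01)"
  obtains \<tau> where "\<tau> \<in> measurable Leb01 P" "distr Leb01 P \<tau> = P"
proof -
  let ?B = "borel :: (real \<times> real) measure"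
  interpret P: prob_space P by fact
  have sp: "space P = {0..<1} \<times> {0..<1}"
    using sets_eq_imp_space_eq[OF P(2)] by (simp add: space_pair_measure)
  have "(\<lambda>z. z) \<in> measurable (Leb01 \<Otimes>\<^sub>M Leb01) (borel \<Otimes>\<^sub>M borel)"
  proof (rule measurable_pair)
    have "fst \<in> measurable (Leb01 \<Otimes>\<^sub>M Leb01) Leb01" "snd \<in> measurable (Leb01 \<Otimes>\<^sub>M Leb01) Leb01" by auto
    then show "fst \<circ> (\<lambda>z. z) \<in> measurable (Leb01 \<Otimes>\<^sub>M Leb01) borel" "snd \<circ> (\<lambda>z. z) \<in> measurable (Leb01 \<Otimes>\<^sub>M Leb01) borel"
      by (auto simp: measurable_restrict_space2_iff comp_def)
  qed
  then have idm: "(\<lambda>z. z) \<in> measurable P ?B"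
    by (simp only: measurable_cong_sets[OF P(2) refl] borel_prod)
  define Q where "Q = distr P ?B (\<lambda>z. z)"
  have "prob_space Q" unfolding Q_def by (rule P.prob_space_distr[OF idm])
  then have "mm_space (euclidean_metric, Q)" by (intro mm_space_euclidean) (simp_all add: Q_def)
  then obtain \<tau> where "\<tau> \<in> mm_parameters (euclidean_metric, Q)" using mm_parameters_nonempty by blast
  then have \<tau>: "\<tau> \<in> measurable Leb01 ?B" "distr Leb01 Q \<tau> = Q"
    by (auto simp: mm_parameters_def Q_def cong: measurable_cong_sets)
  have dB: "distr Leb01 ?B \<tau> = Q" using \<tau>(2) distr_cong[OF refl, of Q ?B Leb01 \<tau> \<tau>] by (simp add: Q_def)
  define r where "r z = (if z \<in> {0..<1} \<times> {0..<1} then z else (0, 0))" for z :: "real \<times> real"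
  have sq: "{0..<1} \<times> {0..<1} \<in> sets ?B" by (auto simp: borel_prod[symmetric])
  have rm [measurable]: "r \<in> borel_measurable ?B" unfolding r_def[abs_def] using sq by measurable
  have r: "r \<in> measurable ?B P"
  proof -
    have "r \<in> measurable ?B (Leb01 \<Otimes>\<^sub>M Leb01)"
    proof (rule measurable_pair)
      have "(fst :: real \<times> real \<Rightarrow> real) \<in> borel_measurable borel" "(snd :: real \<times> real \<Rightarrow> real) \<in> borel_measurable borel"
        by (auto intro!: borel_measurable_continuous_onI continuous_intros)
      then show "fst \<circ> r \<in> measurable borel Leb01" "snd \<circ> r \<in> measurable borel Leb01"
        by (auto simp: measurable_restrict_space2_iff r_def intro!: measurable_comp[OF rm])
    qed
    then show ?thesis using P(2) by (simp cong: measurable_cong_sets)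
  qed
  have "distr Leb01 P (r \<circ> \<tau>) = distr Q P r"
    using distr_distr[OF r \<tau>(1)] dB by simp
  also have "\<dots> = distr P P (r \<circ> (\<lambda>z. z))" unfolding Q_def by (rule distr_distr[OF r idm])
  also have "\<dots> = distr P P (\<lambda>z. z)" by (rule distr_cong) (auto simp: sp r_def)
  finally have "distr Leb01 P (r \<circ> \<tau>) = P" by (simp add: distr_id2)
  then show ?thesis using that measurable_comp[OF \<tau>(1) r] by blast
qed

text \<open>
  The coupling has a density on the square: on \<open>B k \<times> B' k\<close> it puts the common mass \<open>c k\<close> of \<open>B k\<close> and
  \<open>B' k\<close>, uniformly, and it distributes what is left of both marginals as a product.
\<close>

lemma leb_coupling:
  fixes B B' :: "nat \<Rightarrow> real set"
  assumes B [measurable]: "\<And>k. B k \<in> sets Leb01" and B' [measurable]: "\<And>k. B' k \<in> sets Leb01"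
    and dB: "disjoint_family B" and dB': "disjoint_family B'"
  obtains \<sigma> \<sigma>' I where "leb_preserving \<sigma>" "leb_preserving \<sigma>'" "I \<in> sets Leb01"
    "measure Leb01 I \<ge> (\<Sum>k<K. min (measure Leb01 (B k)) (measure Leb01 (B' k)))"
    "\<And>s. s \<in> I \<Longrightarrow> \<exists>k<K. \<sigma> s \<in> B k \<and> \<sigma>' s \<in> B' k"
proof -
  define b where "b k = measure Leb01 (B k)" for k
  define b' where "b' k = measure Leb01 (B' k)" for k
  define c where "c k = min (b k) (b' k)" for k
  define w where "w k = c k / (b k * b' k)" for k
  define r where "r s = 1 - (\<Sum>k<K. w k * b' k * indicator (B k) s)" for s
  define r' where "r' s = 1 - (\<Sum>k<K. w k * b k * indicator (B' k) s)" for s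
  define \<rho> where "\<rho> = 1 - (\<Sum>k<K. c k)"
  have bn: "0 \<le> b k" "0 \<le> b' k" "0 \<le> c k" "0 \<le> w k" for k
    by (auto simp: b_def b'_def c_def w_def intro!: divide_nonneg_nonneg mult_nonneg_nonneg)
  have wb: "0 \<le> w k * b' k" "w k * b' k \<le> 1" "0 \<le> w k * b k" "w k * b k \<le> 1" "w k * b' k * b k = c k" for k
    using bn[of k] unfolding w_def c_def by (auto simp: divide_simps min_def)
  have rn: "0 \<le> 1 - (\<Sum>k<K. v k * indicator (D k) s)" if "\<And>k. 0 \<le> v k" "\<And>k. v k \<le> 1" "disjoint_family D"
    for v :: "nat \<Rightarrow> real" and D :: "nat \<Rightarrow> real set" and s
  proof (cases "\<exists>j<K. s \<in> D j")
    case True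
    then obtain j where j: "j < K" "s \<in> D j" by blast
    have "(\<Sum>k<K. v k * indicator (D k) s) = (\<Sum>k<K. if k = j then v j else 0)"
      using j \<open>disjoint_family D\<close> by (intro sum.cong) (auto simp: indicator_def disjoint_family_on_def)
    then show ?thesis using j that(2) by simp
  next
    case False
    then have "(\<Sum>k<K. v k * indicator (D k) s) = 0" by (intro sum.neutral) auto
    then show ?thesis by simp
  qed
  have r0: "0 \<le> r s" for s unfolding r_def by (rule rn[OF wb(1,2) dB])
  have r'0: "0 \<le> r' s" for s unfolding r'_def by (rule rn[OF wb(3,4) dB'])
  have rm [measurable]: "r \<in> borel_measurable Leb01" "r' \<in> borel_measurable Leb01"
    unfolding r_def[abs_def] r'_def[abs_def] by measurable
  have r1: "r s \<le> 1" "r' s \<le> 1" for s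
    unfolding r_def r'_def using wb by (auto intro!: sum_nonneg)
  have ri: "integrable Leb01 r" "integrable Leb01 r'"
    using r0 r'0 r1 by (auto intro!: Leb01.integrable_const_bound[where B = 1])
  have ii: "integrable Leb01 (\<lambda>s. v * indicator D s :: real)" if "D \<in> sets Leb01" for v D
    using that by (intro integrable_mult_right integrable_real_indicator) (auto simp: Leb01.emeasure_eq_measure)
  have ir: "(\<integral>s. r s \<partial>Leb01) = \<rho>" "(\<integral>s. r' s \<partial>Leb01) = \<rho>"
  proof -
    have isum: "(\<integral>s. 1 - (\<Sum>k<K. v k * indicator (D k) s) \<partial>Leb01) = 1 - (\<Sum>k<K. v k * measure Leb01 (D k))"
      if D: "\<And>k. D k \<in> sets Leb01" for v :: "nat \<Rightarrow> real" and D
    proof -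
      have s: "integrable Leb01 (\<lambda>s. \<Sum>k<K. v k * indicator (D k) s)"
        by (intro Bochner_Integration.integrable_sum ii D)
      have "(\<integral>s. (\<Sum>k<K. v k * indicator (D k) s) \<partial>Leb01) = (\<Sum>k<K. \<integral>s. v k * indicator (D k) s \<partial>Leb01)"
        by (intro Bochner_Integration.integral_sum ii D)
      also have "\<dots> = (\<Sum>k<K. v k * measure Leb01 (D k))"
        using sets.sets_into_space[OF D] by (simp add: Int_absorb2)
      finally show ?thesis
        using Bochner_Integration.integral_diff[OF Leb01.integrable_const[of 1] s] Leb01.prob_space by simp
    qed
    show "(\<integral>s. r s \<partial>Leb01) = \<rho>"
      unfolding r_def isum[OF B] by (simp add: b_def[symmetric] wb(5) \<rho>_def)
    have "w k * b k * b' k = c k" for k using wb(5)[of k] by (simp add: mult_ac)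
    then show "(\<integral>s. r' s \<partial>Leb01) = \<rho>"
      unfolding r'_def isum[OF B'] by (simp add: b'_def[symmetric] \<rho>_def)
  qed
  have \<rho>0: "0 \<le> \<rho>" unfolding ir(1)[symmetric] using r0 by (rule Bochner_Integration.integral_nonneg)
  define p where "p = (\<lambda>(s, t). (\<Sum>k<K. w k * indicator (B k) s * indicator (B' k) t) + r s * r' t / \<rho>)"
  have pm [measurable]: "p \<in> borel_measurable (Leb01 \<Otimes>\<^sub>M Leb01)" unfolding p_def by measurable
  have p0: "0 \<le> p z" for z
    using bn r0 r'0 \<rho>0 by (auto simp: p_def case_prod_unfold intro!: add_nonneg_nonneg sum_nonneg)
  \<comment> \<open>If no mass is left, \<open>\<rho> = 0\<close>, then the remainders vanish almost everywhere and the value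
    \<open>0 / 0 = 0\<close> is harmless.\<close>
  have AEr: "AE s in Leb01. r s * \<rho> / \<rho> = r s" "AE s in Leb01. r' s * \<rho> / \<rho> = r' s"
  proof -
    have "AE s in Leb01. r s = 0" "AE s in Leb01. r' s = 0" if "\<rho> = 0"
      using ir that ri r0 r'0 by (simp_all add: integral_nonneg_eq_0_iff_AE)
    then show "AE s in Leb01. r s * \<rho> / \<rho> = r s" "AE s in Leb01. r' s * \<rho> / \<rho> = r' s"
      by (cases "\<rho> = 0"; auto)+
  qed
  have G: "(\<integral>\<^sup>+t. ennreal ((\<Sum>k<K. v k * indicator (D k) t) + u * q t) \<partial>Leb01)
      = ennreal ((\<Sum>k<K. v k * measure Leb01 (D k)) + u * (\<integral>t. q t \<partial>Leb01))"
    if D: "\<And>k. D k \<in> sets Leb01" and q: "integrable Leb01 q"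
      and nn: "\<And>t. 0 \<le> (\<Sum>k<K. v k * indicator (D k) t) + u * q t"
    for v :: "nat \<Rightarrow> real" and D u q
  proof -
    have s: "integrable Leb01 (\<lambda>t. \<Sum>k<K. v k * indicator (D k) t)"
      by (intro Bochner_Integration.integrable_sum ii D)
    have uq: "integrable Leb01 (\<lambda>t. u * q t)" using q by simp
    have "(\<integral>t. (\<Sum>k<K. v k * indicator (D k) t) \<partial>Leb01) = (\<Sum>k<K. \<integral>t. v k * indicator (D k) t \<partial>Leb01)"
      by (intro Bochner_Integration.integral_sum ii D)
    also have "\<dots> = (\<Sum>k<K. v k * measure Leb01 (D k))"
      using sets.sets_into_space[OF D] by (simp add: Int_absorb2)
    finally have "(\<integral>t. (\<Sum>k<K. v k * indicator (D k) t) + u * q t \<partial>Leb01)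
        = (\<Sum>k<K. v k * measure Leb01 (D k)) + u * (\<integral>t. q t \<partial>Leb01)"
      using Bochner_Integration.integral_add[OF s uq] by simp
    then show ?thesis
      using nn_integral_eq_integral[OF Bochner_Integration.integrable_add[OF s uq]] nn by simp
  qed
  have nn1: "(\<integral>\<^sup>+t. ennreal (p (s, t)) \<partial>Leb01) = ennreal ((\<Sum>k<K. w k * b' k * indicator (B k) s) + r s * \<rho> / \<rho>)" for s
  proof -
    have pe: "p (s, t) = (\<Sum>k<K. (w k * indicator (B k) s) * indicator (B' k) t) + (r s / \<rho>) * r' t" for t
      by (simp add: p_def)
    have nn: "0 \<le> (\<Sum>k<K. (w k * indicator (B k) s) * indicator (B' k) t) + (r s / \<rho>) * r' t" for t
      using p0[of "(s, t)"] unfolding pe .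
    show ?thesis unfolding pe G[where D = B', OF B' ri(2) nn] by (simp add: b'_def ir(2) mult_ac)
  qed
  have nn2: "(\<integral>\<^sup>+s. ennreal (p (s, t)) \<partial>Leb01) = ennreal ((\<Sum>k<K. w k * b k * indicator (B' k) t) + r' t * \<rho> / \<rho>)" for t
  proof -
    have pe: "p (s, t) = (\<Sum>k<K. (w k * indicator (B' k) t) * indicator (B k) s) + (r' t / \<rho>) * r s" for s
      by (simp add: p_def mult_ac)
    have nn: "0 \<le> (\<Sum>k<K. (w k * indicator (B' k) t) * indicator (B k) s) + (r' t / \<rho>) * r s" for s
      using p0[of "(s, t)"] unfolding pe .
    show ?thesis unfolding pe G[where D = B, OF B ri(1) nn] by (simp add: b_def ir(1) mult_ac)
  qed
  define P where "P = density (Leb01 \<Otimes>\<^sub>M Leb01) (\<lambda>z. ennreal (p z))"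
  have A1: "AE s in Leb01. (\<integral>\<^sup>+t. ennreal (p (s, t)) \<partial>Leb01) = 1"
    using AEr(1) unfolding nn1 by eventually_elim (simp add: r_def)
  have A2: "AE t in Leb01. (\<integral>\<^sup>+s. ennreal (p (s, t)) \<partial>Leb01) = 1"
    using AEr(2) unfolding nn2 by eventually_elim (simp add: r'_def)
  have m1: "distr P Leb01 fst = Leb01" unfolding P_def by (rule pair_density_marginal[OF _ A1]) measurable
  have m2: "distr P Leb01 snd = Leb01" unfolding P_def by (rule pair_density_marginal_snd[OF _ A2]) measurable
  have sP: "sets P = sets (Leb01 \<Otimes>\<^sub>M Leb01)" by (simp add: P_def)
  have fs: "fst \<in> measurable P Leb01" "snd \<in> measurable P Leb01" by (simp_all add: P_def)
  have "prob_space P"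
    by (rule prob_space_distrD[OF fs(1)]) (simp only: m1 prob_space_Leb01)
  then interpret P: prob_space P .
  obtain \<tau> where \<tau>: "\<tau> \<in> measurable Leb01 P" "distr Leb01 P \<tau> = P"
    using plane_measure_parametrized[OF P.prob_space_axioms sP] by blast
  define J where "J = (\<Union>k<K. B k \<times> B' k)"
  have Jm: "J \<in> sets P" unfolding sP J_def by (intro sets.finite_UN) auto
  define I where "I = \<tau> -` J \<inter> {0..<1}"
  have "leb_preserving (fst \<circ> \<tau>)" "leb_preserving (snd \<circ> \<tau>)"
    using distr_distr[OF fs(1) \<tau>(1)] distr_distr[OF fs(2) \<tau>(1)] \<tau>(2) m1 m2
      measurable_comp[OF \<tau>(1) fs(1)] measurable_comp[OF \<tau>(1) fs(2)] by simp_all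
  moreover have "I \<in> sets Leb01" using measurable_sets[OF \<tau>(1) Jm] by (simp add: I_def)
  moreover have "measure Leb01 I \<ge> (\<Sum>k<K. min (measure Leb01 (B k)) (measure Leb01 (B' k)))"
  proof -
    have "ennreal (\<Sum>k<K. c k) = (\<Sum>k<K. ennreal (w k) * (emeasure Leb01 (B k) * emeasure Leb01 (B' k)))"
    proof -
      have "ennreal (w k) * (emeasure Leb01 (B k) * emeasure Leb01 (B' k)) = ennreal (c k)" for k
      proof -
        have "emeasure Leb01 (B k) = ennreal (b k)" "emeasure Leb01 (B' k) = ennreal (b' k)"
          by (simp_all add: b_def b'_def Leb01.emeasure_eq_measure)
        moreover have "w k * (b k * b' k) = c k" using wb(5)[of k] by (simp only: mult_ac)
        ultimately show ?thesis using bn[of k] by (metis ennreal_mult mult_nonneg_nonneg)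
      qed
      then show ?thesis using bn(3) by (simp add: sum_ennreal)
    qed
    also have "\<dots> = (\<Sum>k<K. \<integral>\<^sup>+z. ennreal (w k) * indicator (B k \<times> B' k) z \<partial>(Leb01 \<Otimes>\<^sub>M Leb01))"
      by (simp add: nn_integral_cmult_indicator Leb01.emeasure_pair_measure_Times)
    also have "\<dots> = (\<integral>\<^sup>+z. (\<Sum>k<K. ennreal (w k) * indicator (B k \<times> B' k) z) \<partial>(Leb01 \<Otimes>\<^sub>M Leb01))"
      by (rule nn_integral_sum[symmetric]) auto
    also have "\<dots> \<le> (\<integral>\<^sup>+z. ennreal (p z) * indicator J z \<partial>(Leb01 \<Otimes>\<^sub>M Leb01))"
    proof (rule nn_integral_mono)
      fix z
      have "(\<Sum>k<K. ennreal (w k) * indicator (B k \<times> B' k) z)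
          = ennreal (\<Sum>k<K. w k * indicator (B k) (fst z) * indicator (B' k) (snd z))"
      proof -
        have "ennreal (w k) * indicator (B k \<times> B' k) z
            = ennreal (w k * indicator (B k) (fst z) * indicator (B' k) (snd z))" for k
          by (cases z) (auto simp: indicator_def)
        then show ?thesis using bn by (simp only:) (rule sum_ennreal, simp)
      qed
      also have "\<dots> \<le> ennreal (p z) * indicator J z"
      proof (cases "z \<in> J")
        case True
        then show ?thesis using r0 r'0 \<rho>0 by (auto simp: p_def case_prod_unfold intro!: ennreal_leI)
      next
        case False
        then have "(\<Sum>k<K. w k * indicator (B k) (fst z) * indicator (B' k) (snd z)) = 0"
          by (intro sum.neutral) (auto simp: J_def indicator_def mem_Times_iff)
        then show ?thesis using False by simp
      qed
      finally show "(\<Sum>k<K. ennreal (w k) * indicator (B k \<times> B' k) z) \<le> ennreal (p z) * indicator J z" .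
    qed
    also have "\<dots> = emeasure P J" unfolding P_def using Jm by (intro emeasure_density[symmetric]) (auto simp: sP)
    also have "\<dots> = emeasure Leb01 I" using emeasure_distr[OF \<tau>(1) Jm] \<tau>(2) by (simp add: I_def)
    finally show ?thesis
      by (simp add: Leb01.emeasure_eq_measure c_def b_def b'_def)
  qed
  moreover have "\<exists>k<K. (fst \<circ> \<tau>) s \<in> B k \<and> (snd \<circ> \<tau>) s \<in> B' k" if "s \<in> I" for s
    using that by (auto simp: I_def J_def mem_Times_iff)
  ultimately show ?thesis using that by blast
qed

section \<open>The box distance\<close>

lemma mm_parametersD:
  assumes "\<iota> \<in> mm_parameters X"
  shows "\<iota> \<in> measurable Leb01 (snd X)" "distr Leb01 (snd X) \<iota> = snd X"
  using assms by (auto simp: mm_parameters_def)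

lemma mm_parameters_measure:
  assumes \<iota>: "\<iota> \<in> mm_parameters X" and A: "A \<in> sets (snd X)"
  shows "measure Leb01 (\<iota> -` A \<inter> {0..<1}) = measure (snd X) A"
  using measure_distr[OF mm_parametersD(1)[OF \<iota>] A] mm_parametersD(2)[OF \<iota>] by simp

lemma mm_parameters_comp:
  assumes \<iota>: "\<iota> \<in> mm_parameters X" and \<sigma>: "leb_preserving \<sigma>"
  shows "\<iota> \<circ> \<sigma> \<in> mm_parameters X"
  using distr_distr[of \<iota> Leb01 "snd X" \<sigma> Leb01] measurable_comp[of \<sigma> Leb01 Leb01 \<iota> "snd X"] assms
  by (auto simp: mm_parameters_def)

lemma mm_parameters_space:
  assumes X: "mm_space X" and \<iota>: "\<iota> \<in> mm_parameters X" and s: "s \<in> {0..<1}"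
  shows "\<iota> s \<in> mspace (fst X)"
  using measurable_space[OF mm_parametersD(1)[OF \<iota>], of s] s mm_space_sets(1)[OF X] by simp

text \<open>The relation whose admissible \<open>\<epsilon>\<close> have the box distance as their infimum.\<close>

definition box_within :: "'a mm \<Rightarrow> 'b mm \<Rightarrow> real \<Rightarrow> bool" where
  "box_within X Y \<epsilon> \<longleftrightarrow> 0 \<le> \<epsilon> \<and> (\<exists>\<iota>\<in>mm_parameters X. \<exists>\<kappa>\<in>mm_parameters Y.
     \<exists>I \<in> sets Leb01. measure Leb01 I \<ge> 1 - \<epsilon> \<and>
        (\<forall>s\<in>I. \<forall>t\<in>I. \<bar>mdist (fst X) (\<iota> s) (\<iota> t) - mdist (fst Y) (\<kappa> s) (\<kappa> t)\<bar> \<le> \<epsilon>))"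

lemma box_dist_le_iff:
  assumes X: "mm_space X" and Y: "mm_space Y"
  shows "box_within X Y \<epsilon> \<Longrightarrow> box_dist X Y \<le> \<epsilon>"
    and "box_dist X Y < \<epsilon> \<Longrightarrow> \<exists>\<delta><\<epsilon>. box_within X Y \<delta>"
proof -
  define S where "S \<iota> \<kappa> = {\<epsilon>. 0 \<le> \<epsilon> \<and> (\<exists>I \<in> sets Leb01. measure Leb01 I \<ge> 1 - \<epsilon> \<and>
        (\<forall>s\<in>I. \<forall>t\<in>I. \<bar>mdist (fst X) (\<iota> s) (\<iota> t) - mdist (fst Y) (\<kappa> s) (\<kappa> t)\<bar> \<le> \<epsilon>))}" for \<iota> \<kappa>
  let ?P = "mm_parameters X \<times> mm_parameters Y"
  have bd: "box_dist X Y = (INF p\<in>?P. Inf (S (fst p) (snd p)))"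
    by (simp add: box_dist_def S_def case_prod_unfold)
  have Sb: "bdd_below (S \<iota> \<kappa>)" for \<iota> \<kappa> by (auto simp: S_def bdd_below_def)
  have "1 \<in> S \<iota> \<kappa>" for \<iota> \<kappa> unfolding S_def by (auto intro!: bexI[of _ "{}"])
  then have Sne: "S \<iota> \<kappa> \<noteq> {}" for \<iota> \<kappa> by blast
  have Inn: "0 \<le> Inf (S \<iota> \<kappa>)" for \<iota> \<kappa> by (rule cInf_greatest[OF Sne]) (simp add: S_def)
  have bb: "bdd_below ((\<lambda>p. Inf (S (fst p) (snd p))) ` ?P)"
    using Inn by (auto simp: bdd_below_def)
  show "box_dist X Y \<le> \<epsilon>" if "box_within X Y \<epsilon>"
  proof -
    obtain \<iota> \<kappa> where p: "(\<iota>, \<kappa>) \<in> ?P" "\<epsilon> \<in> S \<iota> \<kappa>"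
      using \<open>box_within X Y \<epsilon>\<close> unfolding box_within_def S_def by blast
    have "box_dist X Y \<le> Inf (S \<iota> \<kappa>)"
      unfolding bd using cINF_lower[OF bb p(1)] by simp
    also have "\<dots> \<le> \<epsilon>" by (rule cInf_lower[OF p(2) Sb])
    finally show ?thesis .
  qed
  show "\<exists>\<delta><\<epsilon>. box_within X Y \<delta>" if "box_dist X Y < \<epsilon>"
  proof -
    have "?P \<noteq> {}" using mm_parameters_nonempty[OF X] mm_parameters_nonempty[OF Y] by blast
    then have "\<exists>p\<in>?P. Inf (S (fst p) (snd p)) < \<epsilon>"
      using \<open>box_dist X Y < \<epsilon>\<close> unfolding bd using cINF_less_iff[OF _ bb] by blast
    then obtain \<iota> \<kappa> where p: "\<iota> \<in> mm_parameters X" "\<kappa> \<in> mm_parameters Y" "Inf (S \<iota> \<kappa>) < \<epsilon>" by auto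
    then obtain \<delta> where \<delta>: "\<delta> \<in> S \<iota> \<kappa>" "\<delta> < \<epsilon>"
      using cInf_lessD[OF Sne] by blast
    then have "box_within X Y \<delta>"
      using p(1,2) unfolding box_within_def S_def by blast
    then show ?thesis using \<delta>(2) by blast
  qed
qed

lemma mm_space_dist:
  assumes X: "mm_space X" and "x \<in> mspace (fst X)" "y \<in> mspace (fst X)" "z \<in> mspace (fst X)"
  shows "mdist (fst X) x z \<le> mdist (fst X) x y + mdist (fst X) y z"
    and "mdist (fst X) x y = mdist (fst X) y x"
proof -
  interpret Metric_space "mspace (fst X)" "mdist (fst X)" by simp
  show "mdist (fst X) x z \<le> mdist (fst X) x y + mdist (fst X) y z" "mdist (fst X) x y = mdist (fst X) y x"
    using assms by (auto simp: triangle commute)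
qed

lemma mm_space_dist_diff:
  assumes X: "mm_space X" and "a \<in> mspace (fst X)" "b \<in> mspace (fst X)" "a' \<in> mspace (fst X)" "b' \<in> mspace (fst X)"
    and "mdist (fst X) a a' \<le> r" "mdist (fst X) b b' \<le> r"
  shows "\<bar>mdist (fst X) a b - mdist (fst X) a' b'\<bar> \<le> 2 * r"
  using mm_space_dist(1)[OF X, of a a' b] mm_space_dist(1)[OF X, of a' b' b]
    mm_space_dist(1)[OF X, of a' a b'] mm_space_dist(1)[OF X, of a b b']
    mm_space_dist(2)[OF X, of a a'] mm_space_dist(2)[OF X, of b b'] assms
  by (simp add: abs_le_iff)

lemma fine_partition:
  assumes X: "mm_space X" and \<delta>: "\<delta> > 0"
  obtains A :: "nat \<Rightarrow> 'a set" and K where "\<And>k. A k \<in> sets (snd X)" "disjoint_family A"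
    "\<And>k x y. x \<in> A k \<Longrightarrow> y \<in> A k \<Longrightarrow> mdist (fst X) x y \<le> \<delta>"
    "(\<Sum>k<K. measure (snd X) (A k)) > 1 - \<delta>"
proof -
  interpret Metric_space "mspace (fst X)" "mdist (fst X)" by simp
  have top: "mtopology_of (fst X) = mtopology" by (simp add: mtopology_of_def)
  interpret P: prob_space "snd X" by (rule mm_space_sets(3)[OF X])
  obtain q :: "nat \<Rightarrow> 'a" where "(\<forall>k. q k \<in> mspace (fst X)) \<and>
    (\<forall>x\<in>mspace (fst X). \<forall>r>0. \<exists>k. mdist (fst X) (q k) x < r)"
    using countable_dense_sequence[OF X] by blast
  then have q: "\<And>k. q k \<in> mspace (fst X)" "\<And>x r. x \<in> mspace (fst X) \<Longrightarrow> r > 0 \<Longrightarrow> \<exists>k. mdist (fst X) (q k) x < r"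
    by simp_all
  define U where "U k = mball (q k) (\<delta> / 2)" for k
  have U: "U k \<in> sets (snd X)" for k
    unfolding mm_space_sets(2)[OF X] top U_def by (intro borel_ofI) simp
  define A where "A = disjointed U"
  have As: "A k \<in> sets (snd X)" for k
    using sets.range_disjointed_sets[of U] U by (auto simp: A_def)
  have dA: "disjoint_family A" unfolding A_def by (rule disjoint_family_disjointed)
  have diam: "mdist (fst X) x y \<le> \<delta>" if "x \<in> A k" "y \<in> A k" for k x y
  proof -
    have "x \<in> U k" "y \<in> U k" using that disjointed_subset[of U k] by (auto simp: A_def)
    then show ?thesis using mm_space_dist(1)[OF X, of x "q k" y] by (auto simp: U_def commute)
  qed
  have "(\<Union>k. A k) = (\<Union>k. U k)" unfolding A_def by (rule UN_disjointed_eq)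
  also have "\<dots> = space (snd X)"
  proof
    show "(\<Union>k. U k) \<subseteq> space (snd X)" using U sets.sets_into_space by blast
    show "space (snd X) \<subseteq> (\<Union>k. U k)"
    proof
      fix x assume "x \<in> space (snd X)"
      then have x: "x \<in> mspace (fst X)" using mm_space_sets(1)[OF X] by simp
      then obtain k where "mdist (fst X) (q k) x < \<delta> / 2" using q(2)[of x "\<delta>/2"] \<delta> by auto
      then show "x \<in> (\<Union>k. U k)" using x q(1) by (auto simp: U_def)
    qed
  qed
  finally have UN: "(\<Union>k. A k) = space (snd X)" .
  have "(\<lambda>k. measure (snd X) (A k)) sums 1"
    using P.finite_measure_UNION[OF _ dA] As UN P.prob_space by (auto simp: image_subset_iff)
  then have "(\<lambda>K. \<Sum>k<K. measure (snd X) (A k)) \<longlonglongrightarrow> 1" by (simp add: sums_def)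
  then have "eventually (\<lambda>K. (\<Sum>k<K. measure (snd X) (A k)) > 1 - \<delta>) sequentially"
    using \<delta> by (intro order_tendstoD(1)) auto
  then obtain K where "(\<Sum>k<K. measure (snd X) (A k)) > 1 - \<delta>"
    by (auto simp: eventually_sequentially)
  then show ?thesis using that As dA diam by blast
qed

text \<open>
  Parameters of two measures on the same space can be reparametrised so that they fall into the same
  cell of a partition, as far as the masses of the cells allow.
\<close>

lemma parameter_coupling:
  fixes A :: "nat \<Rightarrow> 'a set"
  assumes \<iota>: "\<iota> \<in> mm_parameters X" and \<kappa>: "\<kappa> \<in> mm_parameters X'"
    and A: "\<And>k. A k \<in> sets (snd X)" "\<And>k. A k \<in> sets (snd X')" and dA: "disjoint_family A"
    and diam: "\<forall>k. \<forall>x\<in>A k. \<forall>y\<in>A k. d x y \<le> \<delta>"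
  obtains \<sigma> \<sigma>' I where "leb_preserving \<sigma>" "leb_preserving \<sigma>'" "I \<in> sets Leb01"
    "measure Leb01 I \<ge> (\<Sum>k<K. min (measure (snd X) (A k)) (measure (snd X') (A k)))"
    "\<And>s. s \<in> I \<Longrightarrow> d (\<iota> (\<sigma> s)) (\<kappa> (\<sigma>' s)) \<le> (\<delta> :: real)"
proof -
  define B where "B k = \<iota> -` A k \<inter> {0..<1}" for k
  define B' where "B' k = \<kappa> -` A k \<inter> {0..<1}" for k
  have B: "B k \<in> sets Leb01" "B' k \<in> sets Leb01" for k
    using measurable_sets[OF mm_parametersD(1)[OF \<iota>] A(1)] measurable_sets[OF mm_parametersD(1)[OF \<kappa>] A(2)]
    by (simp_all add: B_def B'_def)
  have dB: "disjoint_family B" "disjoint_family B'"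
    using dA by (auto simp: disjoint_family_on_def B_def B'_def)
  have mB: "measure Leb01 (B k) = measure (snd X) (A k)" "measure Leb01 (B' k) = measure (snd X') (A k)" for k
    using mm_parameters_measure[OF \<iota> A(1)] mm_parameters_measure[OF \<kappa> A(2)] by (simp_all add: B_def B'_def)
  obtain \<sigma> \<sigma>' I where s: "leb_preserving \<sigma>" "leb_preserving \<sigma>'" "I \<in> sets Leb01"
    "measure Leb01 I \<ge> (\<Sum>k<K. min (measure Leb01 (B k)) (measure Leb01 (B' k)))"
    "\<And>s. s \<in> I \<Longrightarrow> \<exists>k<K. \<sigma> s \<in> B k \<and> \<sigma>' s \<in> B' k"
    using leb_coupling[where B = B and B' = B' and K = K, OF B dB] by blast
  have "d (\<iota> (\<sigma> s)) (\<kappa> (\<sigma>' s)) \<le> \<delta>" if "s \<in> I" for s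
    using s(5)[OF that] diam by (auto simp: B_def B'_def)
  then show ?thesis using that s(1-4) by (simp add: mB)
qed

lemma leb_preserving_measure:
  assumes "leb_preserving \<sigma>" "J \<in> sets Leb01"
  shows "\<sigma> -` J \<inter> {0..<1} \<in> sets Leb01" "measure Leb01 (\<sigma> -` J \<inter> {0..<1}) = measure Leb01 J"
  using measurable_sets[of \<sigma> Leb01 Leb01 J] measure_distr[of \<sigma> Leb01 Leb01 J] assms by simp_all

lemma leb_preserving_space:
  assumes "leb_preserving \<sigma>" "s \<in> {0..<1}" shows "\<sigma> s \<in> {0..<1}"
  using measurable_space[of \<sigma> Leb01 Leb01 s] assms by simp

lemma (in prob_space) prob_Int_ge:
  assumes "A \<in> events" "B \<in> events" "prob A \<ge> 1 - a" "prob B \<ge> 1 - b"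
  shows "prob (A \<inter> B) \<ge> 1 - (a + b)"
proof -
  have "prob (A \<union> B) = prob A + prob B - prob (A \<inter> B)"
    by (rule measure_Un3) (simp_all add: assms fmeasurable_eq_sets)
  then show ?thesis using prob_le_1[of "A \<union> B"] assms(3,4) by linarith
qed

text \<open>
  The two estimates use different parameters of \<open>Y\<close>; after reparametrisation these are within \<open>\<delta>\<close> of
  each other off a set of measure \<open>\<delta>\<close>.
\<close>

lemma box_within_triangle:
  assumes X: "mm_space X" and Y: "mm_space Y" and Z: "mm_space Z"
    and XY: "box_within X Y e1" and YZ: "box_within Y Z e2" and \<delta>: "\<delta> > 0"
  shows "box_within X Z (e1 + e2 + 2 * \<delta>)"
proof -
  obtain \<iota> \<kappa> I where 1: "\<iota> \<in> mm_parameters X" "\<kappa> \<in> mm_parameters Y" "I \<in> sets Leb01" "measure Leb01 I \<ge> 1 - e1"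
    "\<And>s t. s \<in> I \<Longrightarrow> t \<in> I \<Longrightarrow> \<bar>mdist (fst X) (\<iota> s) (\<iota> t) - mdist (fst Y) (\<kappa> s) (\<kappa> t)\<bar> \<le> e1" and e1: "e1 \<ge> 0"
    using XY unfolding box_within_def by blast
  obtain \<kappa>' \<theta> J where 2: "\<kappa>' \<in> mm_parameters Y" "\<theta> \<in> mm_parameters Z" "J \<in> sets Leb01" "measure Leb01 J \<ge> 1 - e2"
    "\<And>s t. s \<in> J \<Longrightarrow> t \<in> J \<Longrightarrow> \<bar>mdist (fst Y) (\<kappa>' s) (\<kappa>' t) - mdist (fst Z) (\<theta> s) (\<theta> t)\<bar> \<le> e2" and e2: "e2 \<ge> 0"
    using YZ unfolding box_within_def by blast
  obtain A :: "nat \<Rightarrow> 'b set" and K where A: "\<And>k. A k \<in> sets (snd Y)" "disjoint_family A"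
    "\<And>k x y. x \<in> A k \<Longrightarrow> y \<in> A k \<Longrightarrow> mdist (fst Y) x y \<le> \<delta>"
    "(\<Sum>k<K. measure (snd Y) (A k)) > 1 - \<delta>"
    using fine_partition[OF Y \<delta>] by blast
  have diam': "\<forall>k. \<forall>x\<in>A k. \<forall>y\<in>A k. mdist (fst Y) x y \<le> \<delta>" using A(3) by blast
  obtain \<sigma> \<sigma>' L where s: "leb_preserving \<sigma>" "leb_preserving \<sigma>'" "L \<in> sets Leb01"
    "measure Leb01 L \<ge> (\<Sum>k<K. min (measure (snd Y) (A k)) (measure (snd Y) (A k)))"
    "\<And>s. s \<in> L \<Longrightarrow> mdist (fst Y) (\<kappa> (\<sigma> s)) (\<kappa>' (\<sigma>' s)) \<le> \<delta>"
    by (rule parameter_coupling[where K = K and d = "mdist (fst Y)", OF 1(2) 2(1) A(1) A(1) A(2) diam']) (rule that)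
  define I' where "I' = \<sigma> -` I \<inter> {0..<1}"
  define J' where "J' = \<sigma>' -` J \<inter> {0..<1}"
  have I': "I' \<in> sets Leb01" "measure Leb01 I' \<ge> 1 - e1"
    using leb_preserving_measure[OF s(1) 1(3)] 1(4) by (simp_all add: I'_def)
  have J': "J' \<in> sets Leb01" "measure Leb01 J' \<ge> 1 - e2"
    using leb_preserving_measure[OF s(2) 2(3)] 2(4) by (simp_all add: J'_def)
  have "measure Leb01 (I' \<inter> J' \<inter> L) \<ge> 1 - (e1 + e2 + \<delta>)"
    using s(3,4) A(4) I' J' by (intro Leb01.prob_Int_ge) auto
  moreover have "I' \<inter> J' \<inter> L \<in> sets Leb01" using I' J' s by auto
  moreover have "\<bar>mdist (fst X) ((\<iota> \<circ> \<sigma>) s) ((\<iota> \<circ> \<sigma>) t) - mdist (fst Z) ((\<theta> \<circ> \<sigma>') s) ((\<theta> \<circ> \<sigma>') t)\<bar> \<le> e1 + e2 + 2 * \<delta>"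
    if st: "s \<in> I' \<inter> J' \<inter> L" "t \<in> I' \<inter> J' \<inter> L" for s t
  proof -
    have "\<kappa> (\<sigma> u) \<in> mspace (fst Y)" "\<kappa>' (\<sigma>' u) \<in> mspace (fst Y)" if "u \<in> I'" for u
    proof -
      have u: "u \<in> {0..<1}" using that by (simp add: I'_def)
      show "\<kappa> (\<sigma> u) \<in> mspace (fst Y)"
        by (rule mm_parameters_space[OF Y 1(2) leb_preserving_space[OF s(1) u]])
      show "\<kappa>' (\<sigma>' u) \<in> mspace (fst Y)"
        by (rule mm_parameters_space[OF Y 2(1) leb_preserving_space[OF s(2) u]])
    qed
    then have "\<bar>mdist (fst Y) (\<kappa> (\<sigma> s)) (\<kappa> (\<sigma> t)) - mdist (fst Y) (\<kappa>' (\<sigma>' s)) (\<kappa>' (\<sigma>' t))\<bar> \<le> 2 * \<delta>"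
      using st s(5) by (intro mm_space_dist_diff[OF Y]) auto
    moreover have "\<bar>mdist (fst X) (\<iota> (\<sigma> s)) (\<iota> (\<sigma> t)) - mdist (fst Y) (\<kappa> (\<sigma> s)) (\<kappa> (\<sigma> t))\<bar> \<le> e1"
      using st by (intro 1(5)) (auto simp: I'_def)
    moreover have "\<bar>mdist (fst Y) (\<kappa>' (\<sigma>' s)) (\<kappa>' (\<sigma>' t)) - mdist (fst Z) (\<theta> (\<sigma>' s)) (\<theta> (\<sigma>' t))\<bar> \<le> e2"
      using st by (intro 2(5)) (auto simp: J'_def)
    ultimately show ?thesis by simp
  qed
  ultimately show ?thesis
    unfolding box_within_def using e1 e2 \<delta> mm_parameters_comp[OF 1(1) s(1)] mm_parameters_comp[OF 2(2) s(2)]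
    by (intro conjI bexI[of _ "\<iota> \<circ> \<sigma>"] bexI[of _ "\<theta> \<circ> \<sigma>'"] bexI[of _ "I' \<inter> J' \<inter> L"]) auto
qed

lemma box_dist_triangle:
  assumes X: "mm_space X" and Y: "mm_space Y" and Z: "mm_space Z"
  shows "box_dist X Z \<le> box_dist X Y + box_dist Y Z"
proof (rule field_le_epsilon)
  fix e :: real assume e: "e > 0"
  obtain e1 where e1: "e1 < box_dist X Y + e / 4" "box_within X Y e1"
    using box_dist_le_iff(2)[OF X Y, of "box_dist X Y + e / 4"] e by auto
  obtain e2 where e2: "e2 < box_dist Y Z + e / 4" "box_within Y Z e2"
    using box_dist_le_iff(2)[OF Y Z, of "box_dist Y Z + e / 4"] e by auto
  have "box_dist X Z \<le> e1 + e2 + 2 * (e / 4)"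
    using box_within_triangle[OF X Y Z e1(2) e2(2), of "e / 4"] e by (intro box_dist_le_iff(1)[OF X Z]) auto
  then show "box_dist X Z \<le> box_dist X Y + box_dist Y Z + e" using e1 e2 by simp
qed

lemma box_within_sym: "box_within X Y e \<Longrightarrow> box_within Y X e"
  unfolding box_within_def by (metis abs_minus_commute)

lemma box_within_same_metric:
  fixes A :: "nat \<Rightarrow> 'a set"
  assumes Y: "mm_space Y" and Y': "mm_space Y'" and same: "fst Y' = fst Y"
    and A: "\<And>k. A k \<in> sets (snd Y)" "disjoint_family A"
    and diam: "\<And>k x y. x \<in> A k \<Longrightarrow> y \<in> A k \<Longrightarrow> mdist (fst Y) x y \<le> \<delta>"
    and mass: "(\<Sum>k<K. measure (snd Y) (A k)) \<ge> 1 - \<delta>"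
    and close: "(\<Sum>k<K. \<bar>measure (snd Y') (A k) - measure (snd Y) (A k)\<bar>) \<le> \<delta>"
    and \<delta>: "\<delta> \<ge> 0"
  shows "box_within Y Y' (2 * \<delta>)"
proof -
  have ss: "sets (snd Y') = sets (snd Y)" using mm_space_sets(2)[OF Y] mm_space_sets(2)[OF Y'] same by simp
  obtain \<iota> where \<iota>: "\<iota> \<in> mm_parameters Y" using mm_parameters_nonempty[OF Y] by blast
  obtain \<kappa> where \<kappa>: "\<kappa> \<in> mm_parameters Y'" using mm_parameters_nonempty[OF Y'] by blast
  have A': "A k \<in> sets (snd Y')" for k using A(1) ss by simp
  have diam': "\<forall>k. \<forall>x\<in>A k. \<forall>y\<in>A k. mdist (fst Y) x y \<le> \<delta>" using diam by blast
  obtain \<sigma> \<sigma>' L where s: "leb_preserving \<sigma>" "leb_preserving \<sigma>'" "L \<in> sets Leb01"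
    "measure Leb01 L \<ge> (\<Sum>k<K. min (measure (snd Y) (A k)) (measure (snd Y') (A k)))"
    "\<And>s. s \<in> L \<Longrightarrow> mdist (fst Y) (\<iota> (\<sigma> s)) (\<kappa> (\<sigma>' s)) \<le> \<delta>"
    by (rule parameter_coupling[where K = K and d = "mdist (fst Y)", OF \<iota> \<kappa> A(1) A' A(2) diam']) (rule that)
  have "1 - 2 * \<delta> \<le> (\<Sum>k<K. measure (snd Y) (A k)) - (\<Sum>k<K. \<bar>measure (snd Y') (A k) - measure (snd Y) (A k)\<bar>)"
    using mass close by simp
  also have "\<dots> = (\<Sum>k<K. measure (snd Y) (A k) - \<bar>measure (snd Y') (A k) - measure (snd Y) (A k)\<bar>)"
    by (simp add: sum_subtractf)
  also have "\<dots> \<le> (\<Sum>k<K. min (measure (snd Y) (A k)) (measure (snd Y') (A k)))"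
    by (intro sum_mono) auto
  finally have L: "measure Leb01 L \<ge> 1 - 2 * \<delta>" using s(4) by simp
  have "\<bar>mdist (fst Y) ((\<iota> \<circ> \<sigma>) s) ((\<iota> \<circ> \<sigma>) t) - mdist (fst Y') ((\<kappa> \<circ> \<sigma>') s) ((\<kappa> \<circ> \<sigma>') t)\<bar> \<le> 2 * \<delta>"
    if st: "s \<in> L" "t \<in> L" for s t
  proof -
    have "L \<subseteq> {0..<1}" using s(3) by (simp add: sets_Leb01)
    then have u: "u \<in> {0..<1}" if "u \<in> L" for u using that by blast
    have "\<iota> (\<sigma> u) \<in> mspace (fst Y)" if "u \<in> L" for u
      by (rule mm_parameters_space[OF Y \<iota> leb_preserving_space[OF s(1) u[OF that]]])
    moreover have "\<kappa> (\<sigma>' u) \<in> mspace (fst Y)" if "u \<in> L" for u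
      using mm_parameters_space[OF Y' \<kappa> leb_preserving_space[OF s(2) u[OF that]]] by (simp only: same)
    ultimately show ?thesis
      using st s(5) unfolding same comp_def by (intro mm_space_dist_diff[OF Y]) auto
  qed
  then show ?thesis
    unfolding box_within_def using L s(3) \<delta> mm_parameters_comp[OF \<iota> s(1)] mm_parameters_comp[OF \<kappa> s(2)]
    by (intro conjI bexI[of _ "\<iota> \<circ> \<sigma>"] bexI[of _ "\<kappa> \<circ> \<sigma>'"] bexI[of _ L]) auto
qed

section \<open>Isomorphism classes and box closures\<close>

lemma msupport_full:
  assumes X: "mm_space X"
  shows "msupport X \<in> sets (snd X)" "measure (snd X) (msupport X) = 1"
proof -
  interpret Metric_space "mspace (fst X)" "mdist (fst X)" by simp
  have top: "mtopology_of (fst X) = mtopology" by (simp add: mtopology_of_def)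
  interpret P: prob_space "snd X" by (rule mm_space_sets(3)[OF X])
  obtain q :: "nat \<Rightarrow> 'a" where "(\<forall>k. q k \<in> mspace (fst X)) \<and>
    (\<forall>x\<in>mspace (fst X). \<forall>r>0. \<exists>k. mdist (fst X) (q k) x < r)"
    using countable_dense_sequence[OF X] by blast
  then have q: "\<And>k. q k \<in> mspace (fst X)" "\<And>x r. x \<in> mspace (fst X) \<Longrightarrow> r > 0 \<Longrightarrow> \<exists>k. mdist (fst X) (q k) x < r"
    by simp_all
  \<comment> \<open>The complement of the support is the union of the null balls in a countable family.\<close>
  define U where "U p = mball (q (fst p)) (inverse (Suc (snd p)))" for p :: "nat \<times> nat"
  define N where "N = {p. emeasure (snd X) (U p) = 0}"
  have U: "U p \<in> sets (snd X)" for p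
    unfolding mm_space_sets(2)[OF X] top U_def by (intro borel_ofI) simp
  have "msupport X = space (snd X) - (\<Union>p\<in>N. U p)"
  proof (intro set_eqI iffI)
    fix x assume x: "x \<in> msupport X"
    have "x \<notin> U p" if "p \<in> N" for p
    proof
      assume "x \<in> U p"
      moreover have "openin mtopology (U p)" by (simp add: U_def)
      ultimately have "0 < emeasure (snd X) (U p)" using x unfolding msupport_def top by blast
      then show False using that by (simp add: N_def)
    qed
    then show "x \<in> space (snd X) - (\<Union>p\<in>N. U p)" using x mm_space_sets(1)[OF X] by (auto simp: msupport_def)
  next
    fix x assume x: "x \<in> space (snd X) - (\<Union>p\<in>N. U p)"
    then have xM: "x \<in> mspace (fst X)" using mm_space_sets(1)[OF X] by auto
    have "0 < emeasure (snd X) V" if V: "openin mtopology V" "x \<in> V" for V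
    proof (rule ccontr)
      assume "\<not> 0 < emeasure (snd X) V"
      then have V0: "emeasure (snd X) V = 0" by simp
      obtain r where r: "r > 0" "mball x r \<subseteq> V" using V by (auto simp: openin_mtopology)
      obtain n where n: "inverse (Suc n) < r / 2" using reals_Archimedean[of "r/2"] r by auto
      obtain k where k: "mdist (fst X) (q k) x < inverse (Suc n)" using q(2)[OF xM, of "inverse (Suc n)"] by auto
      have "U (k, n) \<subseteq> mball x r"
      proof
        fix z assume z: "z \<in> U (k, n)"
        then have "mdist (fst X) x z \<le> mdist (fst X) (q k) x + mdist (fst X) (q k) z"
          using mm_space_dist(1)[OF X, of x "q k" z] xM q(1) by (auto simp: U_def commute)
        also have "\<dots> < r" using k n z by (auto simp: U_def)
        finally show "z \<in> mball x r" using z xM by (auto simp: U_def)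
      qed
      then have "emeasure (snd X) (U (k, n)) \<le> emeasure (snd X) V"
        using r V(1) mm_space_sets(2)[OF X] top by (intro emeasure_mono) (auto intro: borel_ofI)
      then have "(k, n) \<in> N" using V0 by (simp add: N_def)
      moreover have "x \<in> U (k, n)" using k xM q(1) by (auto simp: U_def)
      ultimately show False using x by blast
    qed
    then show "x \<in> msupport X" using xM by (simp add: msupport_def top)
  qed
  moreover have N: "(\<Union>p\<in>N. U p) \<in> null_sets (snd X)"
  proof (rule null_sets_UN')
    fix p assume "p \<in> N"
    then show "U p \<in> null_sets (snd X)" using U[of p] by (intro null_setsI) (simp add: N_def)
  qed simp
  moreover have "measure (snd X) (\<Union>p\<in>N. U p) = 0" by (simp add: measure_def null_setsD1[OF N])
  ultimately show "msupport X \<in> sets (snd X)" "measure (snd X) (msupport X) = 1"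
    using P.prob_compl[OF null_setsD2[OF N]] by auto
qed

lemma box_within_mm_iso:
  assumes X: "mm_space X" and Y: "mm_space Y" and iso: "mm_iso X Y"
  shows "box_within X Y 0"
proof -
  obtain f where f: "f \<in> measurable (snd X) (snd Y)" "distr (snd X) (snd Y) f = snd Y"
    "\<And>x y. x \<in> msupport X \<Longrightarrow> y \<in> msupport X \<Longrightarrow> mdist (fst Y) (f x) (f y) = mdist (fst X) x y"
    using iso unfolding mm_iso_def by blast
  obtain \<iota> where \<iota>: "\<iota> \<in> mm_parameters X" using mm_parameters_nonempty[OF X] by blast
  have "f \<circ> \<iota> \<in> mm_parameters Y"
    using distr_distr[OF f(1) mm_parametersD(1)[OF \<iota>]] mm_parametersD(2)[OF \<iota>] f(2)
      measurable_comp[OF mm_parametersD(1)[OF \<iota>] f(1)] by (simp add: mm_parameters_def)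
  moreover define I where "I = \<iota> -` msupport X \<inter> {0..<1}"
  have "measure Leb01 I = 1"
    unfolding I_def mm_parameters_measure[OF \<iota> msupport_full(1)[OF X]] by (rule msupport_full(2)[OF X])
  moreover have "I \<in> sets Leb01"
    using measurable_sets[OF mm_parametersD(1)[OF \<iota>] msupport_full(1)[OF X]] by (simp add: I_def)
  ultimately show ?thesis
    unfolding box_within_def using \<iota> f(3)
    by (intro conjI bexI[of _ \<iota>] bexI[of _ "f \<circ> \<iota>"] bexI[of _ I]) (auto simp: I_def)
qed

lemma mm_iso_refl: "mm_space X \<Longrightarrow> mm_iso X X"
  unfolding mm_iso_def by (intro bexI[of _ "\<lambda>x. x"]) (auto simp: distr_id2)

lemma mm_class_rep:
  assumes c: "c \<in> mm_classes"
  obtains X0 where "mm_space X0" "c = {Y. mm_space Y \<and> mm_iso X0 Y}" "X0 \<in> c"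
  using c mm_iso_refl unfolding mm_classes_def quotient_def by auto

lemma mm_class_of:
  fixes Y :: "real mm"
  assumes Y: "mm_space Y"
  shows "{Z. mm_space Z \<and> mm_iso Y Z} \<in> mm_classes" "Y \<in> {Z. mm_space Z \<and> mm_iso Y Z}"
proof -
  have eq: "{Z. mm_space Z \<and> mm_iso Y Z} = {(X, Y). mm_space X \<and> mm_space Y \<and> mm_iso X Y} `` {Y}"
    using Y by auto
  show "{Z. mm_space Z \<and> mm_iso Y Z} \<in> mm_classes"
    unfolding mm_classes_def eq by (rule quotientI) (simp add: Y)
  show "Y \<in> {Z. mm_space Z \<and> mm_iso Y Z}" using Y mm_iso_refl by blast
qed

lemma mm_class_member:
  assumes c: "c \<in> mm_classes" and Y: "Y \<in> c"
  shows "mm_space Y"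
  using mm_class_rep[OF c] Y by blast

text \<open>
  Symmetry of \<open>mm_iso\<close> is not needed: two members of a class are compared through the space \<open>X0\<close> that
  generates it.
\<close>

lemma box_dist_same_class:
  assumes c: "c \<in> mm_classes" and Y: "Y \<in> c" and Z: "Z \<in> c"
  shows "box_dist Y Z \<le> 0"
proof -
  obtain X0 :: "real mm" where X0: "mm_space X0" "c = {Y. mm_space Y \<and> mm_iso X0 Y}" using mm_class_rep[OF c] by blast
  have mY: "mm_space Y" and mZ: "mm_space Z" using X0 Y Z by auto
  have "box_dist Y X0 \<le> 0" using X0 Y mY
    by (intro box_dist_le_iff(1)[OF mY X0(1)] box_within_sym[OF box_within_mm_iso[OF X0(1) mY]]) auto
  moreover have "box_dist X0 Z \<le> 0" using X0 Z
    by (intro box_dist_le_iff(1)[OF X0(1) mZ] box_within_mm_iso[OF X0(1) mZ]) auto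
  ultimately show ?thesis using box_dist_triangle[OF mY X0(1) mZ] by simp
qed

lemma box_class_dist_le:
  assumes a: "a \<in> mm_classes" and b: "b \<in> mm_classes" and Y: "Y \<in> a" and Z: "Z \<in> b"
  shows "box_class_dist a b \<le> box_dist Y Z"
proof -
  have A: "(SOME X. X \<in> a) \<in> a" and B: "(SOME X. X \<in> b) \<in> b" using Y Z by (auto intro: someI)
  have "box_dist (SOME X. X \<in> a) (SOME X. X \<in> b) \<le> box_dist (SOME X. X \<in> a) Y + box_dist Y Z + box_dist Z (SOME X. X \<in> b)"
    using box_dist_triangle[OF mm_class_member[OF a A] mm_class_member[OF a Y] mm_class_member[OF b B]]
      box_dist_triangle[OF mm_class_member[OF a Y] mm_class_member[OF b Z] mm_class_member[OF b B]] by simp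
  then show ?thesis
    using box_dist_same_class[OF a A Y] box_dist_same_class[OF b Z B] by (simp add: box_class_dist_def)
qed

lemma box_class_dist_triangle:
  assumes "a \<in> mm_classes" "b \<in> mm_classes" "c \<in> mm_classes"
  shows "box_class_dist a c \<le> box_class_dist a b + box_class_dist b c"
proof -
  have "mm_space (SOME X. X \<in> e)" if e: "e \<in> mm_classes" for e
  proof -
    obtain X0 where "X0 \<in> e" by (rule mm_class_rep[OF e])
    then have "(SOME X. X \<in> e) \<in> e" by (rule someI)
    then show ?thesis by (rule mm_class_member[OF e])
  qed
  then show ?thesis unfolding box_class_dist_def using assms by (intro box_dist_triangle) auto
qed

lemma box_closure_subset:
  assumes P: "P \<subseteq> mm_classes" and Q: "Q \<subseteq> mm_classes"
    and approx: "\<And>a \<epsilon>. a \<in> P \<Longrightarrow> \<epsilon> > 0 \<Longrightarrow> \<exists>b\<in>Q. box_class_dist a b < \<epsilon>"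
  shows "box_closure P \<subseteq> box_closure Q"
proof
  fix c assume c: "c \<in> box_closure P"
  then have cm: "c \<in> mm_classes" by (simp add: box_closure_def)
  have "\<exists>b\<in>Q. box_class_dist c b < \<epsilon>" if \<epsilon>: "\<epsilon> > 0" for \<epsilon>
  proof -
    obtain a where a: "a \<in> P" "box_class_dist c a < \<epsilon> / 2"
      using c half_gt_zero[OF \<epsilon>] unfolding box_closure_def by blast
    obtain b where b: "b \<in> Q" "box_class_dist a b < \<epsilon> / 2" using approx[OF a(1) half_gt_zero[OF \<epsilon>]] by blast
    have "box_class_dist c b \<le> box_class_dist c a + box_class_dist a b"
      using a b P Q cm by (intro box_class_dist_triangle) auto
    then show ?thesis using a b by (intro bexI[of _ b]) auto
  qed
  then show "c \<in> box_closure Q" using cm by (simp add: box_closure_def)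
qed

lemma box_closure_mono: "P \<subseteq> Q \<Longrightarrow> box_closure P \<subseteq> box_closure Q"
  unfolding box_closure_def by blast

section \<open>Sections of sets in an infinite product\<close>

lemma sequence_space_std_gaussian: "sequence_space std_gaussian"
  by (intro sequence_space.intro product_prob_spaceI prob_space_std_gaussian)

context sequence_space
begin

text \<open>Measurable sets that depend on the coordinates below \<open>n\<close> only.\<close>

definition cylinder :: "nat \<Rightarrow> (nat \<Rightarrow> 'a) set \<Rightarrow> bool" where
  "cylinder n A \<longleftrightarrow> A \<in> sets S \<and> (\<forall>x\<in>space S. \<forall>y\<in>space S. (\<forall>i<n. x i = y i) \<longrightarrow> (x \<in> A \<longleftrightarrow> y \<in> A))"

lemma cylinder_mono: "cylinder m A \<Longrightarrow> m \<le> n \<Longrightarrow> cylinder n A"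
  unfolding cylinder_def by (meson less_le_trans)

lemma cylinder_approximation:
  assumes "A \<in> sets S" "\<delta> > 0"
  shows "\<exists>n A'. cylinder n A' \<and> P.prob (sym_diff A A') < \<delta>"
proof -
  have "A \<in> sigma_sets (\<Pi>\<^sub>E i\<in>UNIV. space M) {{f \<in> \<Pi>\<^sub>E i\<in>UNIV. space M. f i \<in> A} | i A. i \<in> (UNIV :: nat set) \<and> A \<in> sets M}"
    using assms(1) unfolding sets_PiM_single .
  then have "\<forall>\<delta>>0. \<exists>n A'. cylinder n A' \<and> P.prob (sym_diff A A') < \<delta>"
  proof (induction rule: sigma_sets.induct)
    case (Basic A)
    then obtain i B where A: "A = {f \<in> \<Pi>\<^sub>E i\<in>UNIV. space M. f i \<in> B}" "B \<in> sets M" by blast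
    have "A = {f \<in> space S. f i \<in> B}" using A by (simp add: space_PiM)
    then have "A \<in> sets S" using A(2) by simp
    then have "cylinder (Suc i) A" using A(1) by (auto simp: cylinder_def space_PiM)
    then show ?case by (intro allI impI exI[of _ "Suc i"] exI[of _ A]) simp
  next
    case Empty
    then show ?case by (intro allI impI exI[of _ 0] exI[of _ "{}"]) (simp add: cylinder_def)
  next
    case (Compl A)
    show ?case
    proof (intro allI impI)
      fix \<delta> :: real assume "\<delta> > 0"
      then obtain n A' where A': "cylinder n A'" "P.prob (sym_diff A A') < \<delta>" using Compl.IH by blast
      have As: "A \<subseteq> space S"
        using Compl.hyps sets.sets_into_space unfolding sets_PiM_single[symmetric] by blast
      have A's: "A' \<subseteq> space S" using A'(1) sets.sets_into_space by (auto simp: cylinder_def)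
      have sp: "(\<Pi>\<^sub>E i\<in>UNIV. space M) = space S" by (simp only: space_PiM)
      have "sym_diff ((\<Pi>\<^sub>E i\<in>UNIV. space M) - A) (space S - A') = sym_diff A A'"
        unfolding sp using As A's by blast
      moreover have "cylinder n (space S - A')" 
      proof -
        have "space S - A' \<in> sets S" using A'(1) by (intro sets.compl_sets) (simp add: cylinder_def)
        then show ?thesis using A'(1) unfolding cylinder_def by blast
      qed
      ultimately show "\<exists>n A'. cylinder n A' \<and> P.prob (sym_diff ((\<Pi>\<^sub>E i\<in>UNIV. space M) - A) A') < \<delta>"
        using A'(2) by (intro exI[of _ n] exI[of _ "space S - A'"]) (simp only: simp_thms)
    qed
  next
    case (Union A)
    have Am: "A j \<in> sets S" for j using Union.hyps unfolding sets_PiM_single by simp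
    show ?case
    proof (intro allI impI)
      fix \<delta> :: real assume \<delta>: "\<delta> > 0"
      have "(\<lambda>N. P.prob (\<Union>j<N. A j)) \<longlonglongrightarrow> P.prob (\<Union>N. \<Union>j<N. A j)"
      proof (rule P.finite_Lim_measure_incseq)
        show "range (\<lambda>N. \<Union>j<N. A j) \<subseteq> sets S" using Am by auto
        show "incseq (\<lambda>N. \<Union>j<N. A j)" by (intro incseq_SucI UN_mono) auto
      qed
      moreover have "(\<Union>N. \<Union>j<N. A j) = (\<Union>j. A j)" by blast
      ultimately have "eventually (\<lambda>N. P.prob (\<Union>j<N. A j) > P.prob (\<Union>j. A j) - \<delta> / 2) sequentially"
        using \<delta> by (intro order_tendstoD(1)) auto
      then obtain N where N: "P.prob (\<Union>j<N. A j) > P.prob (\<Union>j. A j) - \<delta> / 2"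
        by (auto simp: eventually_sequentially)
      have "\<delta> / (2 * (real N + 1)) > 0" using \<delta> by simp
      then have "\<exists>n A'. cylinder n A' \<and> P.prob (sym_diff (A j) A') < \<delta> / (2 * (real N + 1))" for j
        using Union.IH by blast
      then obtain n A' where A': "\<And>j. cylinder (n j) (A' j)" "\<And>j. P.prob (sym_diff (A j) (A' j)) < \<delta> / (2 * (real N + 1))"
        by metis
      have A'm: "A' j \<in> sets S" for j using A'(1) by (simp add: cylinder_def)
      define B where "B = (\<Union>j<N. A' j)"
      define m where "m = (\<Sum>j<N. n j)"
      have cm: "cylinder m (A' j)" if "j < N" for j
        using that unfolding m_def by (intro cylinder_mono[OF A'(1)] member_le_sum) auto
      have "cylinder m B"
        unfolding cylinder_def
      proof (intro conjI ballI impI)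
        show "B \<in> sets S" unfolding B_def using A'm by (intro sets.finite_UN) simp_all
        fix x y assume xy: "x \<in> space S" "y \<in> space S" "\<forall>i<m. x i = y i"
        then have "x \<in> A' j \<longleftrightarrow> y \<in> A' j" if "j < N" for j
          using cm[OF that] unfolding cylinder_def by blast
        then show "x \<in> B \<longleftrightarrow> y \<in> B" by (simp add: B_def)
      qed
      moreover have "P.prob (sym_diff (\<Union>j. A j) B) < \<delta>"
      proof -
        have "P.prob (sym_diff (\<Union>j. A j) B) \<le> P.prob (((\<Union>j. A j) - (\<Union>j<N. A j)) \<union> (\<Union>j<N. sym_diff (A j) (A' j)))"
          using Am A'm by (intro P.finite_measure_mono) (auto simp: B_def)
        also have "\<dots> \<le> P.prob ((\<Union>j. A j) - (\<Union>j<N. A j)) + P.prob (\<Union>j<N. sym_diff (A j) (A' j))"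
          using Am A'm by (intro measure_Un_le) auto
        also have "P.prob ((\<Union>j. A j) - (\<Union>j<N. A j)) = P.prob (\<Union>j. A j) - P.prob (\<Union>j<N. A j)"
          using Am by (intro P.finite_measure_Diff) auto
        also have "P.prob (\<Union>j<N. sym_diff (A j) (A' j)) \<le> (\<Sum>j<N. P.prob (sym_diff (A j) (A' j)))"
          using Am A'm by (intro P.finite_measure_subadditive_finite) auto
        also have "\<dots> \<le> (\<Sum>j<N. \<delta> / (2 * (real N + 1)))"
          using A'(2) by (intro sum_mono less_imp_le) auto
        also have "\<dots> = \<delta> / 2 * (real N / (real N + 1))" by simp
        also have "\<dots> \<le> \<delta> / 2 * 1" using \<delta> by (intro mult_left_mono) auto
        finally show ?thesis using N by simp
      qed
      ultimately show "\<exists>n A'. cylinder n A' \<and> P.prob (sym_diff (\<Union>j. A j) A') < \<delta>" by blast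
    qed
  qed
  then show ?thesis using assms(2) by blast
qed

text \<open>The probability of \<open>A\<close> when the coordinates from \<open>n\<close> on are those of \<open>z\<close>, shifted by \<open>n\<close>.\<close>

abbreviation section_prob :: "nat \<Rightarrow> (nat \<Rightarrow> 'a) \<Rightarrow> (nat \<Rightarrow> 'a) set \<Rightarrow> real" where
  "section_prob n z A \<equiv> P.prob {x \<in> space S. comb_seq n x z \<in> A}"

lemma comb_seq_in_space: "x \<in> space S \<Longrightarrow> z \<in> space S \<Longrightarrow> comb_seq n x z \<in> space S"
  by (auto simp: space_PiM PiE_iff comb_seq_def)

lemma section_sets:
  assumes A [measurable]: "A \<in> sets S" and z [measurable]: "z \<in> space S"
  shows "{x \<in> space S. comb_seq n x z \<in> A} \<in> sets S"
proof -
  have "(\<lambda>x. comb_seq n x z) \<in> measurable S S"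
    by (rule measurable_comb_seq') (use z in auto)
  from measurable_sets[OF this A] have "(\<lambda>x. comb_seq n x z) -` A \<inter> space S \<in> sets S" .
  moreover have "(\<lambda>x. comb_seq n x z) -` A \<inter> space S = {x \<in> space S. comb_seq n x z \<in> A}" by blast
  ultimately show ?thesis by simp
qed

lemma section_prob_measurable:
  assumes A [measurable]: "A \<in> sets S"
  shows "(\<lambda>z. section_prob n z A) \<in> borel_measurable S"
    and "(\<integral>\<^sup>+z. ennreal (section_prob n z A) \<partial>S) = emeasure S A"
proof -
  have eq: "ennreal (section_prob n z A) = (\<integral>\<^sup>+x. indicator A (comb_seq n x z) \<partial>S)" if z: "z \<in> space S" for z
  proof -
    have "(\<integral>\<^sup>+x. indicator A (comb_seq n x z) \<partial>S) = (\<integral>\<^sup>+x. indicator {x \<in> space S. comb_seq n x z \<in> A} x \<partial>S)"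
      by (intro nn_integral_cong) (auto simp: indicator_def)
    also have "\<dots> = emeasure S {x \<in> space S. comb_seq n x z \<in> A}"
      by (rule nn_integral_indicator[OF section_sets[OF A z]])
    finally show ?thesis by (simp add: P.emeasure_eq_measure)
  qed
  have m: "(\<lambda>z. \<integral>\<^sup>+x. indicator A (comb_seq n x z) \<partial>S) \<in> borel_measurable S"
  proof (rule P.borel_measurable_nn_integral)
    have "(\<lambda>w. comb_seq n (snd w) (fst w)) \<in> measurable (S \<Otimes>\<^sub>M S) S"
      by (intro measurable_comb_seq' measurable_fst measurable_snd)
    then have "(\<lambda>w. indicator A (comb_seq n (snd w) (fst w)) :: ennreal) \<in> borel_measurable (S \<Otimes>\<^sub>M S)"
      by (rule measurable_compose) (rule borel_measurable_indicator[OF A])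
    then show "(\<lambda>(z, x). indicator A (comb_seq n x z) :: ennreal) \<in> borel_measurable (S \<Otimes>\<^sub>M S)"
      by (simp add: case_prod_unfold)
  qed
  have eq': "section_prob n z A = enn2real (\<integral>\<^sup>+x. indicator A (comb_seq n x z) \<partial>S)" if z: "z \<in> space S" for z
    by (simp only: eq[OF z, symmetric] enn2real_ennreal measure_nonneg)
  have "(\<lambda>z. enn2real (\<integral>\<^sup>+x. indicator A (comb_seq n x z) \<partial>S)) \<in> borel_measurable S"
    by (rule measurable_compose[OF m]) simp
  then show "(\<lambda>z. section_prob n z A) \<in> borel_measurable S"
    by (subst measurable_cong[OF eq'])
  interpret SS: pair_sigma_finite S S ..
  have "(\<integral>\<^sup>+z. ennreal (section_prob n z A) \<partial>S) = (\<integral>\<^sup>+z. \<integral>\<^sup>+x. indicator A (comb_seq n x z) \<partial>S \<partial>S)"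
    by (intro nn_integral_cong eq)
  also have "\<dots> = (\<integral>\<^sup>+w. (case w of (x, z) \<Rightarrow> indicator A (comb_seq n x z)) \<partial>(S \<Otimes>\<^sub>M S))"
    by (subst SS.nn_integral_snd[symmetric]) auto
  also have "\<dots> = (\<integral>\<^sup>+y. indicator A y \<partial>distr (S \<Otimes>\<^sub>M S) S (\<lambda>(x, z). comb_seq n x z))"
    by (subst nn_integral_distr[OF measurable_comb_seq]) (auto simp: case_prod_unfold)
  also have "\<dots> = emeasure S A" unfolding PiM_comb_seq by simp
  finally show "(\<integral>\<^sup>+z. ennreal (section_prob n z A) \<partial>S) = emeasure S A" .
qed

lemma section_prob_cylinder:
  assumes "cylinder n A" "z \<in> space S"
  shows "section_prob n z A = P.prob A"
proof -
  have "{x \<in> space S. comb_seq n x z \<in> A} = A"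
  proof -
    have "comb_seq n x z \<in> A \<longleftrightarrow> x \<in> A" if "x \<in> space S" for x
      using assms comb_seq_in_space[OF that assms(2)] that
      unfolding cylinder_def by (metis comb_seq_less)
    moreover have "A \<subseteq> space S" using assms sets.sets_into_space by (auto simp: cylinder_def)
    ultimately show ?thesis by blast
  qed
  then show ?thesis by simp
qed

lemma prob_diff_le_sym_diff:
  assumes "prob_space Q" "A \<in> sets Q" "B \<in> sets Q"
  shows "\<bar>measure Q A - measure Q B\<bar> \<le> measure Q (sym_diff A B)"
proof -
  interpret Q: prob_space Q by fact
  have "measure Q A \<le> measure Q (B \<union> sym_diff A B)" "measure Q B \<le> measure Q (A \<union> sym_diff A B)"
    using assms by (auto intro!: Q.finite_measure_mono)
  moreover have "measure Q (B \<union> sym_diff A B) \<le> measure Q B + measure Q (sym_diff A B)"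
    "measure Q (A \<union> sym_diff A B) \<le> measure Q A + measure Q (sym_diff A B)"
    using assms by (auto intro!: measure_Un_le)
  ultimately show ?thesis by simp
qed

text \<open>
  A set that is close in measure to one depending on the first \<open>n\<close> coordinates has, on average over
  \<open>z\<close>, sections of nearly constant probability.
\<close>

lemma section_prob_deviation:
  assumes A: "A \<in> sets S" and A': "cylinder n A'" and d: "P.prob (sym_diff A A') \<le> \<delta>" "\<delta> \<ge> 0"
  shows "(\<integral>\<^sup>+z. ennreal \<bar>section_prob n z A - P.prob A\<bar> \<partial>S) \<le> ennreal (2 * \<delta>)"
proof -
  have A's: "A' \<in> sets S" using A' by (simp add: cylinder_def)
  then have D: "sym_diff A A' \<in> sets S" using A by auto
  have "\<bar>section_prob n z A - P.prob A\<bar> \<le> section_prob n z (sym_diff A A') + \<delta>" if z: "z \<in> space S" for z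
  proof -
    have "\<bar>section_prob n z A - section_prob n z A'\<bar>
      \<le> P.prob (sym_diff {x \<in> space S. comb_seq n x z \<in> A} {x \<in> space S. comb_seq n x z \<in> A'})"
      by (rule prob_diff_le_sym_diff[OF P.prob_space_axioms section_sets[OF A z] section_sets[OF A's z]])
    also have "sym_diff {x \<in> space S. comb_seq n x z \<in> A} {x \<in> space S. comb_seq n x z \<in> A'}
      = {x \<in> space S. comb_seq n x z \<in> sym_diff A A'}" by auto
    finally have "\<bar>section_prob n z A - section_prob n z A'\<bar> \<le> section_prob n z (sym_diff A A')" .
    moreover have "\<bar>P.prob A - P.prob A'\<bar> \<le> \<delta>"
      using prob_diff_le_sym_diff[OF P.prob_space_axioms A A's] d by simp
    ultimately show ?thesis using section_prob_cylinder[OF A' z] by simp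
  qed
  then have "(\<integral>\<^sup>+z. ennreal \<bar>section_prob n z A - P.prob A\<bar> \<partial>S)
     \<le> (\<integral>\<^sup>+z. ennreal (section_prob n z (sym_diff A A')) + ennreal \<delta> \<partial>S)"
    using d(2) by (intro nn_integral_mono) (simp add: ennreal_plus[symmetric] ennreal_leI del: ennreal_plus)
  also have "\<dots> = (\<integral>\<^sup>+z. ennreal (section_prob n z (sym_diff A A')) \<partial>S) + (\<integral>\<^sup>+z. ennreal \<delta> \<partial>S)"
    using section_prob_measurable(1)[OF D] by (intro nn_integral_add) auto
  also have "\<dots> = ennreal (P.prob (sym_diff A A') + \<delta>)"
    unfolding section_prob_measurable(2)[OF D] using d(2)
    by (simp add: P.emeasure_eq_measure P.prob_space)
  also have "\<dots> \<le> ennreal (2 * \<delta>)" using d by (intro ennreal_leI) simp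
  finally show ?thesis .
qed

lemma good_section:
  fixes A :: "nat \<Rightarrow> (nat \<Rightarrow> 'a) set"
  assumes A: "\<And>k. A k \<in> sets S" and E: "E \<in> sets S" "P.prob E = 1" and \<eta>: "\<eta> > 0"
  obtains n z where "n \<ge> 1" "z \<in> space S" "section_prob n z E = 1"
    "(\<Sum>k<K. \<bar>section_prob n z (A k) - P.prob (A k)\<bar>) \<le> \<eta>"
proof -
  define \<delta> where "\<delta> = \<eta> / (4 * (real K + 1))"
  have \<delta>: "\<delta> > 0" using \<eta> by (simp add: \<delta>_def)
  have "\<exists>n A'. cylinder n A' \<and> P.prob (sym_diff (A k) A') < \<delta>" for k
    by (rule cylinder_approximation[OF A \<delta>])
  then obtain m A' where A': "\<And>k. cylinder (m k) (A' k)" "\<And>k. P.prob (sym_diff (A k) (A' k)) < \<delta>" by metis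
  \<comment> \<open>Any common upper bound of the \<open>m k\<close> would do; the successor makes it positive.\<close>
  define n where "n = Suc (\<Sum>k<K. m k)"
  have cy: "cylinder n (A' k)" if "k < K" for k
  proof -
    have "m k \<le> (\<Sum>k<K. m k)" using that by (intro member_le_sum) auto
    then show ?thesis unfolding n_def by (intro cylinder_mono[OF A'(1)]) simp
  qed
  define g where "g z = (\<Sum>k<K. \<bar>section_prob n z (A k) - P.prob (A k)\<bar>)" for z
  have g0: "0 \<le> g z" for z unfolding g_def by (intro sum_nonneg) auto
  have secm: "(\<lambda>z. section_prob n z (A k)) \<in> borel_measurable S" for k by (rule section_prob_measurable(1)[OF A])
  have "(\<integral>\<^sup>+z. ennreal (g z) \<partial>S) = (\<integral>\<^sup>+z. (\<Sum>k<K. ennreal \<bar>section_prob n z (A k) - P.prob (A k)\<bar>) \<partial>S)"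
    unfolding g_def by (simp add: sum_ennreal)
  also have "\<dots> = (\<Sum>k<K. \<integral>\<^sup>+z. ennreal \<bar>section_prob n z (A k) - P.prob (A k)\<bar> \<partial>S)"
    using secm by (intro nn_integral_sum) auto
  also have "\<dots> \<le> (\<Sum>k<K. ennreal (2 * \<delta>))"
    using A'(2) \<delta> by (intro sum_mono section_prob_deviation[OF A cy]) (auto intro: less_imp_le)
  also have "\<dots> = ennreal (real K * (2 * \<delta>))" using \<delta> by (subst sum_ennreal) auto
  also have "\<dots> < ennreal \<eta>"
  proof (rule ennreal_lessI[OF \<eta>])
    have "real K * (2 * \<delta>) = \<eta> * (real K / (2 * (real K + 1)))" by (simp add: \<delta>_def field_simps)
    also have "\<dots> < \<eta> * 1" using \<eta> by (intro mult_strict_left_mono) (simp_all add: divide_simps)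
    finally show "real K * (2 * \<delta>) < \<eta>" by simp
  qed
  finally have gi: "(\<integral>\<^sup>+z. ennreal (g z) \<partial>S) < ennreal \<eta>" .
  have "AE z in S. section_prob n z E = 1"
  proof -
    have i: "integrable S (\<lambda>z. 1 - section_prob n z E)"
      using section_prob_measurable(1)[OF E(1)] P.prob_le_1
      by (intro P.integrable_const_bound[where B = 1]) (auto intro!: AE_I2)
    have s: "integrable S (\<lambda>z. section_prob n z E)"
      using section_prob_measurable(1)[OF E(1)] P.prob_le_1
      by (intro P.integrable_const_bound[where B = 1]) (auto intro!: AE_I2)
    have "(\<integral>z. section_prob n z E \<partial>S) = 1"
      using section_prob_measurable(2)[OF E(1)] E(2) nn_integral_eq_integral[OF s]
      by (simp add: P.emeasure_eq_measure)
    then have "(\<integral>z. 1 - section_prob n z E \<partial>S) = 0"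
      using Bochner_Integration.integral_diff[OF P.integrable_const[of 1] s] P.prob_space by simp
    then have "AE z in S. 1 - section_prob n z E = 0"
      using integral_nonneg_eq_0_iff_AE[OF i] P.prob_le_1 by simp
    then show ?thesis by eventually_elim simp
  qed
  have "\<exists>z\<in>space S. section_prob n z E = 1 \<and> g z \<le> \<eta>"
  proof (rule ccontr)
    assume no: "\<not> (\<exists>z\<in>space S. section_prob n z E = 1 \<and> g z \<le> \<eta>)"
    have "AE z in S. ennreal \<eta> \<le> ennreal (g z)"
      using \<open>AE z in S. section_prob n z E = 1\<close> AE_space
      by eventually_elim (use no in \<open>auto intro!: ennreal_leI\<close>)
    then have "(\<integral>\<^sup>+z. ennreal \<eta> \<partial>S) \<le> (\<integral>\<^sup>+z. ennreal (g z) \<partial>S)" by (rule nn_integral_mono_AE)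
    then show False using gi by (simp add: P.emeasure_space_1)
  qed
  then obtain z where "z \<in> space S" "section_prob n z E = 1" "g z \<le> \<eta>" by blast
  then show ?thesis using that[of n z] by (simp add: n_def g_def)
qed

end

section \<open>Approximation by finite-dimensional Gaussian spaces\<close>

interpretation gauss: sequence_space std_gaussian
  by (rule sequence_space_std_gaussian)

lemma emm_of_sel [simp]:
  "emeas (emm_of Y) = snd Y" "edist (emm_of Y) x y = ennreal (mdist (fst Y) x y)"
  by (simp_all add: emm_of_def)

lemma snd_gaussian_power [simp]: "snd (gaussian_power n) = Pi\<^sub>M {..<n} (\<lambda>_. std_gaussian)"
  by (simp add: gaussian_power_def)

lemma gaussian_power_dominated:
  "emm_of (gaussian_power n) \<prec>\<^sub>L gaussian_infinite_power"
proof -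
  let ?G = "Pi\<^sub>M UNIV (\<lambda>_::nat. std_gaussian)"
  let ?r = "\<lambda>x. restrict x {..<n}"
  have r: "?r \<in> measurable ?G (Pi\<^sub>M {..<n} (\<lambda>_. std_gaussian))"
    by (rule measurable_restrict_subset) simp
  have "distr ?G (Pi\<^sub>M {..<n} (\<lambda>_. std_gaussian)) ?r = Pi\<^sub>M {..<n} (\<lambda>_. std_gaussian)"
    by (rule gauss.distr_PiM_restrict_finite) auto
  moreover have "ennreal (mdist (fst (gaussian_power n)) (?r x) (?r y)) \<le> ell2_edist x y" for x y
  proof (cases "summable (\<lambda>i. (x i - y i)\<^sup>2)")
    case True
    have "mdist (fst (gaussian_power n)) (?r x) (?r y) = sqrt (\<Sum>i<n. (x i - y i)\<^sup>2)"
      by (simp add: mdist_gaussian_power L2_set_def)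
    also have "\<dots> \<le> sqrt (\<Sum>i. (x i - y i)\<^sup>2)"
      using sum_le_suminf[OF True, of "{..<n}"] by simp
    finally show ?thesis using True by (simp add: ell2_edist_def ennreal_leI)
  qed (simp add: ell2_edist_def)
  ultimately show ?thesis
    unfolding dominated_def gaussian_infinite_power_def
    using r gauss.P.emeasure_space_1 by (auto intro!: bexI[of _ ?r] bexI[of _ "space ?G"])
qed

lemma ell2_edist_comb_seq:
  "ell2_edist (comb_seq n x z) (comb_seq n y z) = ennreal (L2_set (\<lambda>i. x i - y i) {..<n})"
proof -
  have 0: "(comb_seq n x z i - comb_seq n y z i)\<^sup>2 = (if i < n then (x i - y i)\<^sup>2 else 0)" for i
    by (simp add: comb_seq_def)
  have "(\<lambda>i. if i < n then (x i - y i)\<^sup>2 else 0) sums (\<Sum>i<n. (x i - y i)\<^sup>2)"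
    using sums_If_finite_set[of "{..<n}" "\<lambda>i. (x i - y i)\<^sup>2"] by simp
  then show ?thesis
    unfolding ell2_edist_def 0 L2_set_def by (simp add: sums_iff)
qed

text \<open>
  The approximating space has the metric of \<open>Y\<close> and, as its measure, the law of a section of the map
  that witnesses \<open>Y \<prec> X\<^sup>\<infinity>\<close>.
\<close>

lemma section_approximation:
  fixes Y :: "'a mm"
  assumes Y: "mm_space Y" and dom: "emm_of Y \<prec>\<^sub>L gaussian_infinite_power" and \<epsilon>: "\<epsilon> > 0"
  obtains n Y' where "n \<ge> 1" "mm_space Y'" "emm_of (Y' :: 'a mm) \<prec>\<^sub>L emm_of (gaussian_power n)" "box_dist Y Y' < \<epsilon>"
proof -
  let ?G = "Pi\<^sub>M UNIV (\<lambda>_::nat. std_gaussian)"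
  obtain \<phi> E where \<phi>: "\<phi> \<in> measurable ?G (snd Y)" "distr ?G (snd Y) \<phi> = snd Y"
    and E: "E \<in> sets ?G" "emeasure ?G E = 1"
    and L: "\<And>x y. x \<in> E \<Longrightarrow> y \<in> E \<Longrightarrow> ennreal (mdist (fst Y) (\<phi> x) (\<phi> y)) \<le> ell2_edist x y"
    using dom unfolding dominated_def gaussian_infinite_power_def emm_of_sel emm.select_convs by blast
  have E1: "measure ?G E = 1" using E(2) by (simp add: measure_def)
  define \<delta> where "\<delta> = \<epsilon> / 3"
  have \<delta>: "\<delta> > 0" using \<epsilon> by (simp add: \<delta>_def)
  obtain A :: "nat \<Rightarrow> 'a set" and K where A: "\<And>k. A k \<in> sets (snd Y)" "disjoint_family A"
    and diam: "\<And>k x y. x \<in> A k \<Longrightarrow> y \<in> A k \<Longrightarrow> mdist (fst Y) x y \<le> \<delta>"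
    and mass: "(\<Sum>k<K. measure (snd Y) (A k)) > 1 - \<delta>"
    using fine_partition[OF Y \<delta>] by blast
  define C where "C k = \<phi> -` A k \<inter> space ?G" for k
  have C: "C k \<in> sets ?G" for k unfolding C_def by (rule measurable_sets[OF \<phi>(1) A(1)])
  have mC: "measure ?G (C k) = measure (snd Y) (A k)" for k
    using measure_distr[OF \<phi>(1) A(1)] \<phi>(2) by (simp add: C_def)
  obtain n z where n: "n \<ge> 1" and z: "z \<in> space ?G"
    and zE: "measure ?G {x \<in> space ?G. comb_seq n x z \<in> E} = 1"
    and zC: "(\<Sum>k<K. \<bar>measure ?G {x \<in> space ?G. comb_seq n x z \<in> C k} - measure ?G (C k)\<bar>) \<le> \<delta>"
    by (rule gauss.good_section[where A = C and E = E and \<eta> = \<delta> and K = K, OF C E(1) E1 \<delta>]) (rule that)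
  let ?Gn = "Pi\<^sub>M {..<n} (\<lambda>_. std_gaussian)"
  define \<psi> where "\<psi> x = \<phi> (comb_seq n x z)" for x
  have czm: "(\<lambda>x. comb_seq n x z) \<in> measurable ?G ?G"
    by (rule measurable_comb_seq') (use z in auto)
  have \<psi>G: "\<psi> \<in> measurable ?G (snd Y)"
    unfolding \<psi>_def[abs_def] by (rule measurable_compose[OF czm \<phi>(1)])
  have spn: "space ?Gn = extensional {..<n}" by (simp add: space_PiM PiE_def)
  have cn: "(\<lambda>x. comb_seq n x z) \<in> measurable ?Gn ?G"
  proof (rule measurable_PiM_single')
    fix i :: nat
    show "(\<lambda>x. comb_seq n x z i) \<in> measurable ?Gn std_gaussian"
    proof (cases "i < n")
      case True
      then show ?thesis using measurable_component_singleton[of i "{..<n}" "\<lambda>_. std_gaussian"]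
        by (simp add: comb_seq_def)
    qed (simp add: comb_seq_def)
  qed (auto simp: space_PiM)
  have \<psi>n: "\<psi> \<in> measurable ?Gn (snd Y)"
    unfolding \<psi>_def[abs_def] by (rule measurable_compose[OF cn \<phi>(1)])
  let ?r = "\<lambda>x. restrict x {..<n}"
  have r: "?r \<in> measurable ?G ?Gn" by (rule measurable_restrict_subset) simp
  have dr: "distr ?G ?Gn ?r = ?Gn" by (rule gauss.distr_PiM_restrict_finite) auto
  have cr: "comb_seq n (?r x) z = comb_seq n x z" for x by (auto simp: comb_seq_def)
  define m' where "m' = distr ?G (snd Y) \<psi>"
  have m'n: "distr ?Gn (snd Y) \<psi> = m'"
  proof -
    have "distr ?Gn (snd Y) \<psi> = distr ?G (snd Y) (\<psi> \<circ> ?r)"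
      using distr_distr[OF \<psi>n r] by (simp only: dr)
    also have "\<psi> \<circ> ?r = \<psi>" by (auto simp: \<psi>_def cr)
    finally show ?thesis by (simp add: m'_def)
  qed
  define Y' where "Y' = (fst Y, m')"
  have Y': "mm_space Y'"
    using Y gauss.P.prob_space_distr[OF \<psi>G] by (simp add: mm_space_def Y'_def m'_def)
  have Y'dom: "emm_of Y' \<prec>\<^sub>L emm_of (gaussian_power n)"
  proof -
    define E' where "E' = (\<lambda>x. comb_seq n x z) -` E \<inter> space ?Gn"
    have E': "E' \<in> sets ?Gn" unfolding E'_def by (rule measurable_sets[OF cn E(1)])
    have "measure ?Gn E' = measure ?G (?r -` E' \<inter> space ?G)"
      using measure_distr[OF r E'] by (simp only: dr)
    also have "?r -` E' \<inter> space ?G = {x \<in> space ?G. comb_seq n x z \<in> E}"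
      by (auto simp: E'_def cr spn)
    finally have "measure ?Gn E' = 1" using zE by simp
    then have E'1: "emeasure ?Gn E' = 1"
      by (metis emeasure_eq_ennreal_measure ennreal_1 ennreal_top_neq_one measure_zero_top zero_neq_one)
    have "ennreal (mdist (fst Y) (\<psi> x) (\<psi> y)) \<le> ennreal (mdist (fst (gaussian_power n)) x y)"
      if "x \<in> E'" "y \<in> E'" for x y
      using L[of "comb_seq n x z" "comb_seq n y z"] that
      by (simp add: \<psi>_def E'_def ell2_edist_comb_seq mdist_gaussian_power)
    moreover have "\<psi> \<in> measurable ?Gn m'" using \<psi>n by (simp add: m'_def)
    moreover have "distr ?Gn m' \<psi> = m'"
      using m'n distr_cong[of ?Gn ?Gn m' "snd Y" \<psi> \<psi>] by (simp add: m'_def)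
    ultimately show ?thesis
      unfolding dominated_def emm_of_sel snd_gaussian_power using E' E'1
      by (intro bexI[of _ \<psi>] conjI bexI[of _ E']) (auto simp: Y'_def)
  qed
  have "box_within Y Y' (2 * \<delta>)"
  proof (rule box_within_same_metric[where A = A and K = K, OF Y Y' _ A diam])
    have "measure (snd Y') (A k) = measure ?G {x \<in> space ?G. comb_seq n x z \<in> C k}" for k
    proof -
      have "measure (snd Y') (A k) = measure ?G (\<psi> -` A k \<inter> space ?G)"
        unfolding Y'_def m'_def using measure_distr[OF \<psi>G A(1)] by simp
      also have "\<psi> -` A k \<inter> space ?G = {x \<in> space ?G. comb_seq n x z \<in> C k}"
        using measurable_space[OF czm] by (auto simp: \<psi>_def C_def)
      finally show ?thesis .
    qed
    then show "(\<Sum>k<K. \<bar>measure (snd Y') (A k) - measure (snd Y) (A k)\<bar>) \<le> \<delta>"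
      using zC by (simp add: mC)
  qed (use mass \<delta> in \<open>auto simp: Y'_def\<close>)
  then have "box_dist Y Y' \<le> 2 * \<delta>" by (rule box_dist_le_iff(1)[OF Y Y'])
  then have "box_dist Y Y' < \<epsilon>" using \<epsilon> by (simp add: \<delta>_def)
  then show ?thesis using that n Y' Y'dom by blast
qed

section \<open>Equality of the three closures\<close>

theorem corollary1p10:
  fixes i :: "'h::{real_inner, complete_space, second_countable_topology}
                \<Rightarrow> 'w::{banach, second_countable_topology}"
    and \<mu> :: "'w measure"
  assumes "abstract_wiener_space i \<mu>"
    and "\<nexists>B. finite B \<and> span B = (UNIV :: 'h set)"
  shows "box_closure (pyramid (wiener_emm i \<mu>)) = box_closure (pyramid gaussian_infinite_power)
    \<and> box_closure (pyramid gaussian_infinite_power)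
        = box_closure (\<Union>n\<in>{1..}. pyramid (emm_of (gaussian_power n)))"
proof
  have pW: "prob_space (emeas (wiener_emm i \<mu>))"
    using assms(1) by (simp add: wiener_emm_def abstract_wiener_space_def)
  have pG: "prob_space (emeas gaussian_infinite_power)"
    unfolding gaussian_infinite_power_def using gauss.P.prob_space_axioms by simp
  have "pyramid (wiener_emm i \<mu>) = pyramid gaussian_infinite_power"
    using pyramid_mono[OF wiener_equiv_gaussian_infinite_power(1)[OF assms] pW]
      pyramid_mono[OF wiener_equiv_gaussian_infinite_power(2)[OF assms] pG] by simp
  then show "box_closure (pyramid (wiener_emm i \<mu>)) = box_closure (pyramid gaussian_infinite_power)"
    by simp
  let ?Q = "\<Union>n\<in>{1..}. pyramid (emm_of (gaussian_power n))"
  show "box_closure (pyramid gaussian_infinite_power) = box_closure ?Q"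
  proof
    show "box_closure ?Q \<subseteq> box_closure (pyramid gaussian_infinite_power)"
      using pyramid_mono[OF gaussian_power_dominated pG] by (intro box_closure_mono) blast
    show "box_closure (pyramid gaussian_infinite_power) \<subseteq> box_closure ?Q"
    proof (rule box_closure_subset)
      fix a and \<epsilon> :: real
      assume a: "a \<in> pyramid gaussian_infinite_power" and \<epsilon>: "\<epsilon> > 0"
      then obtain Y where Y: "a \<in> mm_classes" "Y \<in> a" "emm_of Y \<prec>\<^sub>L gaussian_infinite_power"
        by (auto simp: pyramid_def)
      obtain n and Y' :: "real mm" where n: "n \<ge> 1" and Y': "mm_space Y'"
        "emm_of Y' \<prec>\<^sub>L emm_of (gaussian_power n)" "box_dist Y Y' < \<epsilon>"
        using section_approximation[OF mm_class_member[OF Y(1,2)] Y(3) \<epsilon>] by blast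
      define b :: "real mm set" where "b = {Z. mm_space Z \<and> mm_iso Y' Z}"
      have b: "b \<in> mm_classes" "Y' \<in> b" using mm_class_of[OF Y'(1)] by (simp_all only: b_def)
      have "box_class_dist a b < \<epsilon>" using box_class_dist_le[OF Y(1) b(1) Y(2) b(2)] Y'(3) by simp
      moreover have "b \<in> ?Q" using b n Y'(2) by (auto simp: pyramid_def)
      ultimately show "\<exists>b\<in>?Q. box_class_dist a b < \<epsilon>" by blast
    qed (auto simp: pyramid_def)
  qed
qed

end
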